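(* A compactly supported probability distribution $\mu$ on $\mathbb{R}$ belongs to $\mathcal{M}_{\mathrm{ratio}}^{\mathrm{fid}}$ if and only if there exist $u\in\mathbb{R}$, $c_0\ge0$, an integer $r\ge0$, $c_1,\ldots,c_r>0$ and distinct $u_1,\ldots,u_r\in\mathbb{R}\setminus\{0\}$ such that \[ \mu=\delta_u\boxplus\mathrm{W}(c_0)\boxplus\mathrm{MP}(u_1,c_1)\boxplus\ldots\boxplus\mathrm{MP}(u_r,c_r), \] so that \[ R_\mu(w)=uw+c_0w^2+\sum_{k=1}^{r}\frac{c_ku_kw}{1-u_kw}. \] Such a decomposition is unique (up to reordering the pairs $(u_k,c_k)$).
   Context: For a compactly supported probability distribution $\mu$ on $\mathbb{R}$ let $M_\mu(z)=\int_{\mathbb{R}}\frac{\mu(dx)}{1-xz}$ for $z$ near $0$. The free $R$-transform $R_\mu$ is the analytic function near $0$ determined by $1+R_\mu(zM_\mu(z))=M_\mu(z)$ for $z$ near $0$. The additive free convolution $\mu_1\boxplus\mu_2$ is the unique compactly supported probability distribution with $R_{\mu_1\boxplus\mu_2}=R_{\mu_1}+R_{\mu_2}$, and $\mu^{\boxplus n}$ denotes the $n$-fold free convolution. $\mu$ is freely infinitely divisible if for every $n\in\mathbb{N}$ there is a compactly supported probability distribution $\mu_n$ with $\mu=\mu_n^{\boxplus n}$. $\mathcal{M}_{\mathrm{ratio}}^{\mathrm{fid}}$ is the class of compactly supported probability distributions $\mu$ on $\mathbb{R}$ which are freely infinitely divisible and for which $R_\mu(w)$ is a rational function. $\delta_u$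 is the point mass at $u$. For $v\in\mathbb{R}\setminus\{0\}$, $t>0$, the Marchenko–Pastur law is $\mathrm{MP}(v,t)=\max\{1-t,0\}\delta_0+\frac{1}{|v|}f_t(x/v)\,dx$, where $f_t(x)=\frac{\sqrt{4t-(x-1-t)^2}}{2\pi x}$ if $(x-1-t)^2<4t$ and $f_t(x)=0$ otherwise. For $t>0$ the Wigner law is $\mathrm{W}(t)=\frac{1}{2\pi t}\sqrt{4t-x^2}\,\mathbf{1}_{[-2\sqrt t,2\sqrt t]}(x)\,dx$; $\mathrm{W}(0):=\delta_0$. Their free $R$-transforms are $R_{\delta_u}(w)=uw$, $R_{\mathrm{MP}(v,t)}(w)=\frac{tvw}{1-vw}$, $R_{\mathrm{W}(t)}(w)=tw^2$. *)

theory Defs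
  imports "HOL-Probability.Probability" "HOL-Complex_Analysis.Complex_Analysis"
begin

definition compact_distr :: "real measure \<Rightarrow> bool" where
  "compact_distr \<mu> \<longleftrightarrow>
     prob_space \<mu> \<and> sets \<mu> = sets borel \<and> (\<exists>K. compact K \<and> (AE x in \<mu>. x \<in> K))"

definition M_transform :: "real measure \<Rightarrow> complex \<Rightarrow> complex" where
  "M_transform \<mu> z = (\<integral>x. 1 / (1 - complex_of_real x * z) \<partial>\<mu>)"

text \<open>The free R-transform is determined only as a germ at 0; \<open>R_transform \<mu>\<close> is an arbitrary
  representative. All statements about it below are therefore made near 0.\<close>

definition R_transform :: "real measure \<Rightarrow> complex \<Rightarrow> complex" where
  "R_transform \<mu> = (SOME R. R analytic_on {0} \<and>
     (\<forall>\<^sub>F z in nhds 0. 1 + R (z * M_transform \<mu> z) = M_transform \<mu> z))"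

definition is_free_conv :: "real measure \<Rightarrow> real measure \<Rightarrow> real measure \<Rightarrow> bool" where
  "is_free_conv \<mu>\<^sub>1 \<mu>\<^sub>2 \<mu> \<longleftrightarrow>
     compact_distr \<mu>\<^sub>1 \<and> compact_distr \<mu>\<^sub>2 \<and> compact_distr \<mu> \<and>
     (\<forall>\<^sub>F w in nhds 0. R_transform \<mu> w = R_transform \<mu>\<^sub>1 w + R_transform \<mu>\<^sub>2 w)"

text \<open>The free convolution of two compactly supported probability distributions always exists and
  is unique. HOL functions being total, a value is also needed where \<open>is_free_conv\<close> has no solution
  (that is, for other arguments): the zero measure, which is not a probability distribution.\<close>

definition free_conv :: "real measure \<Rightarrow> real measure \<Rightarrow> real measure" (infixl \<open>\<boxplus>\<close> 65) where
  "\<mu>\<^sub>1 \<boxplus> \<mu>\<^sub>2 = (if \<exists>\<mu>. is_free_conv \<mu>\<^sub>1 \<mu>\<^sub>2 \<mu>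
     then (THE \<mu>. is_free_conv \<mu>\<^sub>1 \<mu>\<^sub>2 \<mu>) else null_measure borel)"

abbreviation point_mass :: "real \<Rightarrow> real measure" where
  "point_mass u \<equiv> return borel u"

text \<open>The point mass at 0 is neutral for \<open>\<boxplus>\<close>.\<close>

primrec free_conv_power :: "real measure \<Rightarrow> nat \<Rightarrow> real measure" where
  "free_conv_power \<mu> 0 = point_mass 0"
| "free_conv_power \<mu> (Suc n) = free_conv_power \<mu> n \<boxplus> \<mu>"

definition freely_inf_divisible :: "real measure \<Rightarrow> bool" where
  "freely_inf_divisible \<mu> \<longleftrightarrow>
     (\<forall>n\<ge>1. \<exists>\<nu>. compact_distr \<nu> \<and> \<mu> = free_conv_power \<nu> n)"

definition rational_near_0 :: "(complex \<Rightarrow> complex) \<Rightarrow> bool" where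
  "rational_near_0 f \<longleftrightarrow>
     (\<exists>p q :: complex poly. q \<noteq> 0 \<and> (\<forall>\<^sub>F w in at 0. f w = poly p w / poly q w))"

definition M_ratio_fid :: "real measure set" where
  "M_ratio_fid = {\<mu>. compact_distr \<mu> \<and> freely_inf_divisible \<mu> \<and> rational_near_0 (R_transform \<mu>)}"

definition MP_density :: "real \<Rightarrow> real \<Rightarrow> real" where
  "MP_density t x =
     (if (x - 1 - t)\<^sup>2 < 4 * t then sqrt (4 * t - (x - 1 - t)\<^sup>2) / (2 * pi * x) else 0)"

definition MP :: "real \<Rightarrow> real \<Rightarrow> real measure" where
  "MP v t = measure_of UNIV (sets borel)
     (\<lambda>A. ennreal (max (1 - t) 0) * emeasure (point_mass 0) A +
          emeasure (density lborel (\<lambda>x. ennreal (1 / \<bar>v\<bar> * MP_density t (x / v)))) A)"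

lemma sets_MP [simp]: "sets (MP v t) = sets borel"
  unfolding MP_def using sets.sigma_sets_eq[of "borel :: real measure"] by simp

lemma emeasure_MP:
  assumes "A \<in> sets borel"
  shows "emeasure (MP v t) A = ennreal (max (1 - t) 0) * emeasure (point_mass 0) A +
     emeasure (density lborel (\<lambda>x. ennreal (1 / \<bar>v\<bar> * MP_density t (x / v)))) A"
proof (rule emeasure_measure_of[OF MP_def])
  show "countably_additive (sets (MP v t))
     (\<lambda>A. ennreal (max (1 - t) 0) * emeasure (point_mass 0) A +
          emeasure (density lborel (\<lambda>x. ennreal (1 / \<bar>v\<bar> * MP_density t (x / v)))) A)"
  proof (rule countably_additiveI)
    fix F :: "nat \<Rightarrow> real set"
    assume F: "range F \<subseteq> sets (MP v t)" "disjoint_family F" "\<Union> (range F) \<in> sets (MP v t)"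
    show "(\<Sum>i. ennreal (max (1 - t) 0) * emeasure (point_mass 0) (F i) +
          emeasure (density lborel (\<lambda>x. ennreal (1 / \<bar>v\<bar> * MP_density t (x / v)))) (F i)) =
        ennreal (max (1 - t) 0) * emeasure (point_mass 0) (\<Union> (range F)) +
          emeasure (density lborel (\<lambda>x. ennreal (1 / \<bar>v\<bar> * MP_density t (x / v)))) (\<Union> (range F))"
      using F by (subst suminf_add[symmetric]) (auto simp: suminf_emeasure simp del: emeasure_return)
  qed
qed (use assms in \<open>auto simp: positive_def\<close>)

definition Wigner :: "real \<Rightarrow> real measure" where
  "Wigner t = (if t = 0 then point_mass 0 else
     density lborel (\<lambda>x. ennreal (1 / (2 * pi * t) * sqrt (4 * t - x\<^sup>2) *
       indicator {- 2 * sqrt t .. 2 * sqrt t} x)))"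

text \<open>The list \<open>ps\<close> consists of the pairs \<open>(u\<^sub>k, c\<^sub>k)\<close>, \<open>k = 1, \<dots>, r\<close>, where \<open>r = length ps\<close>.\<close>

definition free_decomposition ::
    "real measure \<Rightarrow> real \<Rightarrow> real \<Rightarrow> (real \<times> real) list \<Rightarrow> bool" where
  "free_decomposition \<mu> u c\<^sub>0 ps \<longleftrightarrow>
     c\<^sub>0 \<ge> 0 \<and> (\<forall>(v, c)\<in>set ps. v \<noteq> 0 \<and> c > 0) \<and> distinct (map fst ps) \<and>
     \<mu> = foldl (\<lambda>\<nu> (v, c). \<nu> \<boxplus> MP v c) (point_mass u \<boxplus> Wigner c\<^sub>0) ps"

end

theory Submission
  imports Defs "HOL-Computational_Algebra.Fundamental_Theorem_Algebra"
begin

text \<open>All transforms are handled as power series at 0: the R-series of a compactly supported law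
  determines its moments and hence the law, and \<open>\<boxplus>\<close> adds R-series.

  If \<open>\<mu>\<close> is the \<open>N\<close>-fold convolution of \<open>\<mu>\<^sub>N\<close>, the \<open>m\<close>-th free cumulant of \<open>\<mu>\<close> is the limit of \<open>N\<close> times
  the \<open>m\<close>-th moment of \<open>\<mu>\<^sub>N\<close>. So the cumulants from the second on form a positive definite sequence; when
  \<open>R\<close> is rational they satisfy a linear recurrence, and a positive functional on polynomials with a
  nonzero null element is a finite sum of point evaluations. The atom at 0 gives the Wigner part, the others
  the Marchenko--Pastur parts.

  Conversely, a law with \<open>R w = a w + (\<Sum>q w\<^sup>2 / (1 - v w))\<close> must exist for all weights \<open>q \<ge> 0\<close>: iterating
  \<open>H z \<mapsto> (\<Sum>q / (z - a - v - H z))\<close> from \<open>0\<close> produces Cauchy transforms of finite atomic measures with uniformly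
  bounded supports, and the law is a weak limit point of the laws with Cauchy transform \<open>1 / (z - a - H z)\<close>.\<close>

section \<open>The R-transform as a power series\<close>

text \<open>Working with coefficients removes the choice hidden in \<open>R_transform\<close>: germs
  at 0 agree exactly when their series do. What remains difficult is existence. As
  \<open>\<boxplus>\<close> has a default value, a convolution can be evaluated only once a law with
  the required R-series is known to exist. This is proved only for R-series of the form in the
  theorem, which are closed under sums and nonnegative multiples; they cover every partial
  convolution and fractional power needed for the converse.

  All parts fall under one formula by
  \<open>c v w / (1 - v w) = c v w + c v^2 w^2 / (1 - v w)\<close>: the Wigner part is the node
  \<open>v = 0\<close>, the other nodes carry weight \<open>q = c v^2\<close>, and the linear terms
  go into \<open>a\<close>. The iteration comes from the R-equation: with \<open>w = z M z\<close>
  and \<open>y = 1 / z\<close> it reads \<open>1 / w + R w / w = y\<close>, that is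
  \<open>1 / w = y - a - H\<close>, where \<open>H\<close> is the sum of
  \<open>q / (1 / w - v)\<close>, hence of \<open>q / (y - a - v - H)\<close>.\<close>

lemma compact_distrI:
  assumes "prob_space \<mu>" "sets \<mu> = sets borel" "AE x in \<mu>. \<bar>x\<bar> \<le> K"
  shows "compact_distr \<mu>"
  unfolding compact_distr_def
proof (intro conjI exI[of _ "{-K..K}"])
  show "AE x in \<mu>. x \<in> {-K..K}" using assms(3) by eventually_elim auto
qed (use assms in auto)

lemma compact_distrE:
  assumes "compact_distr \<mu>"
  obtains K where "K > 0" "real_distribution \<mu>" "AE x in \<mu>. \<bar>x\<bar> \<le> K"
proof -
  obtain C where C: "compact C" "AE x in \<mu>. x \<in> C"
    using assms by (auto simp: compact_distr_def)
  obtain K where K: "K > 0" "\<And>x. x \<in> C \<Longrightarrow> norm x \<le> K"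
    using compact_imp_bounded[OF C(1)] by (auto simp: bounded_pos)
  show ?thesis
  proof (rule that[OF K(1)])
    show "real_distribution \<mu>"
      using assms by (auto simp: compact_distr_def real_distribution_def real_distribution_axioms_def)
    show "AE x in \<mu>. \<bar>x\<bar> \<le> K" using C(2) by eventually_elim (use K(2) in auto)
  qed
qed

lemma compact_distr_integrable_power:
  assumes "compact_distr \<mu>"
  shows "integrable \<mu> (\<lambda>x. x ^ n)"
proof -
  obtain K where K: "K > 0" "real_distribution \<mu>" "AE x in \<mu>. \<bar>x\<bar> \<le> K"
    using assms by (rule compact_distrE)
  interpret real_distribution \<mu> by fact
  show ?thesis
    by (rule integrable_const_bound[of _ "K ^ n"])
       (use K(3) in \<open>auto simp: power_abs elim!: eventually_mono intro: power_mono\<close>)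
qed

text \<open>The factor \<open>X\<close> makes the composition triangular: the \<open>i\<close>-th
  term involves \<open>M\<close> only up to index \<open>n - i\<close>. Uniqueness and the limit of
  the scaled moments both rest on this.\<close>

lemma fps_nth_compose_X_mult:
  fixes F M :: "'a :: idom fps"
  shows "fps_nth (F oo (fps_X * M)) n = (\<Sum>i\<le>n. fps_nth F i * fps_nth (M ^ i) (n - i))"
proof -
  have "fps_nth ((fps_X * M) ^ i) n = fps_nth (M ^ i) (n - i)" if "i \<le> n" for i
    using that by (simp add: power_mult_distrib fps_X_power_mult_nth)
  thus ?thesis by (simp add: fps_compose_nth atLeast0AtMost)
qed

section \<open>Moment series and R-series\<close>

definition fps_M :: "real measure \<Rightarrow> complex fps" where
  "fps_M \<mu> = Abs_fps (\<lambda>n. complex_of_real (\<integral>x. x ^ n \<partial>\<mu>))"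

text \<open>The equation \<open>1 + R (z M z) = M z\<close> solved for \<open>R\<close>: as the
  moment series of a law begins with 1, \<open>X * M\<close> has a compositional inverse.\<close>

definition fps_R :: "real measure \<Rightarrow> complex fps" where
  "fps_R \<mu> = (fps_M \<mu> - 1) oo fps_inv (fps_X * fps_M \<mu>)"

lemma fps_M_nth: "fps_nth (fps_M \<mu>) n = complex_of_real (\<integral>x. x ^ n \<partial>\<mu>)"
  by (simp add: fps_M_def)

lemma fps_M_0:
  assumes "compact_distr \<mu>"
  shows "fps_nth (fps_M \<mu>) 0 = 1"
  using assms by (simp add: fps_M_nth compact_distr_def prob_space.prob_space)

lemma AE_norm_mult_le_half:
  assumes K: "AE x in \<mu>. \<bar>x\<bar> \<le> K" and z: "K * norm z \<le> 1 / 2"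
  shows "AE x in \<mu>. norm (complex_of_real x * z) \<le> 1 / 2"
  using K
  proof eventually_elim
  case (elim x)
  have "norm (complex_of_real x * z) \<le> K * norm z"
    using elim by (auto simp: norm_mult intro: mult_right_mono)
  thus ?case using z by linarith
qed

lemma norm_one_minus_ge_half:
  fixes w :: complex
  assumes "norm w \<le> 1 / 2"
  shows "norm (1 - w) \<ge> 1 / 2"
  using norm_triangle_ineq2[of 1 w] assms by simp

lemma M_transform_integrable:
  assumes \<mu>: "compact_distr \<mu>" and K: "AE x in \<mu>. \<bar>x\<bar> \<le> K" and z: "K * norm z \<le> 1 / 2"
  shows "integrable \<mu> (\<lambda>x. 1 / (1 - complex_of_real x * z))"
proof -
  interpret real_distribution \<mu> using compact_distrE[OF \<mu>] by metis
  show ?thesis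
  proof (rule integrable_const_bound[of _ 2])
    show "AE x in \<mu>. norm (1 / (1 - complex_of_real x * z)) \<le> 2"
      using AE_norm_mult_le_half[OF K z]
    proof eventually_elim
      case (elim x)
      have "1 / norm (1 - complex_of_real x * z) \<le> 1 / (1 / 2)"
        by (intro frac_le norm_one_minus_ge_half elim) auto
      thus ?case by (simp add: norm_divide)
    qed
  qed auto
qed

text \<open>Geometric series under the integral: the integrand \<open>1 / (1 - x z)\<close> differs
  from its partial sums by at most \<open>2 * (1 / 2) ^ N\<close> almost everywhere, and the bound
  survives integration.\<close>

lemma M_transform_sums:
  assumes \<mu>: "compact_distr \<mu>" and K: "AE x in \<mu>. \<bar>x\<bar> \<le> K" and z: "K * norm z \<le> 1 / 2"
  shows "(\<lambda>n. fps_nth (fps_M \<mu>) n * z ^ n) sums M_transform \<mu> z"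
proof -
  interpret real_distribution \<mu> using compact_distrE[OF \<mu>] by metis
  note bd = AE_norm_mult_le_half[OF K z]
  note den = norm_one_minus_ge_half
  note intM = M_transform_integrable[OF \<mu> K z]
  have int: "integrable \<mu> (\<lambda>x. (complex_of_real x * z) ^ n)" for n
    unfolding power_mult_distrib
    by (intro integrable_mult_left)
       (use compact_distr_integrable_power[OF \<mu>] in \<open>simp del: of_real_power add: of_real_power[symmetric]\<close>)
  have eq: "(\<Sum>n<N. fps_nth (fps_M \<mu>) n * z ^ n) = (\<integral>x. (\<Sum>n<N. (complex_of_real x * z) ^ n) \<partial>\<mu>)" for N
    using int by (subst Bochner_Integration.integral_sum)
      (auto simp: fps_M_nth power_mult_distrib simp del: of_real_power simp: of_real_power[symmetric])
  have "norm ((\<Sum>n<N. fps_nth (fps_M \<mu>) n * z ^ n) - M_transform \<mu> z) \<le> 2 * (1 / 2) ^ N" for N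
  proof -
    have "(\<Sum>n<N. fps_nth (fps_M \<mu>) n * z ^ n) - M_transform \<mu> z =
      (\<integral>x. (\<Sum>n<N. (complex_of_real x * z) ^ n) - 1 / (1 - complex_of_real x * z) \<partial>\<mu>)"
      unfolding eq M_transform_def using int intM
      by (subst Bochner_Integration.integral_diff) auto
    also have "norm \<dots> \<le> (\<integral>x. 2 * (1 / 2) ^ N \<partial>\<mu>)"
    proof (rule order.trans[OF integral_norm_bound integral_mono_AE])
      show "AE x in \<mu>. norm ((\<Sum>n<N. (complex_of_real x * z) ^ n) - 1 / (1 - complex_of_real x * z))
              \<le> 2 * (1 / 2) ^ N"
        using bd
      proof eventually_elim
        case (elim x)
        let ?w = "complex_of_real x * z"
        have "1 - ?w \<noteq> 0" using den[OF elim] by auto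
        hence "(\<Sum>n<N. ?w ^ n) = (1 - ?w ^ N) / (1 - ?w)"
          by (subst sum_gp_strict) auto
        hence "(\<Sum>n<N. ?w ^ n) - 1 / (1 - ?w) = - (?w ^ N / (1 - ?w))"
          by (simp add: diff_divide_distrib)
        also have "norm \<dots> = norm ?w ^ N / norm (1 - ?w)"
          by (simp add: norm_divide norm_power)
        also have "\<dots> \<le> (1 / 2) ^ N / (1 / 2)"
          by (intro frac_le power_mono elim den) auto
        finally show ?case by simp
      qed
      show "integrable \<mu> (\<lambda>x. norm ((\<Sum>n<N. (complex_of_real x * z) ^ n) - 1 / (1 - complex_of_real x * z)))"
        by (intro integrable_norm Bochner_Integration.integrable_diff Bochner_Integration.integrable_sum int intM)
    qed simp
    finally show ?thesis using prob_space by simp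
  qed
  moreover have "(\<lambda>N. 2 * (1 / 2 :: real) ^ N) \<longlonglongrightarrow> 0" by real_asymp
  ultimately have "(\<lambda>N. (\<Sum>n<N. fps_nth (fps_M \<mu>) n * z ^ n) - M_transform \<mu> z) \<longlonglongrightarrow> 0"
    using Lim_null_comparison[OF always_eventually,
      of "\<lambda>N. (\<Sum>n<N. fps_nth (fps_M \<mu>) n * z ^ n) - M_transform \<mu> z" "\<lambda>N. 2 * (1 / 2) ^ N"]
    by blast
  thus ?thesis unfolding sums_def by (simp add: LIM_zero_iff)
qed

lemma M_transform_has_fps_expansion:
  assumes \<mu>: "compact_distr \<mu>"
  shows "M_transform \<mu> has_fps_expansion fps_M \<mu>"
proof (rule has_fps_expansionI)
  obtain K where K: "K > 0" "real_distribution \<mu>" "AE x in \<mu>. \<bar>x\<bar> \<le> K"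
    using assms by (rule compact_distrE)
  have "\<forall>\<^sub>F z in nhds 0. z \<in> ball (0::complex) (1 / (2 * K))"
    using K(1) by (intro eventually_nhds_in_open) auto
  thus "\<forall>\<^sub>F z in nhds 0. (\<lambda>n. fps_nth (fps_M \<mu>) n * z ^ n) sums M_transform \<mu> z"
    proof eventually_elim
    case (elim z)
    hence "K * norm z \<le> 1 / 2" using K(1) by (simp add: field_simps)
    thus ?case by (rule M_transform_sums[OF \<mu> K(3)])
  qed
qed

lemma eq_near_0_iff_fps_eq:
  fixes f g :: "complex \<Rightarrow> complex"
  assumes "f has_fps_expansion F" "g has_fps_expansion G"
  shows "(\<forall>\<^sub>F z in nhds 0. f z = g z) \<longleftrightarrow> F = G"
proof
  assume "\<forall>\<^sub>F z in nhds 0. f z = g z"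
  hence "f has_fps_expansion G" using assms(2) has_fps_expansion_cong by blast
  thus "F = G" using assms(1) fps_expansion_unique_complex by blast
next
  assume "F = G"
  with assms show "\<forall>\<^sub>F z in nhds 0. f z = g z"
    by (auto simp: has_fps_expansion_def elim: eventually_elim2)
qed

lemma R_eq_iff_fps:
  assumes \<mu>: "compact_distr \<mu>" and F: "f has_fps_expansion F"
  shows "(\<forall>\<^sub>F z in nhds 0. 1 + f (z * M_transform \<mu> z) = M_transform \<mu> z) \<longleftrightarrow>
    1 + (F oo (fps_X * fps_M \<mu>)) = fps_M \<mu>"
proof (rule eq_near_0_iff_fps_eq)
  note M = M_transform_has_fps_expansion[OF \<mu>]
  have W: "(\<lambda>z. z * M_transform \<mu> z) has_fps_expansion fps_X * fps_M \<mu>"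
    by (intro fps_expansion_intros M)
  have "(f \<circ> (\<lambda>z. z * M_transform \<mu> z)) has_fps_expansion (F oo (fps_X * fps_M \<mu>))"
    by (rule has_fps_expansion_compose[OF F W]) simp
  from has_fps_expansion_add[OF has_fps_expansion_1 this]
  show "(\<lambda>z. 1 + f (z * M_transform \<mu> z)) has_fps_expansion 1 + (F oo (fps_X * fps_M \<mu>))"
    by (simp add: o_def)
qed (rule M_transform_has_fps_expansion[OF \<mu>])

lemma fps_R_eqI:
  assumes \<mu>: "compact_distr \<mu>" and F: "1 + (F oo (fps_X * fps_M \<mu>)) = fps_M \<mu>"
  shows "fps_R \<mu> = F"
proof -
  let ?W = "fps_X * fps_M \<mu>"
  have W: "fps_nth ?W 0 = 0" "fps_nth ?W 1 \<noteq> 0"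
    using fps_M_0[OF \<mu>] by auto
  have "fps_M \<mu> - 1 = F oo ?W" using F by (simp add: algebra_simps)
  hence "fps_R \<mu> = F oo (?W oo fps_inv ?W)"
    unfolding fps_R_def using W by (simp add: fps_compose_assoc fps_inv_def)
  also have "?W oo fps_inv ?W = fps_X" using W by (rule fps_inv_right)
  finally show ?thesis by simp
qed

lemma fps_R_eq:
  assumes \<mu>: "compact_distr \<mu>"
  shows "1 + (fps_R \<mu> oo (fps_X * fps_M \<mu>)) = fps_M \<mu>"
proof -
  let ?W = "fps_X * fps_M \<mu>"
  have W: "fps_nth ?W 0 = 0" "fps_nth ?W 1 \<noteq> 0"
    using fps_M_0[OF \<mu>] by auto
  have "fps_R \<mu> oo ?W = (fps_M \<mu> - 1) oo (fps_inv ?W oo ?W)"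
    unfolding fps_R_def using W by (simp add: fps_compose_assoc fps_inv_def)
  also have "fps_inv ?W oo ?W = fps_X" using W by (rule fps_inv)
  finally show ?thesis by simp
qed

text \<open>This makes the choice in \<open>R_transform\<close> meaningful: \<open>z M z\<close> has
  derivative 1 at 0, hence a local holomorphic inverse \<open>g\<close>, and
  \<open>M (g w) - 1\<close> is a solution.\<close>

lemma R_transform_exists:
  assumes \<mu>: "compact_distr \<mu>"
  shows "\<exists>R. R analytic_on {0} \<and>
     (\<forall>\<^sub>F z in nhds 0. 1 + R (z * M_transform \<mu> z) = M_transform \<mu> z)"
proof -
  let ?w = "\<lambda>z. z * M_transform \<mu> z"
  note M = M_transform_has_fps_expansion[OF \<mu>]
  have W: "?w has_fps_expansion fps_X * fps_M \<mu>"
    by (intro fps_expansion_intros M)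
  obtain S where S: "open S" "0 \<in> S" "?w holomorphic_on S"
    using has_fps_expansion_imp_holomorphic[OF W] by metis
  have "deriv ?w 0 \<noteq> 0"
    using fps_nth_fps_expansion[OF W, of 1] fps_M_0[OF \<mu>] by simp
  then obtain r where r: "r > 0" "ball 0 r \<subseteq> S" "inj_on ?w (ball 0 r)"
    using has_complex_derivative_locally_invertible[OF S(3,2,1)] by metis
  have "?w holomorphic_on ball 0 r" using S r holomorphic_on_subset by blast
  then obtain g where g: "g holomorphic_on ?w ` ball 0 r" "\<And>z. z \<in> ball 0 r \<Longrightarrow> g (?w z) = z"
    using holomorphic_has_inverse[of ?w "ball 0 r"] r by (metis open_ball)
  have "open (?w ` ball 0 r)"
    using \<open>?w holomorphic_on ball 0 r\<close> r(3) by (intro open_mapping_thm3) auto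
  moreover have "0 \<in> ?w ` ball 0 r" using r(1) by (auto intro!: image_eqI[of _ _ 0])
  ultimately have ga: "g analytic_on {0}"
    using g(1) analytic_at by blast
  have g0: "g 0 = 0" using g(2)[of 0] r(1) by simp
  have "M_transform \<mu> analytic_on {g 0}"
    unfolding g0 using M has_fps_expansion_imp_analytic_0 by blast
  hence "(M_transform \<mu> \<circ> g) analytic_on {0}"
    by (intro analytic_on_compose ga) auto
  hence "(\<lambda>w. M_transform \<mu> (g w) - 1) analytic_on {0}"
    by (intro analytic_on_diff) (auto simp: o_def)
  moreover have "\<forall>\<^sub>F z in nhds 0. z \<in> ball (0::complex) r"
    using r(1) by (intro eventually_nhds_in_open) auto
  hence "\<forall>\<^sub>F z in nhds 0. 1 + (M_transform \<mu> (g (?w z)) - 1) = M_transform \<mu> z"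
    by eventually_elim (use g(2) in simp)
  ultimately show ?thesis by (intro exI[of _ "\<lambda>w. M_transform \<mu> (g w) - 1"] conjI)
qed

lemma R_transform_has_fps_expansion:
  assumes \<mu>: "compact_distr \<mu>"
  shows "R_transform \<mu> has_fps_expansion fps_R \<mu>"
proof -
  have R: "R_transform \<mu> analytic_on {0}"
      "\<forall>\<^sub>F z in nhds 0. 1 + R_transform \<mu> (z * M_transform \<mu> z) = M_transform \<mu> z"
    using someI_ex[OF R_transform_exists[OF \<mu>]] unfolding R_transform_def by auto
  obtain F where F: "R_transform \<mu> has_fps_expansion F"
    using analytic_at_imp_has_fps_expansion_0[OF R(1)] by blast
  have "fps_R \<mu> = F"
    using R(2) R_eq_iff_fps[OF \<mu> F] fps_R_eqI[OF \<mu>] by blast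
  with F show ?thesis by simp
qed

lemma fps_R_eqI_fun:
  assumes \<mu>: "compact_distr \<mu>" and F: "f has_fps_expansion F"
    and "\<forall>\<^sub>F z in nhds 0. 1 + f (z * M_transform \<mu> z) = M_transform \<mu> z"
  shows "fps_R \<mu> = F"
  using assms R_eq_iff_fps[OF \<mu> F] fps_R_eqI[OF \<mu>] by blast

lemma fps_R_0:
  assumes "compact_distr \<mu>"
  shows "fps_nth (fps_R \<mu>) 0 = 0"
proof -
  have "fps_nth (1 + (fps_R \<mu> oo (fps_X * fps_M \<mu>))) 0 = 1 + fps_nth (fps_R \<mu>) 0"
    by simp
  thus ?thesis using fps_R_eq[OF assms] fps_M_0[OF assms] by simp
qed

text \<open>Strong induction: coefficient \<open>n\<close> of the composition depends only on the
  coefficients of \<open>M\<close> below \<open>n\<close>, as \<open>fps_nth F 0 = 0\<close> removes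
  the one term that reaches index \<open>n\<close>.\<close>

lemma fps_eq_of_R_equation:
  fixes F M N :: "'a :: idom fps"
  assumes "1 + (F oo (fps_X * M)) = M" "1 + (F oo (fps_X * N)) = N" "fps_nth F 0 = 0"
  shows "M = N"
proof (rule fps_ext)
  fix n show "fps_nth M n = fps_nth N n"
  proof (induction n rule: less_induct)
    case (less n)
    have pw: "fps_nth (M ^ i) k = fps_nth (N ^ i) k" if "k < n" for i k
      using that
    proof (induction i arbitrary: k)
      case (Suc i)
      thus ?case using less by (simp add: fps_mult_nth)
    qed auto
    have "fps_nth (F oo (fps_X * M)) n = fps_nth (F oo (fps_X * N)) n"
      unfolding fps_nth_compose_X_mult
    proof (rule sum.cong[OF refl])
      fix i assume "i \<in> {..n}"
      thus "fps_nth F i * fps_nth (M ^ i) (n - i) = fps_nth F i * fps_nth (N ^ i) (n - i)"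
        using assms(3) by (cases "i = 0") (auto intro!: pw)
    qed
    thus ?case using assms(1,2) by (metis fps_add_nth)
  qed
qed

text \<open>Through characteristic functions: \<open>s t n\<close> is a Taylor polynomial formed
  with the common moments, and for a law on \<open>[-K, K]\<close> its distance to
  \<open>char\<close> is at most \<open>2 (|t| K)^n / n!\<close>.\<close>

lemma compact_distr_eqI_moments:
  assumes \<mu>: "compact_distr \<mu>" and \<nu>: "compact_distr \<nu>"
    and eq: "\<And>n. (\<integral>x. x ^ n \<partial>\<mu>) = (\<integral>x. x ^ n \<partial>\<nu>)"
  shows "\<mu> = \<nu>"
proof -
  define s where "s t n = (\<Sum>k\<le>n. ((\<i> * complex_of_real t) ^ k / fact k) * complex_of_real (\<integral>x. x ^ k \<partial>\<mu>))"
    for t :: real and n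
  have *: "s t \<longlonglongrightarrow> char \<rho> t"
    if \<rho>: "compact_distr \<rho>" and eq: "\<And>n. (\<integral>x. x ^ n \<partial>\<rho>) = (\<integral>x. x ^ n \<partial>\<mu>)" for \<rho> t
  proof -
    obtain K where K: "K > 0" "real_distribution \<rho>" "AE x in \<rho>. \<bar>x\<bar> \<le> K"
      using \<rho> by (rule compact_distrE)
    interpret real_distribution \<rho> by fact
    have abs_le: "expectation (\<lambda>x. \<bar>x\<bar> ^ n) \<le> K ^ n" for n
    proof -
      have "expectation (\<lambda>x. \<bar>x\<bar> ^ n) \<le> expectation (\<lambda>x. K ^ n)"
      proof (rule integral_mono_AE)
        show "AE x in \<rho>. \<bar>x\<bar> ^ n \<le> K ^ n" using K(3) by eventually_elim (auto intro: power_mono)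
        show "integrable \<rho> (\<lambda>x. \<bar>x\<bar> ^ n)"
          using integrable_abs[OF compact_distr_integrable_power[OF \<rho>, of n]] by (simp add: power_abs)
      qed auto
      thus ?thesis using prob_space by simp
    qed
    have "norm (s t n - char \<rho> t) \<le> 2 * ((\<bar>t\<bar> * K) ^ n / fact n)" for n
    proof -
      have "norm (char \<rho> t - s t n) \<le> (2 * \<bar>t\<bar> ^ n / fact n) * expectation (\<lambda>x. \<bar>x\<bar> ^ n)"
        using char_approx1[of n t] compact_distr_integrable_power[OF \<rho>] unfolding s_def eq[symmetric] by simp
      also have "\<dots> \<le> (2 * \<bar>t\<bar> ^ n / fact n) * K ^ n"
        by (intro mult_left_mono abs_le) auto
      finally show ?thesis by (simp add: norm_minus_commute power_mult_distrib)
    qed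
    moreover have "(\<lambda>n. 2 * ((\<bar>t\<bar> * K) ^ n / fact n)) \<longlonglongrightarrow> 2 * 0"
      using summable_LIMSEQ_zero[OF summable_exp[of "\<bar>t\<bar> * K"]]
      by (intro tendsto_mult tendsto_const) (simp only: divide_inverse mult.commute)
    ultimately have "(\<lambda>n. s t n - char \<rho> t) \<longlonglongrightarrow> 0"
      using Lim_null_comparison[OF always_eventually, of "\<lambda>n. s t n - char \<rho> t"
        "\<lambda>n. 2 * ((\<bar>t\<bar> * K) ^ n / fact n)"] by simp
    thus ?thesis by (simp add: LIM_zero_iff)
  qed
  have "char \<mu> = char \<nu>"
  proof
    fix t
    from *[OF \<mu>, of t] *[OF \<nu>, of t] eq show "char \<mu> t = char \<nu> t"
      by (intro LIMSEQ_unique) auto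
  qed
  thus ?thesis
    using compact_distrE[OF \<mu>] compact_distrE[OF \<nu>] Levy_uniqueness by metis
qed

lemma compact_distr_eqI_fps_R:
  assumes \<mu>: "compact_distr \<mu>" and \<nu>: "compact_distr \<nu>" and eq: "fps_R \<mu> = fps_R \<nu>"
  shows "\<mu> = \<nu>"
proof (rule compact_distr_eqI_moments[OF \<mu> \<nu>])
  have "fps_M \<mu> = fps_M \<nu>"
    using fps_R_eq[OF \<mu>] fps_R_eq[OF \<nu>] fps_R_0[OF \<mu>] eq fps_eq_of_R_equation by metis
  thus "(\<integral>x. x ^ n \<partial>\<mu>) = (\<integral>x. x ^ n \<partial>\<nu>)" for n
    by (metis fps_M_nth of_real_eq_iff)
qed

section \<open>Free convolution as addition of R-series\<close>

lemma is_free_conv_iff: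
  "is_free_conv \<mu>\<^sub>1 \<mu>\<^sub>2 \<mu> \<longleftrightarrow>
     compact_distr \<mu>\<^sub>1 \<and> compact_distr \<mu>\<^sub>2 \<and> compact_distr \<mu> \<and> fps_R \<mu> = fps_R \<mu>\<^sub>1 + fps_R \<mu>\<^sub>2"
  unfolding is_free_conv_def
  by (intro conj_cong refl eq_near_0_iff_fps_eq fps_expansion_intros R_transform_has_fps_expansion)

lemma free_conv_eqI:
  assumes "is_free_conv \<mu>\<^sub>1 \<mu>\<^sub>2 \<mu>"
  shows "\<mu>\<^sub>1 \<boxplus> \<mu>\<^sub>2 = \<mu>"
proof -
  have "(THE \<mu>. is_free_conv \<mu>\<^sub>1 \<mu>\<^sub>2 \<mu>) = \<mu>"
    by (rule the_equality) (use assms in \<open>auto simp: is_free_conv_iff intro: compact_distr_eqI_fps_R\<close>)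
  thus ?thesis using assms by (auto simp: free_conv_def)
qed

text \<open>The default value of \<open>\<boxplus>\<close> is the zero measure, which has mass 0. So
  a convolution that is a compactly supported law is a genuine solution, and an equation such as
  \<open>\<mu> = free_conv_power \<nu> n\<close> can be read backwards.\<close>

lemma is_free_conv_free_conv:
  assumes "compact_distr (\<mu>\<^sub>1 \<boxplus> \<mu>\<^sub>2)"
  shows "is_free_conv \<mu>\<^sub>1 \<mu>\<^sub>2 (\<mu>\<^sub>1 \<boxplus> \<mu>\<^sub>2)"
proof (cases "\<exists>\<mu>. is_free_conv \<mu>\<^sub>1 \<mu>\<^sub>2 \<mu>")
  case True
  thus ?thesis using free_conv_eqI by metis
next
  case False
  hence "\<mu>\<^sub>1 \<boxplus> \<mu>\<^sub>2 = null_measure borel" by (simp add: free_conv_def)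
  with assms have "prob_space (null_measure (borel :: real measure))"
    by (simp add: compact_distr_def)
  from prob_space.emeasure_space_1[OF this] show ?thesis by simp
qed

lemma compact_distr_return: "compact_distr (point_mass u)"
  by (rule compact_distrI[where K = "\<bar>u\<bar>"]) (auto intro: prob_space_return simp: AE_return)

lemma fps_R_return: "fps_R (point_mass u) = fps_const (complex_of_real u) * fps_X"
proof (rule fps_R_eqI_fun[OF compact_distr_return])
  show "(\<lambda>w. complex_of_real u * w) has_fps_expansion fps_const (complex_of_real u) * fps_X"
    by (intro fps_expansion_intros)
  have M: "M_transform (point_mass u) z = 1 / (1 - complex_of_real u * z)" for z
    unfolding M_transform_def by (subst integral_return) auto
  have "\<forall>\<^sub>F z in nhds 0. 1 - complex_of_real u * z \<noteq> 0"
    by (rule tendsto_imp_eventually_ne) (auto intro!: tendsto_eq_intros filterlim_ident)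
  thus "\<forall>\<^sub>F z in nhds 0. 1 + complex_of_real u * (z * M_transform (point_mass u) z) = M_transform (point_mass u) z"
    by eventually_elim (simp add: M divide_simps)
qed

section \<open>Polynomials and positive functionals\<close>

definition root_poly :: "'a :: field set \<Rightarrow> 'a poly" where
  "root_poly T = (\<Prod>x\<in>T. [:- x, 1:])"

lemma poly_root_poly: "poly (root_poly T) y = (\<Prod>x\<in>T. y - x)"
  by (simp add: root_poly_def poly_prod)

lemma poly_root_poly_eq_0_iff: "finite T \<Longrightarrow> poly (root_poly T) y = 0 \<longleftrightarrow> y \<in> T"
  by (auto simp: poly_root_poly)

lemma degree_root_poly: "degree (root_poly T) = card T"
  unfolding root_poly_def by (subst degree_prod_eq_sum_degree) auto

lemma lead_coeff_root_poly: "coeff (root_poly T) (card T) = 1"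
proof -
  have "lead_coeff (root_poly T) = 1" unfolding root_poly_def by (simp add: lead_coeff_prod)
  thus ?thesis by (simp add: degree_root_poly)
qed

lemma root_poly_remove:
  "finite T \<Longrightarrow> y \<in> T \<Longrightarrow> root_poly T = [:- y, 1:] * root_poly (T - {y})"
  unfolding root_poly_def by (rule prod.remove)

lemma poly_root_poly_remove:
  "finite T \<Longrightarrow> y \<in> T \<Longrightarrow> poly (root_poly T) z = (z - y) * poly (root_poly (T - {y})) z"
  unfolding poly_root_poly by (rule prod.remove)

lemma root_poly_dvd:
  assumes "finite T" "\<And>y. y \<in> T \<Longrightarrow> poly p y = 0"
  shows "root_poly T dvd p"
  using assms
proof (induction T)
  case empty
  thus ?case by (simp add: root_poly_def)
next
  case (insert y T)
  then obtain q where q: "p = root_poly T * q" by (auto simp: dvd_def)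
  have "poly (root_poly T) y \<noteq> 0" using insert by (simp add: poly_root_poly_eq_0_iff)
  moreover have "poly p y = 0" using insert.prems by simp
  ultimately have "poly q y = 0" by (simp add: q)
  then obtain q' where "q = [:- y, 1:] * q'" using poly_eq_0_iff_dvd[of q y] by (auto simp: dvd_def)
  moreover have "root_poly (insert y T) = [:- y, 1:] * root_poly T"
    unfolding root_poly_def using insert.hyps by (rule prod.insert)
  ultimately have "p = root_poly (insert y T) * q'"
    by (simp only: q mult_ac)
  thus ?case by simp
qed

text \<open>Both sides have degree below \<open>card T\<close> and agree on \<open>T\<close>; a
  nonzero difference would have too many roots.\<close>

lemma Lagrange_interpolation:
  fixes f :: "'a :: field poly"
  assumes T: "finite T" and f: "degree f < card T"
  shows "f = (\<Sum>y\<in>T. smult (poly f y / poly (root_poly (T - {y})) y) (root_poly (T - {y})))"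
    (is "_ = ?g")
proof (rule ccontr)
  assume ne: "f \<noteq> ?g"
  have "degree (root_poly (T - {y})) < card T" if "y \<in> T" for y
    using that T card_gt_0_iff[of T] by (auto simp: degree_root_poly)
  hence "degree ?g < card T"
    using f by (intro degree_sum_less) (auto intro: le_less_trans[OF degree_smult_le])
  hence "degree (f - ?g) < card T" using f by (rule degree_diff_less[rotated])
  moreover have "poly ?g y = poly f y" if "y \<in> T" for y
  proof -
    have "poly ?g y = (\<Sum>w\<in>T. if w = y then poly f y else 0)"
      unfolding poly_sum
    proof (rule sum.cong[OF refl])
      fix w assume w: "w \<in> T"
      show "poly (smult (poly f w / poly (root_poly (T - {w})) w) (root_poly (T - {w}))) y =
        (if w = y then poly f y else 0)"
        using that T w poly_root_poly_eq_0_iff[of "T - {w}" y] by auto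
    qed
    thus ?thesis using that T by simp
  qed
  hence "T \<subseteq> {y. poly (f - ?g) y = 0}" by auto
  hence "card T \<le> card {y. poly (f - ?g) y = 0}"
    using ne by (intro card_mono poly_roots_finite) auto
  moreover have "card {y. poly (f - ?g) y = 0} \<le> degree (f - ?g)"
    using ne by (intro card_poly_roots_bound) auto
  ultimately show False by linarith
qed

section \<open>Positive functionals on real polynomials\<close>

lemma map_poly_of_real_add:
  "map_poly of_real (p + q) = (map_poly of_real p + map_poly of_real q :: 'a :: {real_algebra_1} poly)"
  by (rule poly_eqI) (simp add: coeff_map_poly)

lemma map_poly_of_real_mult:
  "map_poly of_real (p * q) = (map_poly of_real p * map_poly of_real q :: 'a :: {real_algebra_1, comm_ring_1} poly)"
  by (rule poly_eqI) (simp add: coeff_map_poly coeff_mult)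

lemma poly_map_poly_of_real:
  "poly (map_poly of_real p) (of_real x :: 'a :: {real_algebra_1, comm_ring_1}) = of_real (poly p x)"
  by (induction p) (simp_all add: map_poly_pCons)

text \<open>Take a complex root \<open>a + i b\<close>. If \<open>b \<noteq> 0\<close>, division by
  the real quadratic with roots \<open>a + i b\<close> and \<open>a - i b\<close> leaves a real
  remainder of degree at most 1 that vanishes at a nonreal point, hence 0.\<close>

lemma real_poly_root_or_quadratic_factor:
  fixes p :: "real poly"
  assumes "degree p > 0"
  shows "\<exists>a b. (b = 0 \<and> poly p a = 0) \<or> (b \<noteq> 0 \<and> [:a\<^sup>2 + b\<^sup>2, - 2 * a, 1:] dvd p)"
proof -
  let ?c = "map_poly complex_of_real"
  have "\<not> constant (poly (?c p))"
    using assms by (simp add: constant_degree degree_map_poly)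
  then obtain z where z: "poly (?c p) z = 0"
    using fundamental_theorem_of_algebra by blast
  show ?thesis
  proof (cases "Im z = 0")
    case True
    hence "z = of_real (Re z)" by (simp add: complex_eq_iff)
    hence "complex_of_real (poly p (Re z)) = 0"
      using z by (metis poly_map_poly_of_real)
    thus ?thesis by auto
  next
    case False
    let ?q = "[:(Re z)\<^sup>2 + (Im z)\<^sup>2, - 2 * Re z, 1:]"
    define m where "m = p mod ?q"
    have "?q \<noteq> 0" by simp
    hence "degree m \<le> 1"
      unfolding m_def using degree_mod_less'[of ?q p] by (cases "p mod ?q = 0") (auto simp: less_Suc_eq_le numeral_2_eq_2)
    hence "m = [:coeff m 0, coeff m 1:]"
      by (auto simp: poly_eq_iff coeff_pCons coeff_eq_0 split: nat.splits)
    then obtain \<beta> \<alpha> where m: "m = [:\<beta>, \<alpha>:]" by metis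
    have quad: "poly (?c ?q) z = 0"
      by (simp add: map_poly_pCons complex_eq_iff power2_eq_square algebra_simps)
    have "p = ?q * (p div ?q) + m" unfolding m_def by (rule mult_div_mod_eq[symmetric])
    hence "?c p = ?c ?q * ?c (p div ?q) + ?c m"
      by (metis map_poly_of_real_add map_poly_of_real_mult)
    hence "poly (?c m) z = 0" using z quad by (simp only: poly_add poly_mult) simp
    hence "of_real \<beta> + of_real \<alpha> * z = 0" by (simp add: m map_poly_pCons mult.commute)
    hence "\<alpha> = 0 \<and> \<beta> = 0" using False by (auto simp: complex_eq_iff)
    hence "?q dvd p" using m m_def by (simp add: mod_eq_0_iff_dvd)
    thus ?thesis using False by blast
  qed
qed

text \<open>Take a nonzero \<open>P\<close> of least degree with \<open>L (P * p) = 0\<close> for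
  all \<open>p\<close>. Positivity forces \<open>P\<close> to be, up to a constant, a product of
  distinct real linear factors, so \<open>L p\<close> depends only on the values of \<open>p\<close>
  at the roots; the weights are the values of \<open>L\<close> at the interpolation
  polynomials.\<close>

lemma positive_functional_atomic:
  fixes L :: "real poly \<Rightarrow> real"
  assumes add: "\<And>p q. L (p + q) = L p + L q" and smult: "\<And>c p. L (smult c p) = c * L p"
    and pos: "\<And>p. L (p * p) \<ge> 0" and Q: "Q \<noteq> 0" "\<And>p. L (Q * p) = 0"
  obtains V w where "finite V" "\<And>v. v \<in> V \<Longrightarrow> w v \<ge> 0" "\<And>p. L p = (\<Sum>v\<in>V. w v * poly p v)"
proof -
  have Cauchy_Schwarz: "L (f * p) = 0" if f: "L (f * f) = 0" for f p
  proof (rule ccontr)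
    assume ne: "L (f * p) \<noteq> 0"
    \<comment> \<open>With this \<open>x\<close> the cross term \<open>2 x L (f * p)\<close> cancels
      \<open>L (p * p)\<close> and leaves -1 as the value of \<open>L\<close> at a square.\<close>
    define x where "x = - (L (p * p) + 1) / (2 * L (f * p))"
    have "(smult x f + p) * (smult x f + p) = smult (x * x) (f * f) + (smult x (f * p) + smult x (f * p)) + p * p"
      by (simp add: algebra_simps)
    hence "L ((smult x f + p) * (smult x f + p)) = x * x * L (f * f) + 2 * x * L (f * p) + L (p * p)"
      by (simp only: add smult)
    also have "2 * x * L (f * p) = - (L (p * p) + 1)" using ne by (simp add: x_def)
    also have "x * x * L (f * f) + - (L (p * p) + 1) + L (p * p) = - 1" using f by simp
    finally show False using pos[of "smult x f + p"] by simp
  qed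
  define null where "null f \<longleftrightarrow> f \<noteq> 0 \<and> (\<forall>p. L (f * p) = 0)" for f
  have "null Q" using Q by (simp add: null_def)
  then obtain P where P: "null P" "\<And>f. null f \<Longrightarrow> degree P \<le> degree f"
    using ex_has_least_nat[of null Q degree] by blast
  have P0: "P \<noteq> 0" using P by (simp add: null_def)
  \<comment> \<open>Such a factor could be traded for a null polynomial of smaller degree. The case
    \<open>b = 0\<close> excludes double roots, \<open>b \<noteq> 0\<close> excludes nonreal
    ones.\<close>
  have no_quad: "\<not> [:a\<^sup>2 + b\<^sup>2, - 2 * a, 1:] dvd P" for a b
  proof
    assume "[:a\<^sup>2 + b\<^sup>2, - 2 * a, 1:] dvd P"
    then obtain P1 where P1: "P = [:a\<^sup>2 + b\<^sup>2, - 2 * a, 1:] * P1" by (auto simp: dvd_def)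
    have P10: "P1 \<noteq> 0" using P0 P1 by auto
    have deg: "degree P = 2 + degree P1"
      unfolding P1 using P10 by (subst degree_mult_eq) auto
    let ?f = "[:- a, 1:] * P1" and ?g = "smult b P1"
    \<comment> \<open>\<open>P * P1\<close> is the sum of the squares of \<open>(x - a) P1\<close>
      and \<open>b P1\<close>; since \<open>L\<close> kills it, it kills both squares.\<close>
    have "(f * f + g * g) * x * x = (f * x) * (f * x) + (g * x) * (g * x)" for f g x :: "real poly"
      by (simp add: algebra_simps)
    from this[of "[:- a, 1:]" "[:b:]" P1] have "P * P1 = ?f * ?f + ?g * ?g"
      unfolding P1 by (simp add: power2_eq_square)
    hence "L (?f * ?f) + L (?g * ?g) = 0"
      using P(1) unfolding null_def by (metis add)
    hence fg: "L (?f * ?f) = 0" "L (?g * ?g) = 0" using pos[of ?f] pos[of ?g] by auto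
    show False
    proof (cases "b = 0")
      case True
      have "?f \<noteq> 0" using P10 by (simp only: mult_eq_0_iff) simp
      hence "null ?f" using Cauchy_Schwarz[OF fg(1)] by (simp only: null_def) blast
      moreover have "degree ?f = 1 + degree P1" using P10 by (subst degree_mult_eq) auto
      ultimately show False using P(2) deg by fastforce
    next
      case False
      have "L (P1 * p) = 0" for p
      proof -
        have "P1 * p = ?g * smult (1 / b) p" using False by simp
        thus ?thesis using Cauchy_Schwarz[OF fg(2)] by metis
      qed
      hence "null P1" using P10 by (simp add: null_def)
      thus False using P(2) deg by fastforce
    qed
  qed
  define V where "V = {x. poly P x = 0}"
  have V: "finite V" using P0 poly_roots_finite by (simp add: V_def)
  have "root_poly V dvd P" by (rule root_poly_dvd[OF V]) (simp add: V_def)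
  then obtain P2 where P2: "P = root_poly V * P2" by (rule dvdE)
  have "degree P2 = 0"
  proof (rule ccontr)
    assume "degree P2 \<noteq> 0"
    then consider a where "poly P2 a = 0" | a b where "[:a\<^sup>2 + b\<^sup>2, - 2 * a, 1:] dvd P2"
      using real_poly_root_or_quadratic_factor[of P2] by blast
    thus False
    proof cases
      case (1 a)
      hence "poly P a = 0" by (simp add: P2)
      hence "a \<in> V" by (simp add: V_def)
      hence "[:- a, 1:] dvd root_poly V" using root_poly_remove[OF V] by (metis dvd_triv_left)
      moreover have "[:- a, 1:] dvd P2" using 1 by (simp add: poly_eq_0_iff_dvd)
      ultimately have "[:- a, 1:] * [:- a, 1:] dvd P" unfolding P2 by (rule mult_dvd_mono)
      moreover have "[:- a, 1:] * [:- a, 1:] = [:a\<^sup>2 + 0\<^sup>2, - 2 * a, 1:]" by (simp add: power2_eq_square)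
      ultimately show False using no_quad[of a 0] by metis
    next
      case (2 a b)
      thus False using no_quad[of a b] P2 by (meson dvd_mult)
    qed
  qed
  then obtain c where c: "P2 = [:c:]" by (rule degree_eq_zeroE)
  have vanish: "L p = 0" if p: "\<And>v. v \<in> V \<Longrightarrow> poly p v = 0" for p
  proof -
    obtain r where r: "p = root_poly V * r"
      using root_poly_dvd[OF V p] by (auto simp: dvd_def)
    have "c \<noteq> 0" using P0 P2 c by auto
    hence "p = P * smult (1 / c) r" unfolding P2 c r by simp
    thus ?thesis using P(1) by (simp only: null_def)
  qed
  define e where "e v = smult (1 / poly (root_poly (V - {v})) v) (root_poly (V - {v}))" for v
  have e: "poly (e v) u = (if u = v then 1 else 0)" if "u \<in> V" "v \<in> V" for u v
    using that V poly_root_poly_eq_0_iff[of "V - {v}"] by (auto simp: e_def)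
  have L_sum: "L (\<Sum>x\<in>A. smult (g x) (h x)) = (\<Sum>x\<in>A. g x * L (h x))"
    if "finite A" for A :: "real set" and g h
    using that
  proof induction
    case empty
    show ?case using smult[of 0 0] by simp
  qed (simp_all add: add smult)
  show ?thesis
  proof (rule that[OF V])
    fix p
    have "poly (p - (\<Sum>v\<in>V. smult (poly p v) (e v))) u = 0" if u: "u \<in> V" for u
    proof -
      have "(\<Sum>v\<in>V. poly p v * poly (e v) u) = (\<Sum>v\<in>V. if v = u then poly p u else 0)"
        by (intro sum.cong refl) (use u in \<open>auto simp: e\<close>)
      thus ?thesis using u V by (simp add: poly_sum)
    qed
    hence "L (p - (\<Sum>v\<in>V. smult (poly p v) (e v))) = 0" by (rule vanish)
    moreover have "L p = L (p - (\<Sum>v\<in>V. smult (poly p v) (e v))) + L (\<Sum>v\<in>V. smult (poly p v) (e v))"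
      by (subst add[symmetric]) simp
    ultimately show "L p = (\<Sum>v\<in>V. L (e v) * poly p v)"
      by (simp add: L_sum[OF V] mult.commute)
  next
    fix v assume v: "v \<in> V"
    \<comment> \<open>On \<open>V\<close> the polynomial \<open>e v\<close> is idempotent, so
      \<open>L (e v)\<close> is the value of \<open>L\<close> at a square.\<close>
    have "L (e v * e v - e v) = 0" by (rule vanish) (use v in \<open>auto simp: e\<close>)
    moreover have "L (e v * e v) = L (e v * e v - e v) + L (e v)" by (subst add[symmetric]) simp
    ultimately show "L (e v) \<ge> 0" using pos[of "e v"] by simp
  qed
qed

text \<open>The function \<open>h z = z - a - (\<Sum>x\<in>S. p x / (z - x))\<close> is the quotient of the monic polynomial \<open>P\<close>
  by \<open>root_poly S\<close>. Its zeros are real, as \<open>Im (h z)\<close> has the sign of \<open>Im z\<close>, and simple, as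
  \<open>h' \<ge> 1\<close> on the real axis, so \<open>1 / h\<close> is a sum of simple fractions with weights \<open>1 / h'\<close>.\<close>

lemma resolvent_partial_fractions:
  fixes S :: "complex set" and p :: "complex \<Rightarrow> real" and a :: real
  assumes S: "finite S" "S \<subseteq> \<real>" and p: "\<And>x. x \<in> S \<Longrightarrow> p x > 0"
  obtains T q where "finite T" "T \<subseteq> \<real>" "\<forall>y\<in>T. q y > 0" "sum q T = (1 :: real)"
    "\<forall>y\<in>T. y \<notin> S \<and> y - of_real a = (\<Sum>x\<in>S. of_real (p x) / (y - x))"
    "\<forall>z. z \<notin> S \<longrightarrow> z \<notin> T \<longrightarrow>
       1 / (z - of_real a - (\<Sum>x\<in>S. of_real (p x) / (z - x))) = (\<Sum>y\<in>T. of_real (q y) / (z - y))"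
proof -
  define h where "h z = z - of_real a - (\<Sum>x\<in>S. of_real (p x) / (z - x))" for z :: complex
  define P1 where "P1 = (\<Sum>x\<in>S. smult (complex_of_real (p x)) (root_poly (S - {x})))"
  define P where "P = [:- complex_of_real a, 1:] * root_poly S - P1"
  let ?Q = "root_poly S"
  have Q0: "poly ?Q z \<noteq> 0" if "z \<notin> S" for z
    using that S poly_root_poly_eq_0_iff by auto
  have Qrem: "poly ?Q z = (z - x) * poly (root_poly (S - {x})) z" if "x \<in> S" for x z
    using S(1) that by (rule poly_root_poly_remove)
  have P_eq: "poly P z = poly ?Q z * h z" if "z \<notin> S" for z
  proof -
    have "poly P1 z = (\<Sum>x\<in>S. poly ?Q z * (of_real (p x) / (z - x)))"
      unfolding P1_def poly_sum
    proof (rule sum.cong[OF refl])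
      fix x assume x: "x \<in> S"
      hence "z - x \<noteq> 0" using that by auto
      thus "poly (smult (of_real (p x)) (root_poly (S - {x}))) z = poly ?Q z * (of_real (p x) / (z - x))"
        using Qrem[OF x] by simp
    qed
    thus ?thesis
      by (simp add: P_def h_def sum_distrib_left algebra_simps)
  qed
  \<comment> \<open>Poles of \<open>h\<close> are not roots of \<open>P\<close>: at \<open>x\<close>
    only the summand of \<open>P1\<close> that lacks the factor \<open>z - x\<close> survives, and
    \<open>p x > 0\<close>.\<close>
  have P_S: "poly P x \<noteq> 0" if x: "x \<in> S" for x
  proof -
    have "poly P1 x = (\<Sum>y\<in>S. if y = x then of_real (p x) * poly (root_poly (S - {x})) x else 0)"
      unfolding P1_def poly_sum
      by (intro sum.cong refl) (use x S in \<open>auto simp: poly_root_poly_eq_0_iff\<close>)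
    also have "\<dots> = of_real (p x) * poly (root_poly (S - {x})) x"
      using x S by simp
    finally have "poly P x = - (of_real (p x) * poly (root_poly (S - {x})) x)"
      using x S by (simp add: P_def poly_root_poly_eq_0_iff)
    thus ?thesis using p[OF x] S poly_root_poly_eq_0_iff[of "S - {x}" x] by auto
  qed
  have deg1: "degree P1 < Suc (card S)"
    unfolding P1_def
    by (intro degree_sum_less) (auto simp: degree_root_poly card_Diff_singleton_if less_Suc_eq_le
        intro!: order.trans[OF degree_smult_le])
  have degm: "degree ([:- complex_of_real a, 1:] * ?Q) = Suc (card S)"
  proof -
    have "?Q \<noteq> 0" unfolding root_poly_def using S by auto
    thus ?thesis by (subst degree_mult_eq) (auto simp: degree_root_poly)
  qed
  have lcm: "lead_coeff ([:- complex_of_real a, 1:] * ?Q) = 1"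
    unfolding lead_coeff_mult using lead_coeff_root_poly[of S] by (simp add: degree_root_poly)
  have degP: "degree P = Suc (card S)"
    unfolding P_def using degm deg1 by (metis degree_add_eq_left degree_minus diff_conv_add_uminus)
  have lcP: "lead_coeff P = 1"
    unfolding degP unfolding P_def using lcm degm coeff_eq_0[OF deg1] by simp
  have P0: "P \<noteq> 0" using degP by auto
  define T where "T = {z. poly P z = 0}"
  have T: "finite T" unfolding T_def using P0 by (rule poly_roots_finite)
  have T_S: "y \<notin> S" and T_h: "h y = 0" if "y \<in> T" for y
    using that P_S P_eq[of y] Q0[of y] by (auto simp: T_def)
  \<comment> \<open>One sum controls both facts about the roots \<open>y\<close>:
    \<open>Im (h y) = Im y * (1 + H y)\<close> makes them real, and then
    \<open>h' y = 1 + H y\<close> makes them simple.\<close>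
  define H where "H y = (\<Sum>x\<in>S. p x / (cmod (y - x))\<^sup>2)" for y
  have H: "H y \<ge> 0" for y unfolding H_def using p by (intro sum_nonneg divide_nonneg_nonneg) (auto intro: less_imp_le)
  have T_real: "T \<subseteq> \<real>"
  proof
    fix y assume y: "y \<in> T"
    have "Im (of_real (p x) / (y - x)) = - (p x / (cmod (y - x))\<^sup>2) * Im y" if "x \<in> S" for x
    proof -
      have "Im x = 0" using that S by (auto simp: complex_is_Real_iff)
      thus ?thesis by (simp add: Im_divide cmod_power2)
    qed
    hence "(\<Sum>x\<in>S. Im (of_real (p x) / (y - x))) = (\<Sum>x\<in>S. - (p x / (cmod (y - x))\<^sup>2) * Im y)"
      by (intro sum.cong refl)
    also have "\<dots> = - H y * Im y" by (simp add: H_def sum_distrib_right sum_negf)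
    moreover have "Im (h y) = Im y - (\<Sum>x\<in>S. Im (of_real (p x) / (y - x)))"
      unfolding h_def by (simp only: minus_complex.simps Im_sum Im_complex_of_real diff_zero)
    ultimately have "Im (h y) = Im y * (1 + H y)" by (simp add: algebra_simps)
    hence "Im y * (1 + H y) = 0" using T_h[OF y] by simp
    moreover have "1 + H y \<noteq> 0" using H[of y] by linarith
    ultimately show "y \<in> \<real>" by (simp add: complex_is_Real_iff)
  qed
  have deriv: "poly (pderiv P) y = poly ?Q y * of_real (1 + H y)" if y: "y \<in> T" for y
  proof -
    have "((\<lambda>z. of_real (p x) / (z - x)) has_field_derivative - (of_real (p x) / (y - x)\<^sup>2)) (at y)"
      if "x \<in> S" for x
    proof -
      have "y - x \<noteq> 0" using that T_S[OF y] by auto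
      thus ?thesis by (auto intro!: derivative_eq_intros simp: power2_eq_square)
    qed
    hence "((\<lambda>z. z - of_real a - (\<Sum>x\<in>S. of_real (p x) / (z - x))) has_field_derivative
        1 - 0 - (\<Sum>x\<in>S. - (of_real (p x) / (y - x)\<^sup>2))) (at y)"
      by (rule DERIV_diff[OF DERIV_diff[OF DERIV_ident DERIV_const] DERIV_sum])
    hence "(h has_field_derivative 1 + (\<Sum>x\<in>S. of_real (p x) / (y - x)\<^sup>2)) (at y)"
      unfolding h_def[abs_def] by (simp add: sum_negf)
    also have "(\<Sum>x\<in>S. of_real (p x) / (y - x)\<^sup>2) = of_real (H y)"
      unfolding H_def of_real_sum
    proof (rule sum.cong[OF refl])
      fix x assume "x \<in> S"
      hence "y - x \<in> \<real>" using y T_real S by (intro Reals_diff) auto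
      then obtain r where "y - x = of_real r" by (rule Reals_cases)
      thus "of_real (p x) / (y - x)\<^sup>2 = of_real (p x / (cmod (y - x))\<^sup>2)" by simp
    qed
    finally have "((\<lambda>z. poly ?Q z * h z) has_field_derivative
        poly (pderiv ?Q) y * h y + (1 + of_real (H y)) * poly ?Q y) (at y)"
      by (rule DERIV_mult[OF poly_DERIV])
    moreover have "\<forall>\<^sub>F z in nhds y. poly ?Q z * h z = poly P z"
    proof -
      have "open (- S)" using S(1) by (intro open_Compl finite_imp_closed)
      hence "\<forall>\<^sub>F z in nhds y. z \<in> - S" using T_S[OF y] by (intro eventually_nhds_in_open) auto
      thus ?thesis by eventually_elim (simp add: P_eq)
    qed
    ultimately have "(poly P has_field_derivative
        poly (pderiv ?Q) y * h y + (1 + of_real (H y)) * poly ?Q y) (at y)"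
      by (subst DERIV_cong_ev[OF refl _ refl, of _ "\<lambda>z. poly ?Q z * h z"]) (auto elim: eventually_mono)
    hence "poly (pderiv ?Q) y * h y + (1 + of_real (H y)) * poly ?Q y = poly (pderiv P) y"
      by (rule DERIV_unique[OF _ poly_DERIV])
    thus ?thesis using T_h[OF y] by (simp add: mult.commute)
  qed
  have deriv0: "poly (pderiv P) y \<noteq> 0" if "y \<in> T" for y
  proof -
    have "1 + H y \<noteq> 0" using H[of y] by linarith
    thus ?thesis
      unfolding deriv[OF that] mult_eq_0_iff of_real_eq_0_iff using Q0[OF T_S[OF that]] by blast
  qed
  have "root_poly T dvd P" by (rule root_poly_dvd[OF T]) (simp add: T_def)
  then obtain P2 where P2: "P = root_poly T * P2" by (rule dvdE)
  have "poly P2 y \<noteq> 0" for y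
  proof
    assume 0: "poly P2 y = 0"
    hence "poly P y = 0" by (simp add: P2)
    hence y: "y \<in> T" by (simp add: T_def)
    hence "poly (root_poly T) y = 0" using T by (simp add: poly_root_poly_eq_0_iff)
    hence "poly (pderiv P) y = 0" using 0 by (simp add: P2 pderiv_mult)
    thus False using deriv0[OF y] by simp
  qed
  hence "degree P2 = 0"
    using fundamental_theorem_of_algebra[of P2] constant_degree[of P2] by metis
  then obtain c where c: "P2 = [:c:]" by (rule degree_eq_zeroE)
  have "c \<noteq> 0" using P0 P2 c by auto
  have "lead_coeff P = c"
    unfolding P2 lead_coeff_mult using lead_coeff_root_poly[of T] by (simp add: degree_root_poly c)
  hence "c = 1" using lcP by simp
  hence PT: "P = root_poly T" using P2 c by simp
  have cardT: "card T = Suc (card S)" using degP PT degree_root_poly by metis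
  have pd: "poly (pderiv P) y = poly (root_poly (T - {y})) y" if y: "y \<in> T" for y
    unfolding PT root_poly_remove[OF T y] pderiv_mult by (simp add: pderiv_pCons)
  \<comment> \<open>The residue of \<open>1 / h\<close> at a root, because \<open>1 + H y\<close> is
    the derivative of \<open>h\<close> there.\<close>
  define q where "q y = 1 / (1 + H y)" for y
  have q_eq: "poly ?Q y / poly (root_poly (T - {y})) y = of_real (q y)" if "y \<in> T" for y
    unfolding pd[OF that, symmetric] deriv[OF that] using Q0[OF T_S[OF that]] by (simp add: q_def)
  have Lag: "?Q = (\<Sum>y\<in>T. smult (of_real (q y)) (root_poly (T - {y})))"
    using Lagrange_interpolation[OF T, of ?Q] by (simp add: degree_root_poly cardT q_eq cong: sum.cong)
  show ?thesis
  proof (rule that[OF T T_real])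
    show "\<forall>y\<in>T. q y > 0" using H by (simp add: q_def add_pos_nonneg)
    \<comment> \<open>Total mass: compare the coefficients of degree \<open>card S\<close> in the
      Lagrange formula for the monic polynomial \<open>root_poly S\<close>.\<close>
    have "1 = coeff ?Q (card S)" by (simp add: lead_coeff_root_poly)
    also have "\<dots> = (\<Sum>y\<in>T. of_real (q y) * coeff (root_poly (T - {y})) (card S))"
      by (subst Lag) (simp add: coeff_sum)
    also have "\<dots> = (\<Sum>y\<in>T. of_real (q y))"
    proof (rule sum.cong[OF refl])
      fix y assume "y \<in> T"
      hence "card (T - {y}) = card S" using T cardT by simp
      thus "of_real (q y) * coeff (root_poly (T - {y})) (card S) = complex_of_real (q y)"
        using lead_coeff_root_poly[of "T - {y}"] by simp
    qed
    finally have "complex_of_real (sum q T) = 1" by simp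
    thus "sum q T = 1" by (simp only: of_real_eq_1_iff)
    show "\<forall>y\<in>T. y \<notin> S \<and> y - of_real a = (\<Sum>x\<in>S. of_real (p x) / (y - x))"
      using T_S T_h by (simp add: h_def)
    show "\<forall>z. z \<notin> S \<longrightarrow> z \<notin> T \<longrightarrow>
      1 / (z - of_real a - (\<Sum>x\<in>S. of_real (p x) / (z - x))) = (\<Sum>y\<in>T. of_real (q y) / (z - y))"
    proof (intro allI impI)
      fix z assume z: "z \<notin> S" "z \<notin> T"
      have Pz: "poly (root_poly T) z \<noteq> 0" using z T by (simp add: poly_root_poly_eq_0_iff)
      have "1 / h z = poly ?Q z / poly P z" using P_eq[OF z(1)] Q0[OF z(1)] by simp
      also have "\<dots> = (\<Sum>y\<in>T. of_real (q y) * poly (root_poly (T - {y})) z) / poly (root_poly T) z"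
        unfolding PT by (subst Lag) (simp add: poly_sum)
      also have "\<dots> = (\<Sum>y\<in>T. of_real (q y) / (z - y))"
        unfolding sum_divide_distrib
      proof (rule sum.cong[OF refl])
        fix y assume y: "y \<in> T"
        have "poly (root_poly T) z = (z - y) * poly (root_poly (T - {y})) z"
          using T y by (rule poly_root_poly_remove)
        thus "of_real (q y) * poly (root_poly (T - {y})) z / poly (root_poly T) z = of_real (q y) / (z - y)"
          using Pz by simp
      qed
      finally show "1 / (z - of_real a - (\<Sum>x\<in>S. of_real (p x) / (z - x))) = (\<Sum>y\<in>T. of_real (q y) / (z - y))"
        by (simp add: h_def)
    qed
  qed
qed

section \<open>Measures with prescribed R-transform\<close>

text \<open>The Cauchy transform of a finite positive atomic measure, asserted only for
  \<open>cmod z \<ge> B\<close>, where no pole is met and division by 0 never enters. Weights are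
  strictly positive, so that every listed atom is a pole, as the partial fractions require.\<close>

definition atomic_outside :: "real \<Rightarrow> (complex \<Rightarrow> complex) \<Rightarrow> bool" where
  "atomic_outside B f \<longleftrightarrow> (\<exists>S p. finite S \<and> S \<subseteq> \<real> \<and> (\<forall>x\<in>S. cmod x < B \<and> p x > 0) \<and>
     (\<forall>z. cmod z \<ge> B \<longrightarrow> f z = (\<Sum>x\<in>S. complex_of_real (p x) / (z - x))))"

lemma atomic_outside_0: "atomic_outside B (\<lambda>z. 0)"
  unfolding atomic_outside_def by (intro exI[of _ "{}"]) auto

lemma atomic_outside_cmult:
  assumes f: "atomic_outside B f" and c: "c \<ge> 0"
  shows "atomic_outside B (\<lambda>z. of_real c * f z)"
proof (cases "c = 0")
  case True
  thus ?thesis using atomic_outside_0 by simp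
next
  case False
  from f obtain S p where "finite S" "S \<subseteq> \<real>" "\<forall>x\<in>S. cmod x < B \<and> p x > 0"
    "\<forall>z. cmod z \<ge> B \<longrightarrow> f z = (\<Sum>x\<in>S. complex_of_real (p x) / (z - x))"
    by (auto simp: atomic_outside_def)
  thus ?thesis unfolding atomic_outside_def using False c
    by (intro exI[of _ S] exI[of _ "\<lambda>x. c * p x"]) (auto simp: sum_distrib_left)
qed

lemma atomic_outside_add:
  assumes "atomic_outside B f" "atomic_outside B g"
  shows "atomic_outside B (\<lambda>z. f z + g z)"
proof -
  from assms(1) obtain S p where S: "finite S" "S \<subseteq> \<real>" "\<forall>x\<in>S. cmod x < B \<and> p x > 0"
    "\<forall>z. cmod z \<ge> B \<longrightarrow> f z = (\<Sum>x\<in>S. complex_of_real (p x) / (z - x))"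
    by (auto simp: atomic_outside_def)
  from assms(2) obtain T q where T: "finite T" "T \<subseteq> \<real>" "\<forall>x\<in>T. cmod x < B \<and> q x > 0"
    "\<forall>z. cmod z \<ge> B \<longrightarrow> g z = (\<Sum>x\<in>T. complex_of_real (q x) / (z - x))"
    by (auto simp: atomic_outside_def)
  define r where "r x = (if x \<in> S then p x else 0) + (if x \<in> T then q x else 0)" for x
  have "(\<Sum>x\<in>S \<union> T. complex_of_real (r x) / (z - x)) =
      (\<Sum>x\<in>S. complex_of_real (p x) / (z - x)) + (\<Sum>x\<in>T. complex_of_real (q x) / (z - x))" for z
  proof -
    have "(\<Sum>x\<in>S \<union> T. complex_of_real (r x) / (z - x)) =
      (\<Sum>x\<in>S \<union> T. complex_of_real (if x \<in> S then p x else 0) / (z - x)) +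
      (\<Sum>x\<in>S \<union> T. complex_of_real (if x \<in> T then q x else 0) / (z - x))"
      by (simp add: r_def add_divide_distrib sum.distrib)
    also have "(\<Sum>x\<in>S \<union> T. complex_of_real (if x \<in> S then p x else 0) / (z - x)) =
        (\<Sum>x\<in>S. complex_of_real (p x) / (z - x))"
      using S(1) T(1) by (intro sum.mono_neutral_cong_right) auto
    also have "(\<Sum>x\<in>S \<union> T. complex_of_real (if x \<in> T then q x else 0) / (z - x)) =
        (\<Sum>x\<in>T. complex_of_real (q x) / (z - x))"
      using S(1) T(1) by (intro sum.mono_neutral_cong_right) auto
    finally show ?thesis .
  qed
  thus ?thesis unfolding atomic_outside_def using S T
    by (intro exI[of _ "S \<union> T"] exI[of _ r]) (auto simp: r_def add_pos_pos)
qed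

lemma sum_list_weighted_diff:
  fixes g h :: "'a \<Rightarrow> complex"
  shows "(\<Sum>(v, q)\<leftarrow>qs. of_real q * g v) - (\<Sum>(v, q)\<leftarrow>qs. of_real q * h v) =
    (\<Sum>(v, q)\<leftarrow>qs. of_real q * (g v - h v))"
  by (induction qs) (auto simp: algebra_simps)

lemma norm_sum_list_weighted_le:
  fixes g :: "'a \<Rightarrow> complex"
  assumes "\<And>v q. (v, q) \<in> set qs \<Longrightarrow> q \<ge> 0 \<and> norm (g v) \<le> c"
  shows "norm (\<Sum>(v, q)\<leftarrow>qs. of_real q * g v) \<le> (\<Sum>(v, q)\<leftarrow>qs. q) * c"
  using assms
proof (induction qs)
  case (Cons x qs)
  obtain v q where x: "x = (v, q)" by (cases x)
  have "norm (of_real q * g v) \<le> q * c"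
    using Cons.prems[of v q] by (auto simp: norm_mult x intro: mult_left_mono)
  moreover have "norm (\<Sum>(v, q)\<leftarrow>qs. of_real q * g v) \<le> (\<Sum>(v, q)\<leftarrow>qs. q) * c"
    using Cons by auto
  ultimately show ?case
    unfolding x by (simp add: algebra_simps norm_triangle_le)
qed auto

lemma tendsto_sum_list_weighted:
  fixes g :: "'a \<Rightarrow> 'b \<Rightarrow> complex"
  assumes "\<And>v q. (v, q) \<in> set qs \<Longrightarrow> (g v \<longlongrightarrow> l v) F"
  shows "((\<lambda>x. \<Sum>(v, q)\<leftarrow>qs. of_real q * g v x) \<longlongrightarrow> (\<Sum>(v, q)\<leftarrow>qs. of_real q * l v)) F"
  using assms by (induction qs) (auto intro!: tendsto_intros)

text \<open>The free Levy-Khintchine form with an atomic measure of weights \<open>q\<close> at the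
  nodes \<open>v\<close>. The node 0 gives the Wigner term, and a node may occur several
  times.\<close>

definition Levy_fps :: "real \<Rightarrow> (real \<times> real) list \<Rightarrow> complex fps" where
  "Levy_fps a qs = fps_const (of_real a) * fps_X +
     (\<Sum>(v, q)\<leftarrow>qs. fps_const (of_real q) * (fps_X\<^sup>2 / (1 - fps_const (of_real v) * fps_X)))"

lemma has_fps_expansion_Levy:
  "(\<lambda>w. of_real a * w + (\<Sum>(v, q)\<leftarrow>qs. of_real q * (w\<^sup>2 / (1 - of_real v * w)))) has_fps_expansion Levy_fps a qs"
proof -
  have "(\<lambda>w. \<Sum>(v, q)\<leftarrow>qs. of_real q * (w\<^sup>2 / (1 - of_real v * w))) has_fps_expansion
     (\<Sum>(v, q)\<leftarrow>qs. fps_const (complex_of_real q) * (fps_X\<^sup>2 / (1 - fps_const (of_real v) * fps_X)))"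
  proof (induction qs)
    case (Cons x qs)
    obtain v q where x: "x = (v, q)" by (cases x)
    show ?case unfolding x list.map sum_list.Cons prod.case
      by (intro fps_expansion_intros Cons.IH) auto
  qed simp
  thus ?thesis unfolding Levy_fps_def by (intro fps_expansion_intros)
qed

section \<open>The continued fraction and its limit law\<close>

locale continued_fraction =
  fixes a :: real and qs :: "(real \<times> real) list"
  assumes weight_nonneg: "\<And>v q. (v, q) \<in> set qs \<Longrightarrow> q \<ge> 0"
begin

definition W :: real where "W = (\<Sum>(v, q)\<leftarrow>qs. q)"

text \<open>Large enough that for \<open>norm z \<ge> B\<close> and
  \<open>norm h \<le> 1 / 2\<close> every denominator has norm at least \<open>2 * W + 2\<close>.
  Then \<open>step z\<close> maps the disc of radius 1/2 into itself and contracts with factor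
  1/2.\<close>

definition B :: real where "B = \<bar>a\<bar> + (\<Sum>(v, q)\<leftarrow>qs. \<bar>v\<bar>) + 2 * W + 3"

definition step :: "complex \<Rightarrow> complex \<Rightarrow> complex" where
  "step z h = (\<Sum>(v, q)\<leftarrow>qs. of_real q * inverse (z - of_real (a + v) - h))"

primrec H :: "nat \<Rightarrow> complex \<Rightarrow> complex" where
  "H 0 z = 0"
| "H (Suc n) z = step z (H n z)"

lemma W_nonneg: "W \<ge> 0"
  unfolding W_def using weight_nonneg by (intro sum_list_nonneg) auto

lemma node_le: "(v, q) \<in> set qs \<Longrightarrow> \<bar>v\<bar> \<le> (\<Sum>(v, q)\<leftarrow>qs. \<bar>v\<bar>)"
proof (induction qs)
  case (Cons x xs)
  have "(\<Sum>(v, q)\<leftarrow>xs. \<bar>v\<bar>) \<ge> 0" by (intro sum_list_nonneg) auto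
  thus ?case using Cons by (cases x) (auto intro: order.trans)
qed auto

lemma B_ge: "B \<ge> 3"
proof -
  have "(\<Sum>(v, q)\<leftarrow>qs. \<bar>v\<bar>) \<ge> 0" by (intro sum_list_nonneg) auto
  thus ?thesis using W_nonneg by (simp add: B_def)
qed

text \<open>The alternative \<open>v = 0\<close> covers the denominator \<open>z - a - h\<close> of
  the Cauchy transform itself, whether or not 0 is a node.\<close>

lemma denominator_ge:
  fixes z h :: complex
  assumes "norm z \<ge> B" "norm h \<le> 1 / 2" "v = 0 \<or> (v, q) \<in> set qs"
  shows "norm (z - of_real (a + v) - h) \<ge> 2 * W + 2"
proof -
  have "\<bar>v\<bar> \<le> (\<Sum>(v, q)\<leftarrow>qs. \<bar>v\<bar>)"
    using assms(3) node_le by (auto intro!: sum_list_nonneg)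
  hence "norm (complex_of_real (a + v) + h) \<le> \<bar>a\<bar> + (\<Sum>(v, q)\<leftarrow>qs. \<bar>v\<bar>) + 1 / 2"
    using norm_triangle_ineq[of "complex_of_real (a + v)" h] assms(2) abs_triangle_ineq[of a v]
    unfolding norm_of_real by linarith
  moreover have "norm z - norm (complex_of_real (a + v) + h) \<le> norm (z - (complex_of_real (a + v) + h))"
    by (rule norm_triangle_ineq2)
  ultimately show ?thesis using assms(1) unfolding B_def diff_diff_eq by linarith
qed

lemma norm_inverse_denominator_le:
  fixes z h :: complex
  assumes "norm z \<ge> B" "norm h \<le> 1 / 2" "v = 0 \<or> (v, q) \<in> set qs"
  shows "norm (inverse (z - of_real (a + v) - h)) \<le> 1 / (2 * W + 2)"
proof -
  have "inverse (norm (z - of_real (a + v) - h)) \<le> inverse (2 * W + 2)"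
    using denominator_ge[OF assms] W_nonneg by (intro le_imp_inverse_le) auto
  thus ?thesis by (simp only: norm_inverse inverse_eq_divide[where 'a = real])
qed

lemma denominator_nonzero:
  fixes z h :: complex
  assumes "norm z \<ge> B" "norm h \<le> 1 / 2" "v = 0 \<or> (v, q) \<in> set qs"
  shows "z - of_real (a + v) - h \<noteq> 0"
  using denominator_ge[OF assms] W_nonneg by auto

lemma norm_step_le:
  assumes "norm z \<ge> B" "norm h \<le> 1 / 2"
  shows "norm (step z h) \<le> 1 / 2"
proof -
  define c where "c = 1 / (2 * W + 2)"
  have *: "q \<ge> 0 \<and> norm (inverse (z - of_real (a + v) - h)) \<le> c"
    if "(v, q) \<in> set qs" for v q
    using that weight_nonneg norm_inverse_denominator_le[OF assms] unfolding c_def by blast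
  have "norm (step z h) \<le> (\<Sum>(v, q)\<leftarrow>qs. q) * c"
    unfolding step_def by (rule norm_sum_list_weighted_le) (rule *)
  also have "\<dots> = W * c" by (simp only: W_def)
  also have "\<dots> \<le> 1 / 2" using W_nonneg by (simp add: c_def field_simps)
  finally show ?thesis .
qed

lemma norm_H_le: "norm z \<ge> B \<Longrightarrow> norm (H n z) \<le> 1 / 2"
  by (induction n) (simp, simp only: H.simps norm_step_le)

text \<open>The atoms are zeros of the denominator, so they cannot have modulus \<open>B\<close> or
  more, where the denominator is bounded away from 0.\<close>

lemma atomic_resolvent:
  assumes "atomic_outside B (H n)" "v = 0 \<or> (v, q) \<in> set qs"
  obtains T p where "finite T" "T \<subseteq> \<real>" "\<forall>y\<in>T. cmod y < B \<and> p y > 0" "sum p T = (1 :: real)"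
    "\<forall>z. cmod z \<ge> B \<longrightarrow> inverse (z - of_real (a + v) - H n z) = (\<Sum>y\<in>T. of_real (p y) / (z - y))"
proof -
  from assms(1) obtain S p where S: "finite S" "S \<subseteq> \<real>" "\<forall>x\<in>S. cmod x < B \<and> p x > 0"
    "\<forall>z. cmod z \<ge> B \<longrightarrow> H n z = (\<Sum>x\<in>S. complex_of_real (p x) / (z - x))"
    unfolding atomic_outside_def by blast
  have p: "p x > 0" if "x \<in> S" for x using S(3) that by blast
  obtain T r where T: "finite T" "T \<subseteq> \<real>" "\<forall>y\<in>T. r y > 0" "sum r T = (1 :: real)"
    "\<forall>y\<in>T. y \<notin> S \<and> y - of_real (a + v) = (\<Sum>x\<in>S. of_real (p x) / (y - x))"
    "\<forall>z. z \<notin> S \<longrightarrow> z \<notin> T \<longrightarrow>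
       1 / (z - of_real (a + v) - (\<Sum>x\<in>S. of_real (p x) / (z - x))) = (\<Sum>y\<in>T. of_real (r y) / (z - y))"
    by (rule resolvent_partial_fractions[OF S(1,2) p, where a = "a + v"])
  have T_B: "cmod y < B" if y: "y \<in> T" for y
  proof (rule ccontr)
    assume "\<not> cmod y < B"
    hence yB: "cmod y \<ge> B" by simp
    hence "y - of_real (a + v) - H n y = 0" using T(5)[rule_format, OF y] S(4)[rule_format, OF yB] by simp
    thus False using denominator_nonzero[OF yB norm_H_le[OF yB, of n] assms(2)] by blast
  qed
  show ?thesis
  proof (rule that[OF T(1,2) _ T(4)])
    show "\<forall>z. cmod z \<ge> B \<longrightarrow> inverse (z - of_real (a + v) - H n z) = (\<Sum>y\<in>T. of_real (r y) / (z - y))"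
    proof (intro allI impI)
      fix z assume z: "cmod z \<ge> B"
      hence "z \<notin> S" "z \<notin> T" using S(3) T_B by fastforce+
      thus "inverse (z - of_real (a + v) - H n z) = (\<Sum>y\<in>T. of_real (r y) / (z - y))"
        using T(6)[rule_format, of z] S(4)[rule_format, OF z] by (simp add: inverse_eq_divide)
    qed
  qed (use T(3) T_B in auto)
qed

lemma atomic_H: "atomic_outside B (H n)"
proof (induction n)
  case 0
  show ?case using atomic_outside_0 by simp
next
  case (Suc n)
  have "atomic_outside B (\<lambda>z. inverse (z - of_real (a + v) - H n z))" if "(v, q) \<in> set qs" for v q
  proof -
    have "v = 0 \<or> (v, q) \<in> set qs" using that by simp
    then obtain T p where "finite T" "T \<subseteq> \<real>" "\<forall>y\<in>T. cmod y < B \<and> p y > 0" "sum p T = (1 :: real)"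
      "\<forall>z. cmod z \<ge> B \<longrightarrow> inverse (z - of_real (a + v) - H n z) = (\<Sum>y\<in>T. of_real (p y) / (z - y))"
      by (rule atomic_resolvent[OF Suc])
    thus ?thesis unfolding atomic_outside_def by blast
  qed
  hence "atomic_outside B (\<lambda>z. \<Sum>(v, q)\<leftarrow>xs. of_real q * inverse (z - of_real (a + v) - H n z))"
    if "set xs \<subseteq> set qs" for xs
    using that
  proof (induction xs)
    case Nil
    show ?case using atomic_outside_0 by simp
  next
    case (Cons x xs)
    obtain v q where x: "x = (v, q)" by (cases x)
    show ?case using Cons weight_nonneg unfolding x
      by (auto intro!: atomic_outside_add atomic_outside_cmult)
  qed
  thus ?case by (simp add: step_def)
qed

text \<open>Resolvent identity: the difference of two inverses is \<open>h - g\<close> times both of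
  them, each of norm at most \<open>c\<close>, and \<open>W * c * c \<le> 1 / 2\<close>.\<close>

lemma step_contraction:
  assumes z: "norm z \<ge> B" and h: "norm h \<le> 1 / 2" and g: "norm g \<le> 1 / 2"
  shows "norm (step z h - step z g) \<le> 1 / 2 * norm (h - g)"
proof -
  define c where "c = 1 / (2 * W + 2)"
  have *: "q \<ge> 0 \<and> norm (inverse (z - of_real (a + v) - h) - inverse (z - of_real (a + v) - g)) \<le> norm (h - g) * c * c"
    if vq: "(v, q) \<in> set qs" for v q
  proof
    show "q \<ge> 0" using vq by (rule weight_nonneg)
    let ?x = "z - of_real (a + v) - h" and ?y = "z - of_real (a + v) - g"
    have vq': "v = 0 \<or> (v, q) \<in> set qs" using vq by simp
    have "inverse ?x - inverse ?y = - (inverse ?x * (?x - ?y) * inverse ?y)"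
      by (rule inverse_diff_inverse) (use denominator_nonzero[OF z _ vq'] h g in blast)+
    also have "\<dots> = (h - g) * inverse ?x * inverse ?y" by (simp add: mult_ac) (simp add: algebra_simps)
    finally have "norm (inverse ?x - inverse ?y) = norm (h - g) * norm (inverse ?x) * norm (inverse ?y)"
      by (simp only: norm_mult)
    also have "\<dots> \<le> norm (h - g) * c * c"
      unfolding c_def
      by (intro mult_mono norm_inverse_denominator_le[OF z h vq'] norm_inverse_denominator_le[OF z g vq'])
         (use W_nonneg in auto)
    finally show "norm (inverse ?x - inverse ?y) \<le> norm (h - g) * c * c" .
  qed
  have "norm (step z h - step z g) \<le> (\<Sum>(v, q)\<leftarrow>qs. q) * (norm (h - g) * c * c)"
    unfolding step_def sum_list_weighted_diff by (rule norm_sum_list_weighted_le) (rule *)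
  also have "(\<Sum>(v, q)\<leftarrow>qs. q) = W" by (simp only: W_def)
  also have "W * (norm (h - g) * c * c) = (W * c * c) * norm (h - g)" by simp
  also have "W * c * c \<le> 1 / 2"
  proof -
    have "2 * W \<le> (2 * W + 2) * (2 * W + 2)" using W_nonneg by (simp add: algebra_simps)
    hence "2 * W / ((2 * W + 2) * (2 * W + 2)) \<le> 1"
      using W_nonneg by (intro divide_le_eq_1_pos[THEN iffD2]) auto
    thus ?thesis by (simp add: c_def mult.commute)
  qed
  hence "(W * c * c) * norm (h - g) \<le> 1 / 2 * norm (h - g)" by (intro mult_right_mono) auto
  finally show ?thesis .
qed

text \<open>Fixed point iteration from 0: the increments shrink geometrically, so the limit exists,
  and \<open>step z\<close> is continuous there because its denominators do not vanish.\<close>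

lemma H_limit:
  assumes z: "norm z \<ge> B"
  obtains L where "(\<lambda>n. H n z) \<longlonglongrightarrow> L" "norm L \<le> 1 / 2"
    "L = step z L"
proof -
  have bd: "norm (H (Suc n) z - H n z) \<le> (1 / 2) ^ n" for n
  proof (induction n)
    case 0
    show ?case using norm_step_le[OF z, of 0] by simp
  next
    case (Suc n)
    have "norm (H (Suc (Suc n)) z - H (Suc n) z) \<le> 1 / 2 * norm (H (Suc n) z - H n z)"
      unfolding H.simps(2)[of "Suc n"] unfolding H.simps(2)[of n]
      using step_contraction[OF z norm_H_le[OF z, of "Suc n"] norm_H_le[OF z, of n]] by simp
    also have "\<dots> \<le> 1 / 2 * (1 / 2) ^ n" by (intro mult_left_mono Suc) auto
    finally show ?case by simp
  qed
  have "summable (\<lambda>n. H (Suc n) z - H n z)"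
    by (rule summable_comparison_test'[of "\<lambda>n. (1 / 2) ^ n" 0]) (use bd in \<open>auto simp del: H.simps\<close>)
  hence "(\<lambda>n. \<Sum>k<n. H (Suc k) z - H k z) \<longlonglongrightarrow> (\<Sum>k. H (Suc k) z - H k z)"
    by (rule summable_LIMSEQ)
  moreover have "(\<Sum>k<n. H (Suc k) z - H k z) = H n z" for n
    by (subst sum_lessThan_telescope) simp
  ultimately obtain L where L: "(\<lambda>n. H n z) \<longlonglongrightarrow> L" by auto
  have nL: "norm L \<le> 1 / 2"
    by (rule LIMSEQ_le_const2[OF tendsto_norm[OF L]]) (use norm_H_le[OF z] in auto)
  have "(\<lambda>n. H (Suc n) z) \<longlonglongrightarrow> step z L"
    unfolding H.simps step_def
  proof (rule tendsto_sum_list_weighted)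
    fix v q assume "(v, q) \<in> set qs"
    hence "z - of_real (a + v) - L \<noteq> 0" using denominator_nonzero[OF z nL] by blast
    thus "(\<lambda>n. inverse (z - of_real (a + v) - H n z)) \<longlonglongrightarrow> inverse (z - of_real (a + v) - L)"
      by (intro tendsto_intros L)
  qed
  moreover have "(\<lambda>n. H (Suc n) z) \<longlonglongrightarrow> L" using L by (rule LIMSEQ_Suc)
  ultimately have "L = step z L" using LIMSEQ_unique by blast
  with L nL show ?thesis by (rule that)
qed

text \<open>The case \<open>v = 0\<close> of the partial fractions, whose weights sum to 1. The
  atoms are real numbers of complex type, so the mass function is formed on the complex numbers and
  pushed forward by \<open>Re\<close>.\<close>

lemma approximating_measure:
  "\<exists>\<nu>. real_distribution \<nu> \<and> (AE x in \<nu>. \<bar>x\<bar> \<le> B) \<and>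
    (\<forall>z. cmod z \<ge> B \<longrightarrow> (\<integral>x. 1 / (z - complex_of_real x) \<partial>\<nu>) = inverse (z - of_real a - H n z))"
proof -
  obtain T p where T: "finite T" "T \<subseteq> \<real>" "\<forall>y\<in>T. cmod y < B \<and> p y > 0" "sum p T = (1 :: real)"
    "\<forall>z. cmod z \<ge> B \<longrightarrow> inverse (z - of_real (a + 0) - H n z) = (\<Sum>y\<in>T. of_real (p y) / (z - y))"
    by (rule atomic_resolvent[OF atomic_H[of n] disjI1[OF refl]])
  define f where "f y = (if y \<in> T then p y else 0)" for y
  define P where "P = embed_pmf f"
  have f_nonneg: "f y \<ge> 0" for y using T(3) by (auto simp: f_def less_imp_le)
  have "(\<integral>\<^sup>+y. ennreal (f y) \<partial>count_space UNIV) = (\<Sum>y\<in>T. ennreal (f y))"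
    using T(1) by (intro nn_integral_count_space') (auto simp: f_def)
  also have "\<dots> = ennreal (sum f T)" using f_nonneg by (intro sum_ennreal) auto
  also have "sum f T = 1" using T(4) by (simp add: f_def)
  finally have f1: "(\<integral>\<^sup>+y. ennreal (f y) \<partial>count_space UNIV) = 1" by simp
  have pmf: "pmf P y = f y" for y
    unfolding P_def using f_nonneg f1 by (rule pmf_embed_pmf)
  have set: "set_pmf P \<subseteq> T"
    by (auto simp: set_pmf_iff pmf f_def split: if_splits)
  define \<nu> where "\<nu> = distr (measure_pmf P) borel Re"
  show ?thesis
  proof (intro exI[of _ \<nu>] conjI allI impI)
    show "real_distribution \<nu>"
      unfolding \<nu>_def by (rule prob_space.real_distribution_distr[OF measure_pmf.prob_space_axioms]) auto
    show "AE x in \<nu>. \<bar>x\<bar> \<le> B"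
      unfolding \<nu>_def
    proof (subst AE_distr_iff)
      have "\<bar>Re y\<bar> \<le> B" if "y \<in> T" for y
        using T(3)[rule_format, OF that] abs_Re_le_cmod[of y] by linarith
      thus "AE x in measure_pmf P. \<bar>Re x\<bar> \<le> B"
        using set by (auto simp: AE_measure_pmf_iff)
    qed auto
    fix z assume z: "cmod z \<ge> B"
    have "(\<integral>x. 1 / (z - complex_of_real x) \<partial>\<nu>) = (\<integral>y. 1 / (z - complex_of_real (Re y)) \<partial>measure_pmf P)"
      unfolding \<nu>_def by (subst integral_distr) auto
    also have "\<dots> = (\<Sum>y\<in>T. pmf P y *\<^sub>R (1 / (z - complex_of_real (Re y))))"
      using T(1) set by (intro integral_measure_pmf) auto
    also have "\<dots> = (\<Sum>y\<in>T. of_real (p y) / (z - y))"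
    proof (rule sum.cong[OF refl])
      fix y assume "y \<in> T"
      moreover from this have "complex_of_real (Re y) = y" using T(2) by (auto simp: complex_is_Real_iff complex_eq_iff)
      ultimately show "pmf P y *\<^sub>R (1 / (z - complex_of_real (Re y))) = of_real (p y) / (z - y)"
        by (simp add: pmf f_def scaleR_conv_of_real)
    qed
    also have "\<dots> = inverse (z - of_real a - H n z)" using T(5)[rule_format, OF z] by simp
    finally show "(\<integral>x. 1 / (z - complex_of_real x) \<partial>\<nu>) = inverse (z - of_real a - H n z)" .
  qed
qed

text \<open>A common compact support gives a weakly convergent subsequence. Its transforms converge
  to \<open>1 / (y - a - L)\<close> with \<open>L = step y L\<close>, and this fixed point equation
  is the R-equation.\<close>

lemma exists_measure_with_Levy_R:
  "\<exists>\<mu>. compact_distr \<mu> \<and> fps_R \<mu> = Levy_fps a qs"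
proof -
  obtain \<nu> where \<nu>: "\<And>n. real_distribution (\<nu> n)" "\<And>n. AE x in \<nu> n. \<bar>x\<bar> \<le> B"
    "\<And>n z. cmod z \<ge> B \<Longrightarrow> (\<integral>x. 1 / (z - complex_of_real x) \<partial>\<nu> n) = inverse (z - of_real a - H n z)"
    using approximating_measure by metis
  have "tight \<nu>"
    unfolding tight_def
  proof (intro conjI allI impI \<nu>(1))
    fix \<epsilon> :: real assume "\<epsilon> > 0"
    \<comment> \<open>The intervals in \<open>tight\<close> are half open, so the left end is moved
      below \<open>- B\<close>.\<close>
    have "measure (\<nu> n) {- B - 1<..B} = 1" for n
    proof -
      interpret real_distribution "\<nu> n" by (rule \<nu>(1))
      have "AE x in \<nu> n. x \<in> {- B - 1<..B}" using \<nu>(2)[of n] by eventually_elim auto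
      thus ?thesis by (subst prob_eq_1) auto
    qed
    thus "\<exists>a b. a < b \<and> (\<forall>n. 1 - \<epsilon> < measure (\<nu> n) {a<..b})"
      using B_ge \<open>\<epsilon> > 0\<close> by (intro exI[of _ "- B - 1"] exI[of _ B]) auto
  qed
  then obtain r M where r: "strict_mono r" and M: "real_distribution M" and weak: "weak_conv_m (\<nu> \<circ> id \<circ> r) M"
    using tight_imp_convergent_subsubsequence[OF _ strict_mono_id] by blast
  interpret M: real_distribution M by (rule M)
  have conv: "(\<lambda>n. \<integral>x. f x \<partial>\<nu> (r n)) \<longlonglongrightarrow> (\<integral>x. f x \<partial>M)"
    if "\<And>x. isCont f x" "\<And>x. norm (f x) \<le> C" for f :: "real \<Rightarrow> 'b :: {banach, second_countable_topology}" and C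
    using weak_conv_imp_integral_bdd_continuous_conv[of "\<nu> \<circ> id \<circ> r" M f C] \<nu>(1) M weak that
    by (simp add: o_def)
  have supp: "AE x in M. \<bar>x\<bar> \<le> B"
  proof -
    \<comment> \<open>A bounded continuous function that vanishes exactly on \<open>[-B, B]\<close>;
      its integral under the weak limit is 0.\<close>
    define f where "f x = min 1 (max 0 (\<bar>x\<bar> - B))" for x :: real
    have f: "isCont f x" "norm (f x) \<le> 1" "f x \<ge> 0" for x
      unfolding f_def by (auto intro!: continuous_intros)
    have [measurable]: "f \<in> borel_measurable borel" unfolding f_def[abs_def] by measurable
    have "(\<integral>x. f x \<partial>\<nu> (r n)) = 0" for n
    proof (rule integral_eq_zero_AE)
      show "AE x in \<nu> (r n). f x = 0" using \<nu>(2)[of "r n"] by eventually_elim (simp add: f_def)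
    qed
    hence "(\<integral>x. f x \<partial>M) = 0"
      using conv[of f 1, OF f(1,2)] by (simp add: LIMSEQ_const_iff)
    moreover have "integrable M f"
      by (rule M.integrable_const_bound[of _ 1]) (use f in auto)
    ultimately have "AE x in M. f x = 0"
      using integral_nonneg_eq_0_iff_AE[of M f] f(3) by simp
    thus ?thesis by eventually_elim (auto simp: f_def min_def max_def split: if_splits)
  qed
  have cd: "compact_distr M"
    by (rule compact_distrI[OF M.prob_space_axioms M.events_eq_borel supp])
  let ?f = "\<lambda>w. of_real a * w + (\<Sum>(v, q)\<leftarrow>qs. of_real q * (w\<^sup>2 / (1 - of_real v * w)))"
  have "\<forall>\<^sub>F z in nhds 0. z \<in> ball (0::complex) (1 / (2 * B))"
    using B_ge by (intro eventually_nhds_in_open) auto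
  hence "\<forall>\<^sub>F z in nhds 0. 1 + ?f (z * M_transform M z) = M_transform M z"
  proof eventually_elim
    case (elim z)
    show ?case
    proof (cases "z = 0")
      case True
      have "(\<Sum>(v, q)\<leftarrow>xs. complex_of_real q * (0\<^sup>2 / (1 - complex_of_real v * 0))) = 0" for xs
        by (induction xs) auto
      moreover have "M_transform M 0 = 1" using M.prob_space by (simp add: M_transform_def)
      ultimately show ?thesis using True by simp
    next
      case False
      have z: "B * norm z \<le> 1 / 2" using elim B_ge by (simp add: field_simps)
      \<comment> \<open>In the variable \<open>y\<close> the transform is
        \<open>M z = y * G y\<close> with the Cauchy transform \<open>G\<close>.\<close>
      define y where "y = 1 / z"
      have y: "norm y \<ge> B"
      proof -
        have "B * norm z \<le> 1" using z by linarith
        thus ?thesis using False by (simp add: y_def norm_divide field_simps)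
      qed
      obtain L where L: "(\<lambda>n. H n y) \<longlonglongrightarrow> L" "norm L \<le> 1 / 2" "L = step y L"
        using H_limit[OF y] by blast
      \<comment> \<open>For real \<open>y\<close> the integrand has a pole on the line. Clamping
        \<open>x\<close> to \<open>[-B, B]\<close> makes it bounded and continuous without changing
        the integrals.\<close>
      define clamp where "clamp x = max (- B) (min B x)" for x
      define f where "f x = 1 / (1 - complex_of_real (clamp x) * z)" for x
      have small: "norm (complex_of_real (clamp x) * z) \<le> 1 / 2" for x
      proof -
        have "\<bar>clamp x\<bar> \<le> B" using B_ge by (auto simp: clamp_def)
        hence "norm (complex_of_real (clamp x) * z) \<le> B * norm z"
          unfolding norm_mult norm_of_real by (intro mult_right_mono) auto
        thus ?thesis using z by linarith
      qed
      have den: "norm (1 - complex_of_real (clamp x) * z) \<ge> 1 / 2" for x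
        by (rule norm_one_minus_ge_half[OF small])
      have cont: "isCont f x" for x
        unfolding f_def clamp_def[abs_def]
        by (intro continuous_intros) (use den[of x] in \<open>auto simp: clamp_def\<close>)
      have bound: "norm (f x) \<le> 2" for x
      proof -
        have "1 / norm (1 - complex_of_real (clamp x) * z) \<le> 1 / (1 / 2)"
          by (intro frac_le den) auto
        thus ?thesis by (simp add: f_def norm_divide)
      qed
      have [measurable]: "f \<in> borel_measurable borel"
        using cont by (intro borel_measurable_continuous_onI continuous_at_imp_continuous_on) auto
      have f_int: "(\<integral>x. f x \<partial>\<rho>) = M_transform \<rho> z" if "real_distribution \<rho>" "AE x in \<rho>. \<bar>x\<bar> \<le> B" for \<rho>
      proof -
        interpret real_distribution \<rho> by fact
        have clamp_eq: "clamp x = x" if "\<bar>x\<bar> \<le> B" for x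
          using that by (auto simp: clamp_def min_def max_def)
        have "AE x in \<rho>. f x = 1 / (1 - complex_of_real x * z)"
          using that(2) by eventually_elim (simp add: f_def clamp_eq)
        thus ?thesis unfolding M_transform_def by (intro integral_cong_AE) auto
      qed
      have "M_transform (\<nu> n) z = y * inverse (y - of_real a - H n y)" for n
      proof -
        have "1 / (1 - complex_of_real x * z) = y * (1 / (y - complex_of_real x))" for x
        proof -
          have "y - complex_of_real x = y * (1 - complex_of_real x * z)"
            using False by (simp add: y_def field_simps)
          thus ?thesis using False by (simp add: y_def)
        qed
        hence "M_transform (\<nu> n) z = (\<integral>x. y * (1 / (y - complex_of_real x)) \<partial>\<nu> n)"
          unfolding M_transform_def by (intro Bochner_Integration.integral_cong refl)
        also have "\<dots> = y * inverse (y - of_real a - H n y)"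
          unfolding integral_mult_right_zero \<nu>(3)[OF y] ..
        finally show ?thesis .
      qed
      hence lim1: "(\<lambda>n. y * inverse (y - of_real a - H (r n) y)) \<longlonglongrightarrow> M_transform M z"
        using conv[OF cont bound] f_int[OF \<nu>(1,2)] f_int[OF M supp] by simp
      define D where "D = y - of_real a - L"
      have nz: "y - of_real (a + v) - L \<noteq> 0" if "v = 0 \<or> (v, q) \<in> set qs" for v q
        by (rule denominator_nonzero[OF y L(2) that])
      have D0: "D \<noteq> 0" using nz[of 0 0] by (simp add: D_def)
      have "(\<lambda>n. H (r n) y) \<longlonglongrightarrow> L"
        using LIMSEQ_subseq_LIMSEQ[OF L(1) r] by (simp add: o_def)
      hence "(\<lambda>n. y * inverse (y - of_real a - H (r n) y)) \<longlonglongrightarrow> y * inverse D"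
        unfolding D_def using D0 by (intro tendsto_intros) (auto simp: D_def)
      with lim1 have M_eq: "M_transform M z = y * inverse D" by (rule LIMSEQ_unique)
      have w: "z * M_transform M z = inverse D" using False by (simp add: M_eq y_def)
      \<comment> \<open>With \<open>w = 1 / D\<close> each \<open>w^2 / (1 - v w)\<close> becomes
        \<open>w / (D - v)\<close>, so the sum over all nodes is
        \<open>w * step y L = w * L\<close>.\<close>
      have "(\<Sum>(v, q)\<leftarrow>xs. of_real q * ((inverse D)\<^sup>2 / (1 - of_real v * inverse D))) =
         inverse D * (\<Sum>(v, q)\<leftarrow>xs. of_real q * inverse (y - of_real (a + v) - L))" if "set xs \<subseteq> set qs" for xs
        using that
      proof (induction xs)
        case (Cons x xs)
        obtain v q where x: "x = (v, q)" by (cases x)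
        have "D - of_real v \<noteq> 0" using nz[of v q] Cons.prems x by (auto simp: D_def algebra_simps)
        hence "(inverse D)\<^sup>2 / (1 - of_real v * inverse D) = inverse D * inverse (D - of_real v)"
          using D0 by (simp add: power2_eq_square field_simps)
        also have "D - of_real v = y - of_real (a + v) - L" by (simp add: D_def)
        finally have e: "(inverse D)\<^sup>2 / (1 - of_real v * inverse D) = inverse D * inverse (y - of_real (a + v) - L)" .
        have "of_real q * ((inverse D)\<^sup>2 / (1 - of_real v * inverse D)) =
            inverse D * (of_real q * inverse (y - of_real (a + v) - L))"
          unfolding e by (rule mult.left_commute)
        moreover have "(\<Sum>(v, q)\<leftarrow>xs. of_real q * ((inverse D)\<^sup>2 / (1 - of_real v * inverse D))) =
           inverse D * (\<Sum>(v, q)\<leftarrow>xs. of_real q * inverse (y - of_real (a + v) - L))"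
          using Cons by simp
        ultimately show ?case by (simp only: x list.map sum_list.Cons prod.case distrib_left)
      qed auto
      hence "1 + ?f (inverse D) = 1 + inverse D * (of_real a + step y L)"
        unfolding step_def by (simp add: algebra_simps)
      also have "\<dots> = 1 + inverse D * (y - D)" unfolding L(3)[symmetric] by (simp add: D_def)
      also have "\<dots> = y * inverse D" using D0 by (simp add: field_simps)
      finally show ?thesis unfolding w unfolding M_eq .
    qed
  qed
  moreover have "?f has_fps_expansion Levy_fps a qs"
    by (rule has_fps_expansion_Levy)
  ultimately have "fps_R M = Levy_fps a qs" using fps_R_eqI_fun[OF cd] by blast
  with cd show ?thesis by blast
qed

end

section \<open>Wigner and Marchenko--Pastur laws\<close>

lemma has_integral_sin_sin:
  "((\<lambda>x. sin x * sin (real (Suc n) * x)) has_integral (if n = 0 then pi / 2 else 0)) {0..pi}"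
proof (cases "n = 0")
  case True
  have "((\<lambda>x. sin x * sin x) has_integral
      (pi / 2 - sin pi * cos pi / 2) - (0 / 2 - sin 0 * cos 0 / 2)) {0..pi}"
  proof (rule fundamental_theorem_of_calculus)
    fix x :: real
    have "((\<lambda>x. x / 2 - sin x * cos x / 2) has_real_derivative
        1 / 2 - (cos x * cos x - sin x * sin x) / 2) (at x within {0..pi})"
      by (auto intro!: derivative_eq_intros)
    also have "1 / 2 - (cos x * cos x - sin x * sin x) / 2 = sin x * sin x"
      using sin_cos_squared_add[of x] by (simp add: power2_eq_square diff_divide_distrib)
    finally show "((\<lambda>x. x / 2 - sin x * cos x / 2) has_vector_derivative sin x * sin x) (at x within {0..pi})"
      by (simp only: has_real_derivative_iff_has_vector_derivative)
  qed auto
  thus ?thesis using True by simp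
next
  case False
  \<comment> \<open>Antiderivative from
    \<open>2 sin x sin ((n + 1) x) = cos (n x) - cos ((n + 2) x)\<close>; its division by
    \<open>n\<close> sets the case \<open>n = 0\<close> apart.\<close>
  define F where "F = (\<lambda>x. (sin (real n * x) / real n - sin (real (n + 2) * x) / real (n + 2)) / 2)"
  have "((\<lambda>x. sin x * sin (real (Suc n) * x)) has_integral F pi - F 0) {0..pi}"
  proof (rule fundamental_theorem_of_calculus)
    fix x :: real assume "x \<in> {0..pi}"
    have "cos (real n * x) - cos (real (n + 2) * x) = 2 * sin (real (Suc n) * x) * sin x"
      using cos_add[of "real (Suc n) * x" x] cos_diff[of "real (Suc n) * x" x]
      by (simp add: algebra_simps)
    hence "(cos (real n * x) - cos (real (n + 2) * x)) / 2 = sin x * sin (real (Suc n) * x)"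
      by simp
    thus "(F has_vector_derivative sin x * sin (real (Suc n) * x)) (at x within {0..pi})"
      using False
      unfolding has_real_derivative_iff_has_vector_derivative[symmetric] F_def
      by (auto intro!: derivative_eq_intros simp del: of_nat_Suc of_nat_add)
  qed auto
  moreover have "F pi = 0"
    unfolding F_def by (simp only: sin_npi) simp
  ultimately show ?thesis using False by (simp add: F_def)
qed

text \<open>The denominator factors as \<open>(1 - r e^(i x)) (1 - r e^(- i x))\<close>.\<close>

lemma poisson_denominator_ge:
  fixes r :: complex
  assumes "norm r < 1"
  shows "norm (1 - 2 * r * of_real (cos x) + r\<^sup>2) \<ge> (1 - norm r)\<^sup>2"
proof -
  have "1 - 2 * r * of_real (cos x) + r\<^sup>2 = (1 - r * cis x) * (1 - r * cis (-x))"
    by (simp add: complex_eq_iff power2_eq_square algebra_simps)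
  moreover have "norm (1 - r * cis y) \<ge> 1 - norm r" for y
    using norm_triangle_ineq2[of 1 "r * cis y"] by (simp add: norm_mult)
  ultimately show ?thesis using assms
    by (auto simp: norm_mult power2_eq_square intro!: mult_mono)
qed

text \<open>Since \<open>sin x / (1 - 2 r cos x + r^2)\<close> is the sum of
  \<open>r^n sin ((n + 1) x)\<close>, orthogonality with \<open>sin x\<close> leaves only
  \<open>n = 0\<close>. Hence the value does not depend on \<open>r\<close>.\<close>

lemma has_integral_poisson:
  fixes r :: complex
  assumes r: "norm r < 1"
  shows "((\<lambda>x. of_real ((sin x)\<^sup>2) / (1 - 2 * r * of_real (cos x) + r\<^sup>2)) has_integral of_real (pi / 2)) {0..pi}"
    (is "(?f has_integral _) _")
proof -
  define S where "S N x = (\<Sum>n<N. r ^ n * of_real (sin x * sin (real (Suc n) * x)))" for N x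
  have den: "1 - 2 * r * of_real (cos x) + r\<^sup>2 \<noteq> 0" for x
  proof -
    have "0 < (1 - norm r)\<^sup>2" using r by simp
    also note poisson_denominator_ge[OF r, of x]
    finally show ?thesis by auto
  qed
  have S_int: "(S N has_integral (if N = 0 then 0 else pi / 2)) {0..pi}" for N
  proof -
    have "((\<lambda>x. r ^ n * of_real (sin x * sin (real (Suc n) * x))) has_integral
        r ^ n * of_real (if n = 0 then pi / 2 else 0)) {0..pi}" for n
      using has_integral_linear[OF has_integral_sin_sin[of n] bounded_linear_of_real]
      by (intro has_integral_mult_right) (simp only: o_def)
    hence "(S N has_integral (\<Sum>n<N. r ^ n * of_real (if n = 0 then pi / 2 else 0))) {0..pi}"
      unfolding S_def by (intro has_integral_sum) auto
    also have "(\<Sum>n<N. r ^ n * of_real (if n = 0 then pi / 2 else 0)) = (if N = 0 then 0 else pi / 2)"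
      by (induction N) auto
    finally show ?thesis .
  qed
  \<comment> \<open>Closed form of the partial sums, from
    \<open>sin ((N + 2) x) = 2 cos x sin ((N + 1) x) - sin (N x)\<close>; the remainder is of order
    \<open>r^N\<close>.\<close>
  have S_eq: "S N x * (1 - 2 * r * of_real (cos x) + r\<^sup>2) =
      of_real (sin x) * (of_real (sin x) - r ^ N * of_real (sin (real (Suc N) * x))
        + r ^ Suc N * of_real (sin (real N * x)))" for N x
  proof (induction N)
    case 0
    thus ?case by (simp add: S_def)
  next
    case (Suc N)
    have "sin (real (Suc (Suc N)) * x) + sin (real N * x) = 2 * sin (real (Suc N) * x) * cos x"
      using sin_add[of "real (Suc N) * x" x] sin_diff[of "real (Suc N) * x" x]
      by (simp add: algebra_simps)
    hence e: "of_real (sin (real (Suc (Suc N)) * x)) =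
       (2 * of_real (sin (real (Suc N) * x)) * of_real (cos x) - of_real (sin (real N * x)) :: complex)"
      by (metis (no_types, lifting) add_diff_cancel_right' of_real_diff of_real_mult of_real_numeral)
    have "S (Suc N) x = S N x + r ^ N * (of_real (sin x) * of_real (sin (real (Suc N) * x)))"
      by (simp add: S_def)
    thus ?case
      unfolding e using Suc.IH
      by (simp add: algebra_simps power2_eq_square del: of_nat_Suc)
  qed
  have cont: "continuous_on {0..pi} ?f"
    using den by (intro continuous_intros) auto
  have f_int: "(?f has_integral integral {0..pi} ?f) {0..pi}"
    using cont by (intro integrable_integral integrable_continuous_real)
  have "norm (integral {0..pi} ?f - (if N = 0 then 0 else pi / 2)) \<le>
      (2 * norm r ^ N / (1 - norm r)\<^sup>2) * pi" for N
  proof -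
    have "((\<lambda>x. ?f x - S N x) has_integral (integral {0..pi} ?f - (if N = 0 then 0 else pi / 2))) {0..pi}"
      by (intro has_integral_diff f_int S_int)
    moreover have "norm (?f x - S N x) \<le> 2 * norm r ^ N / (1 - norm r)\<^sup>2" for x
    proof -
      let ?d = "1 - 2 * r * of_real (cos x) + r\<^sup>2"
      have "S N x = S N x * ?d / ?d" using den by simp
      hence "?f x - S N x = of_real (sin x) * (r ^ N * of_real (sin (real (Suc N) * x))
           - r ^ Suc N * of_real (sin (real N * x))) / ?d"
        unfolding S_eq by (simp add: algebra_simps power2_eq_square diff_divide_distrib[symmetric]
             add_divide_distrib[symmetric] del: of_nat_Suc)
      also have "norm \<dots> \<le> (1 * (norm r ^ N * 1 + norm r ^ N * 1)) / (1 - norm r)\<^sup>2"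
        unfolding norm_divide norm_mult
      proof (intro frac_le mult_mono order.trans[OF norm_triangle_ineq4] add_mono)
        show "norm (r ^ N * complex_of_real (sin (real (Suc N) * x))) \<le> norm r ^ N * 1"
          unfolding norm_mult norm_power by (intro mult_left_mono) (auto simp del: of_nat_Suc)
        have "norm (r ^ Suc N * complex_of_real (sin (real N * x))) \<le> norm r ^ Suc N * 1"
          unfolding norm_mult norm_power by (intro mult_left_mono) auto
        also have "\<dots> \<le> norm r ^ N * 1"
          using r by (simp add: mult_left_le_one_le)
        finally show "norm (r ^ Suc N * complex_of_real (sin (real N * x))) \<le> norm r ^ N * 1" .
      qed (use r in \<open>auto simp: poisson_denominator_ge\<close>)
      finally show ?thesis by simp
    qed
    ultimately have "norm (integral {0..pi} ?f - (if N = 0 then 0 else pi / 2)) \<le>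
       (2 * norm r ^ N / (1 - norm r)\<^sup>2) * measure lborel {0..pi}"
      by (intro has_integral_bound_real) auto
    thus ?thesis by simp
  qed
  moreover have "(\<lambda>N. (2 * norm r ^ N / (1 - norm r)\<^sup>2) * pi) \<longlonglongrightarrow> (2 * 0 / (1 - norm r)\<^sup>2) * pi"
    by (intro tendsto_intros LIMSEQ_power_zero) (use r in auto)
  ultimately have "(\<lambda>N. integral {0..pi} ?f - (if N = 0 then 0 else pi / 2)) \<longlonglongrightarrow> 0"
    by (intro Lim_null_comparison[OF always_eventually,
          of "\<lambda>N. integral {0..pi} ?f - (if N = 0 then 0 else pi / 2)"
             "\<lambda>N. (2 * norm r ^ N / (1 - norm r)\<^sup>2) * pi"]) simp_all
  \<comment> \<open>Only the empty partial sum has integral 0; without it the sequence is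
    constant.\<close>
  hence "(\<lambda>N. integral {0..pi} ?f - (if Suc N = 0 then 0 else pi / 2)) \<longlonglongrightarrow> 0"
    by (rule LIMSEQ_Suc)
  hence "integral {0..pi} ?f = of_real (pi / 2)"
    by (simp add: LIMSEQ_const_iff)
  with f_int show ?thesis by (simp only:)
qed

text \<open>Substituting \<open>x = - 2 s cos y\<close>, increasing thanks to the sign, gives the
  Poisson type integral at \<open>- r\<close>. As the value does not depend on \<open>r\<close>, one
  formula yields both total masses and transforms.\<close>

lemma semicircle_integral:
  fixes r :: complex and s :: real
  assumes s: "s > 0" and r: "norm r < 1"
  defines "f \<equiv> (\<lambda>x. complex_of_real (sqrt (4 * s\<^sup>2 - x\<^sup>2)) / (of_real s * (1 + r\<^sup>2) - r * of_real x))"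
  shows "set_integrable lborel {- 2 * s..2 * s} f"
    and "(LINT x:{- 2 * s..2 * s}|lborel. f x) = 2 * pi * s"
proof -
  have den: "of_real s * (1 + r\<^sup>2) - r * of_real x \<noteq> 0" if x: "x \<in> {- 2 * s..2 * s}" for x
  proof -
    define y where "y = arccos (x / (2 * s))"
    have x_eq: "x = 2 * s * cos y"
      using x s unfolding y_def by (subst cos_arccos) (auto simp: field_simps)
    have "0 < (1 - norm r)\<^sup>2" using r by simp
    also note poisson_denominator_ge[OF r, of y]
    finally have "of_real s * (1 - 2 * r * of_real (cos y) + r\<^sup>2) \<noteq> 0" using s by auto
    thus ?thesis by (simp add: x_eq algebra_simps)
  qed
  have cont: "continuous_on {- 2 * s..2 * s} f"
    unfolding f_def using den by (intro continuous_intros) auto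
  show int: "set_integrable lborel {- 2 * s..2 * s} f"
    using cont by (rule borel_integrable_atLeastAtMost')
  define g where "g x = - 2 * s * cos x" for x :: real
  have "((\<lambda>x. (2 * s * sin x) *\<^sub>R f (g x)) has_integral integral {g 0..g pi} f) {0..pi}"
  proof (rule has_integral_substitution)
    show "g ` {0..pi} \<subseteq> {- 2 * s..2 * s}"
    proof
      fix y assume "y \<in> g ` {0..pi}"
      then obtain x where "y = - (2 * s) * cos x" by (auto simp: g_def)
      moreover have "\<bar>2 * s * cos x\<bar> \<le> 2 * s * 1"
        unfolding abs_mult using s by (intro mult_mono) auto
      ultimately show "y \<in> {- 2 * s..2 * s}" by auto
    qed
    show "(g has_real_derivative 2 * s * sin x) (at x within {0..pi})" for x
      unfolding g_def by (auto intro!: derivative_eq_intros)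
  qed (use cont s in \<open>auto simp: g_def\<close>)
  moreover have "(2 * s * sin x) *\<^sub>R f (g x) =
     4 * of_real s * (of_real ((sin x)\<^sup>2) / (1 - 2 * (- r) * of_real (cos x) + (- r)\<^sup>2))"
    if "x \<in> {0..pi}" for x
  proof -
    have "sin x \<ge> 0" using that by (simp add: sin_ge_zero)
    have "4 * s\<^sup>2 - (g x)\<^sup>2 = (2 * s)\<^sup>2 * (1 - (cos x)\<^sup>2)"
      by (simp add: g_def power2_eq_square algebra_simps)
    also have "\<dots> = (2 * s * sin x)\<^sup>2"
      by (simp add: sin_squared_eq power_mult_distrib)
    finally have 1: "sqrt (4 * s\<^sup>2 - (g x)\<^sup>2) = 2 * s * sin x"
      using s \<open>sin x \<ge> 0\<close> by (simp add: real_sqrt_abs)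
    have 2: "of_real s * (1 + r\<^sup>2) - r * of_real (g x) =
        of_real s * (1 - 2 * (- r) * of_real (cos x) + (- r)\<^sup>2)"
      by (simp add: g_def algebra_simps)
    have 3: "(2 * S * a) * ((2 * S * a) / (S * D)) = 4 * S * (a\<^sup>2 / D)" if "S \<noteq> 0" for S a D :: complex
      using that by (cases "D = 0") (simp_all add: power2_eq_square)
    show ?thesis unfolding f_def 1 2 scaleR_conv_of_real
      using 3[of "of_real s" "of_real (sin x)"] s by simp
  qed
  ultimately have "((\<lambda>x. 4 * of_real s * (of_real ((sin x)\<^sup>2) /
      (1 - 2 * (- r) * of_real (cos x) + (- r)\<^sup>2))) has_integral integral {- 2 * s..2 * s} f) {0..pi}"
    by (subst (asm) has_integral_cong) (auto simp: g_def)
  moreover have "((\<lambda>x. 4 * of_real s * (of_real ((sin x)\<^sup>2) /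
      (1 - 2 * (- r) * of_real (cos x) + (- r)\<^sup>2))) has_integral 4 * of_real s * of_real (pi / 2)) {0..pi}"
    using has_integral_poisson[of "- r"] r by (intro has_integral_mult_right) simp
  ultimately have "integral {- 2 * s..2 * s} f = 4 * of_real s * of_real (pi / 2)"
    by (rule has_integral_unique)
  thus "(LINT x:{- 2 * s..2 * s}|lborel. f x) = 2 * pi * s"
    using set_borel_integral_eq_integral(2)[OF int] by simp
qed

lemma semicircle_integral_real:
  fixes r s :: real
  assumes s: "s > 0" and r: "\<bar>r\<bar> < 1"
  defines "f \<equiv> (\<lambda>x. sqrt (4 * s\<^sup>2 - x\<^sup>2) / (s * (1 + r\<^sup>2) - r * x))"
  shows "set_integrable lborel {- 2 * s..2 * s} f"
    and "(LINT x:{- 2 * s..2 * s}|lborel. f x) = 2 * pi * s"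
proof -
  have r': "norm (complex_of_real r) < 1" using r by simp
  have eq: "complex_of_real (sqrt (4 * s\<^sup>2 - x\<^sup>2)) /
      (of_real s * (1 + (of_real r)\<^sup>2) - of_real r * of_real x) = of_real (f x)" for x
    by (simp add: f_def)
  note * = semicircle_integral[OF s r', unfolded eq]
  show "set_integrable lborel {- 2 * s..2 * s} f"
    using *(1) unfolding set_integrable_def
    by (subst complex_of_real_integrable_eq[symmetric]) (simp add: scaleR_conv_of_real)
  have "complex_of_real (LINT x:{- 2 * s..2 * s}|lborel. f x) = of_real (2 * pi * s)"
    using *(2) unfolding set_lebesgue_integral_def
    by (subst integral_complex_of_real[symmetric]) (simp add: scaleR_conv_of_real)
  thus "(LINT x:{- 2 * s..2 * s}|lborel. f x) = 2 * pi * s"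
    by (simp only: of_real_eq_iff)
qed

section \<open>Transforms of the Wigner and Marchenko-Pastur laws\<close>

text \<open>The roots of \<open>X^2 - \<alpha> X + 1\<close> have product 1 and sum \<alpha>. If
  \<open>norm \<alpha> > 2\<close> they cannot both lie on the unit circle, so one lies
  inside.\<close>

lemma joukowski_inverse:
  fixes \<alpha> :: complex
  assumes "norm \<alpha> > 2"
  obtains r where "r \<noteq> 0" "norm r < 1" "1 + r\<^sup>2 = \<alpha> * r"
proof -
  define d where "d = csqrt (\<alpha>\<^sup>2 - 4)"
  define p where "p = (\<alpha> + d) / 2"
  define q where "q = (\<alpha> - d) / 2"
  have d2: "d * d = \<alpha> * \<alpha> - 4"
    by (metis d_def power2_csqrt power2_eq_square)
  have pq: "p * q = 1" "p + q = \<alpha>"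
    using d2 by (simp_all add: p_def q_def field_simps)
  have "norm p \<noteq> 1 \<or> norm q \<noteq> 1"
    using assms norm_triangle_ineq[of p q] pq by auto
  moreover have n: "norm p * norm q = 1" using pq by (metis norm_mult norm_one)
  ultimately have "norm p < 1 \<or> norm q < 1"
    by (smt (verit) mult_cancel_left2 mult_less_cancel_right1 mult_le_cancel_left1 norm_ge_zero)
  moreover have "1 + p\<^sup>2 = \<alpha> * p" "1 + q\<^sup>2 = \<alpha> * q"
    using pq by (simp_all add: power2_eq_square pq(2)[symmetric] algebra_simps)
  moreover have "p \<noteq> 0" "q \<noteq> 0" using pq by auto
  ultimately show ?thesis using that by blast
qed

text \<open>With \<open>1 + r^2 = r / (s z)\<close> the denominator \<open>1 - x z\<close> is
  proportional to \<open>s (1 + r^2) - r x\<close>, and the semicircle integral gives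
  \<open>M z = 1 + r^2\<close>. Then \<open>z M z = r / s\<close>, so
  \<open>t (z M z)^2 = r^2\<close>.\<close>

lemma Wigner_transform:
  assumes t: "t > 0"
  shows "compact_distr (Wigner t)" (is ?A)
    and "fps_R (Wigner t) = fps_const (complex_of_real t) * fps_X\<^sup>2" (is ?B)
proof -
  define s where "s = sqrt t"
  have s: "s > 0" "s\<^sup>2 = t" using t by (auto simp: s_def)
  have t_eq: "t = s * s" using s(2) by (simp add: power2_eq_square)
  define d where "d x = 1 / (2 * pi * t) * sqrt (4 * t - x\<^sup>2) * indicator {- 2 * sqrt t..2 * sqrt t} x" for x :: real
  have d_eq: "d x = 1 / (2 * pi * t) * (indicator {- 2 * s..2 * s} x * sqrt (4 * s\<^sup>2 - x\<^sup>2))" for x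
    by (simp add: d_def s_def[symmetric] s(2))
  have W: "Wigner t = density lborel (\<lambda>x. ennreal (d x))"
    using t by (simp add: Wigner_def d_def)
  have [measurable]: "d \<in> borel_measurable borel" unfolding d_def[abs_def] by measurable
  have supp: "x \<in> {- 2 * s..2 * s}" if "d x \<noteq> 0" for x
    using that by (auto simp: d_eq indicator_def split: if_splits)
  have d_nonneg: "d x \<ge> 0" for x
  proof (cases "x \<in> {- 2 * s..2 * s}")
    case True
    hence "x\<^sup>2 \<le> (2 * s)\<^sup>2" by (intro power2_le_iff_abs_le[THEN iffD2]) (use s in auto)
    thus ?thesis using t by (simp add: d_eq power_mult_distrib)
  next
    case False
    thus ?thesis using supp[of x] by (cases "d x = 0") auto
  qed
  have int: "integrable lborel d" "integral\<^sup>L lborel d = 1"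
  proof -
    \<comment> \<open>Normalization is the semicircle integral at \<open>r = 0\<close>.\<close>
    have eq: "d x = 1 / (2 * pi * s) * (indicator {- 2 * s..2 * s} x *\<^sub>R
        (sqrt (4 * s\<^sup>2 - x\<^sup>2) / (s * (1 + 0\<^sup>2) - 0 * x)))" for x
      by (simp add: d_eq t_eq)
    have I: "\<bar>0 :: real\<bar> < 1" by simp
    note I = semicircle_integral_real[OF s(1) I, unfolded set_integrable_def set_lebesgue_integral_def]
    show "integrable lborel d"
      unfolding eq[abs_def] using I(1) by (intro integrable_mult_right)
    show "integral\<^sup>L lborel d = 1"
      unfolding eq[abs_def] integral_mult_right_zero I(2) using s(1) by simp
  qed
  have ps: "prob_space (Wigner t)"
  proof
    have "emeasure (Wigner t) (space (Wigner t)) = (\<integral>\<^sup>+x. ennreal (d x) \<partial>lborel)"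
      unfolding W by (subst emeasure_density) auto
    also have "\<dots> = ennreal (integral\<^sup>L lborel d)"
      by (rule nn_integral_eq_integral) (use int d_nonneg in auto)
    finally show "emeasure (Wigner t) (space (Wigner t)) = 1" using int by simp
  qed
  show A: ?A
  proof (rule compact_distrI[OF ps])
    show "sets (Wigner t) = sets borel" by (simp add: W)
    have "0 < ennreal (d x) \<longrightarrow> \<bar>x\<bar> \<le> 2 * s" for x
      using supp[of x] by (cases "d x = 0") auto
    thus "AE x in Wigner t. \<bar>x\<bar> \<le> 2 * s"
      unfolding W by (subst AE_density) auto
  qed
  have M: "M_transform (Wigner t) z = (\<integral>x. d x *\<^sub>R (1 / (1 - complex_of_real x * z)) \<partial>lborel)" for z
    unfolding W M_transform_def using d_nonneg by (subst integral_density) auto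
  show ?B
  proof (rule fps_R_eqI_fun[OF A])
    show "(\<lambda>w. complex_of_real t * w\<^sup>2) has_fps_expansion fps_const (complex_of_real t) * fps_X\<^sup>2"
      by (intro fps_expansion_intros)
    have "\<forall>\<^sub>F z in nhds 0. z \<in> ball (0::complex) (1 / (2 * s))"
      using s by (intro eventually_nhds_in_open) auto
    thus "\<forall>\<^sub>F z in nhds 0. 1 + complex_of_real t * (z * M_transform (Wigner t) z)\<^sup>2 = M_transform (Wigner t) z"
    proof eventually_elim
      case (elim z)
      show ?case
      proof (cases "z = 0")
        case True
        have "M_transform (Wigner t) 0 = 1"
          using prob_space.prob_space[OF ps] by (simp add: M_transform_def)
        thus ?thesis using True by simp
      next
        case False
        have "norm (1 / (of_real s * z)) > 2"
          using elim False s by (simp add: norm_divide norm_mult field_simps)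
        then obtain r where r: "r \<noteq> 0" "norm r < 1" "1 + r\<^sup>2 = 1 / (of_real s * z) * r"
          by (rule joukowski_inverse)
        have den: "of_real s * (1 + r\<^sup>2) - r * of_real x = (r / z) * (1 - of_real x * z)" for x
          unfolding r(3) using False s by (simp add: field_simps)
        have integrand: "d x *\<^sub>R (1 / (1 - complex_of_real x * z)) = (r / z) / (2 * pi * t) *
           (indicator {- 2 * s..2 * s} x *\<^sub>R (complex_of_real (sqrt (4 * s\<^sup>2 - x\<^sup>2)) /
              (of_real s * (1 + r\<^sup>2) - r * of_real x)))" for x
          unfolding den d_eq using r(1) False by (simp add: scaleR_conv_of_real indicator_def)
        have "M_transform (Wigner t) z = (r / z) / (2 * pi * t) * (2 * pi * s)"
          unfolding M integrand integral_mult_right_zero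
            semicircle_integral(2)[OF s(1) r(2), unfolded set_lebesgue_integral_def] ..
        also have "\<dots> = 1 + r\<^sup>2"
          unfolding r(3) using s by (simp add: t_eq field_simps)
        finally have M_eq: "M_transform (Wigner t) z = 1 + r\<^sup>2" .
        have "z * (1 + r\<^sup>2) = r / of_real s"
          unfolding r(3) using False by simp
        thus ?thesis unfolding M_eq using s by (simp add: t_eq power2_eq_square)
      qed
    qed
  qed
qed


text \<open>Up to a factor, \<open>1 + t + x\<close> is \<open>s (1 + r^2) - r x\<close> with
  \<open>r = - s\<close> for \<open>t < 1\<close> and \<open>r = - 1 / s\<close> for
  \<open>t > 1\<close>; the two factors produce \<open>min 1 t\<close>. At \<open>t = 1\<close> this
  \<open>r\<close> lies on the unit circle and the integrand is unbounded near \<open>- 2\<close>,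
  so an explicit antiderivative is used.\<close>

lemma semicircle_inverse_integral:
  fixes t :: real
  assumes t: "t > 0"
  defines "s \<equiv> sqrt t"
  defines "f \<equiv> (\<lambda>x. sqrt (4 * t - x\<^sup>2) / (1 + t + x))"
  shows "set_integrable lborel {- 2 * s..2 * s} f"
    and "(LINT x:{- 2 * s..2 * s}|lborel. f x) = 2 * pi * min 1 t"
proof -
  have s: "s > 0" "s\<^sup>2 = t" using t by (auto simp: s_def)
  have t_eq: "t = s * s" using s(2) by (simp add: power2_eq_square)
  have "set_integrable lborel {- 2 * s..2 * s} f \<and> (LINT x:{- 2 * s..2 * s}|lborel. f x) = 2 * pi * min 1 t"
  proof (rule linorder_cases[of t 1])
    assume less: "t < 1"
    hence "s < 1" by (simp add: s_def)
    hence *: "\<bar>- s\<bar> < 1" using s by simp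
    have eq: "f x = s * (sqrt (4 * s\<^sup>2 - x\<^sup>2) / (s * (1 + (- s)\<^sup>2) - (- s) * x))" for x
    proof -
      have "s * (1 + (- s)\<^sup>2) - (- s) * x = s * (1 + t + x)" by (simp add: s(2) algebra_simps)
      thus ?thesis using s(1) by (simp only: s(2)) (simp add: f_def)
    qed
    have "set_integrable lborel {- 2 * s..2 * s} f \<and> (LINT x:{- 2 * s..2 * s}|lborel. f x) = s * (2 * pi * s)"
      unfolding eq set_integral_mult_right using semicircle_integral_real[OF s(1) *]
      by (intro conjI set_integrable_mult_right) (simp_all only:)
    thus ?thesis using less by (simp add: t_eq)
  next
    assume less: "t > 1"
    hence "s > 1" by (simp add: s_def)
    hence *: "\<bar>- 1 / s\<bar> < 1" by simp
    have eq: "f x = (1 / s) * (sqrt (4 * s\<^sup>2 - x\<^sup>2) / (s * (1 + (- 1 / s)\<^sup>2) - (- 1 / s) * x))" for x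
    proof -
      have "s * (1 + (- 1 / s)\<^sup>2) - (- 1 / s) * x = (1 / s) * (1 + t + x)"
        using s(1) by (simp add: t_eq power2_eq_square field_simps)
      thus ?thesis using s(1) by (simp only: s(2)) (simp add: f_def)
    qed
    have "set_integrable lborel {- 2 * s..2 * s} f \<and> (LINT x:{- 2 * s..2 * s}|lborel. f x) = (1 / s) * (2 * pi * s)"
      unfolding eq set_integral_mult_right using semicircle_integral_real[OF s(1) *]
      by (intro conjI set_integrable_mult_right) (simp_all only:)
    thus ?thesis using less s by simp
  next
    assume t1: "t = 1"
    hence s1: "s = 1" by (simp add: s_def)
    define F where "F x = sqrt (4 - x\<^sup>2) + 2 * arcsin (x / 2)" for x :: real
    have "(f has_integral F 2 - F (- 2)) {- 2..2}"
    proof (rule fundamental_theorem_of_calculus_interior)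
      show "continuous_on {- 2..2} F"
        unfolding F_def by (intro continuous_intros) auto
      fix x :: real assume x: "x \<in> {- 2<..<2}"
      hence "\<bar>x\<bar> < 2" by auto
      hence "x\<^sup>2 < 2\<^sup>2" using abs_square_less_1[of "x / 2"] by (simp add: power_divide)
      hence pos: "0 < 4 - x\<^sup>2" by simp
      have "1 - (x / 2)\<^sup>2 = (4 - x\<^sup>2) / 4" by (simp add: power2_eq_square field_simps)
      hence q: "sqrt (1 - (x / 2)\<^sup>2) = sqrt (4 - x\<^sup>2) / 2" by (simp only: real_sqrt_divide) simp
      have "(F has_real_derivative - x / sqrt (4 - x\<^sup>2) + inverse (sqrt (1 - (x / 2)\<^sup>2))) (at x)"
        unfolding F_def using x pos
        by (auto intro!: derivative_eq_intros simp: field_simps)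
      also have "- x / sqrt (4 - x\<^sup>2) + inverse (sqrt (1 - (x / 2)\<^sup>2)) = (2 - x) / sqrt (4 - x\<^sup>2)"
        unfolding q by (simp add: diff_divide_distrib)
      also have "\<dots> = f x"
      proof -
        have "(2 - x) * (2 + x) = sqrt (4 - x\<^sup>2) * sqrt (4 - x\<^sup>2)"
          using pos by (simp add: power2_eq_square algebra_simps)
        thus ?thesis using pos x by (simp add: f_def t1 field_simps)
      qed
      finally show "(F has_vector_derivative f x) (at x)"
        by (simp add: has_real_derivative_iff_has_vector_derivative)
    qed auto
    hence f_int: "(f has_integral 2 * pi) {- 2..2}"
      by (simp add: F_def)
    have nn: "f x \<ge> 0" if "x \<in> {- 2..2}" for x
    proof -
      have "x\<^sup>2 \<le> 2\<^sup>2" by (intro power2_le_iff_abs_le[THEN iffD2]) (use that in auto)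
      thus ?thesis using that by (auto simp: f_def t1)
    qed
    have "(\<lambda>x. indicator {- 2..2} x *\<^sub>R f x) \<in> borel_measurable lborel"
      unfolding f_def by measurable
    moreover have "((\<lambda>x. indicator {- 2..2} x *\<^sub>R f x) has_integral 2 * pi) UNIV"
    proof -
      have "(\<lambda>x. indicator {- 2..2} x *\<^sub>R f x) = (\<lambda>x. if x \<in> {- 2..2} then f x else 0)"
        by (auto simp: indicator_def)
      thus ?thesis using f_int by (simp only: has_integral_restrict_UNIV)
    qed
    ultimately have "has_bochner_integral lborel (\<lambda>x. indicator {- 2..2} x *\<^sub>R f x) (2 * pi)"
      using nn by (intro has_bochner_integral_nn_integral nn_integral_has_integral_lborel)
        (auto simp: indicator_def)
    thus ?thesis
      unfolding set_integrable_def set_lebesgue_integral_def s1 t1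
      by (simp add: has_bochner_integral_iff)
  qed
  thus "set_integrable lborel {- 2 * s..2 * s} f"
    and "(LINT x:{- 2 * s..2 * s}|lborel. f x) = 2 * pi * min 1 t" by auto
qed

text \<open>The affine map \<open>x = v (1 + t + y)\<close> turns the density into a semicircle
  weight divided by \<open>1 + t + y\<close>. With a suitable Joukowski parameter \<open>r\<close>
  the transform is \<open>M z = 1 + s r\<close>, and the rest is algebra.\<close>

lemma MP_transform:
  assumes v: "v \<noteq> 0" and t: "t > 0"
  shows "compact_distr (MP v t)" (is ?A)
    and "fps_R (MP v t) = fps_const (complex_of_real (t * v)) * fps_X / (1 - fps_const (complex_of_real v) * fps_X)"
      (is ?B)
proof -
  define s where "s = sqrt t"
  have s: "s > 0" "s\<^sup>2 = t" using t by (auto simp: s_def)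
  have t_eq: "t = s * s" using s(2) by (simp add: power2_eq_square)
  have four_t: "4 * t = (2 * s)\<^sup>2" using s(2) by (simp add: power_mult_distrib)
  have sq: "y\<^sup>2 < 4 * t \<longleftrightarrow> \<bar>y\<bar> < 2 * s" for y
  proof -
    have "(2 * s)\<^sup>2 \<le> y\<^sup>2 \<longleftrightarrow> 2 * s \<le> \<bar>y\<bar>"
      using abs_le_square_iff[of "2 * s" y] s(1) by simp
    thus ?thesis unfolding four_t by (cases "2 * s \<le> \<bar>y\<bar>") auto
  qed
  define d where "d x = 1 / \<bar>v\<bar> * MP_density t (x / v)" for x
  have MP_meas [measurable]: "MP_density t \<in> borel_measurable borel"
    unfolding MP_density_def[abs_def] by measurable
  have [measurable]: "d \<in> borel_measurable borel" unfolding d_def[abs_def] by measurable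
  have MP_pos: "MP_density t x \<ge> 0" for x
  proof (cases "(x - 1 - t)\<^sup>2 < 4 * t")
    case True
    hence "\<bar>x - 1 - t\<bar> < 2 * s"
      by (simp add: sq)
    \<comment> \<open>\<open>2 sqrt t \<le> 1 + t\<close> puts the support of
      \<open>MP_density t\<close> on the positive side, so division by \<open>x\<close> keeps it
      nonnegative.\<close>
    moreover have "0 \<le> (s - 1)\<^sup>2" by simp
    hence "2 * s \<le> 1 + t" by (simp add: t_eq power2_eq_square algebra_simps)
    ultimately have "x > 0" by linarith
    thus ?thesis using True by (simp add: MP_density_def)
  qed (simp add: MP_density_def)
  hence d_nonneg: "d x \<ge> 0" for x by (simp add: d_def)
  have d_affine: "d (v * (1 + t) + v * y) = 1 / (2 * pi * \<bar>v\<bar>) *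
      (indicator {- 2 * s..2 * s} y * (sqrt (4 * t - y\<^sup>2) / (1 + t + y)))" for y
  proof -
    have "(v * (1 + t) + v * y) / v = 1 + t + y" using v by (simp add: field_simps)
    \<comment> \<open>The density is cut off by a strict inequality while the indicator is closed;
      at the two edges the root is 0.\<close>
    moreover have "sqrt (4 * t - y\<^sup>2) = 0" if "\<bar>y\<bar> = 2 * s"
      unfolding four_t using that power2_abs[of y] by simp
    ultimately show ?thesis
      by (cases "\<bar>y\<bar> < 2 * s"; cases "\<bar>y\<bar> = 2 * s")
         (auto simp: d_def MP_density_def sq indicator_def)
  qed
  have int: "integrable lborel d" "integral\<^sup>L lborel d = min 1 t"
  proof -
    note I = semicircle_inverse_integral[OF t, folded s_def, unfolded set_integrable_def set_lebesgue_integral_def]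
    have i: "integrable lborel (\<lambda>y. d (v * (1 + t) + v * y))"
      unfolding d_affine using I(1) by (intro integrable_mult_right) simp
    thus "integrable lborel d" using v lborel_integrable_real_affine_iff by blast
    have "integral\<^sup>L lborel d = \<bar>v\<bar> *\<^sub>R (\<integral>y. d (v * (1 + t) + v * y) \<partial>lborel)"
      using v by (rule lborel_integral_real_affine)
    also have "(\<integral>y. d (v * (1 + t) + v * y) \<partial>lborel) = 1 / (2 * pi * \<bar>v\<bar>) * (2 * pi * min 1 t)"
      unfolding d_affine using I(2) by (subst integral_mult_right_zero) simp
    finally show "integral\<^sup>L lborel d = min 1 t" using v by simp
  qed
  have MP_em: "emeasure (MP v t) A = ennreal (max (1 - t) 0) * indicator A 0 + (\<integral>\<^sup>+x. ennreal (d x) * indicator A x \<partial>lborel)"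
    if "A \<in> sets borel" for A
    unfolding emeasure_MP[OF that] using that by (subst emeasure_density) (auto simp: d_def)
  have ps: "prob_space (MP v t)"
  proof
    have sp: "space (MP v t) = UNIV" using sets_eq_imp_space_eq[OF sets_MP] by simp
    have "emeasure (MP v t) UNIV = ennreal (max (1 - t) 0) + (\<integral>\<^sup>+x. ennreal (d x) \<partial>lborel)"
      by (subst MP_em) auto
    also have "(\<integral>\<^sup>+x. ennreal (d x) \<partial>lborel) = ennreal (integral\<^sup>L lborel d)"
      by (rule nn_integral_eq_integral) (use int d_nonneg in auto)
    also have "ennreal (max (1 - t) 0) + \<dots> = ennreal (max (1 - t) 0 + min 1 t)"
      unfolding int using t by (intro ennreal_plus[symmetric]) auto
    also have "max (1 - t) 0 + min 1 t = 1" by (simp add: max_def min_def)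
    finally show "emeasure (MP v t) (space (MP v t)) = 1" unfolding sp by simp
  qed
  have supp: "d x = 0" if "\<bar>x\<bar> > \<bar>v\<bar> * (1 + t + 2 * s)" for x
  proof -
    have "\<bar>x / v\<bar> > 1 + t + 2 * s" using that v by (simp add: field_simps)
    hence "\<bar>x / v - 1 - t\<bar> \<ge> 2 * s" using t by linarith
    thus ?thesis by (simp add: d_def MP_density_def sq)
  qed
  define K where "K = \<bar>v\<bar> * (1 + t + 2 * s)"
  have bounded: "AE x in MP v t. \<bar>x\<bar> \<le> K"
  proof -
    let ?K = "\<bar>v\<bar> * (1 + t + 2 * s)"
    have K: "?K \<ge> 0" using s t by simp
    have "{x. ?K < \<bar>x\<bar>} \<in> null_sets (MP v t)"
    proof (rule null_setsI)
      have [measurable]: "{x. ?K < \<bar>x\<bar>} \<in> sets borel" by measurable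
      have "(\<integral>\<^sup>+x. ennreal (d x) * indicator {x. ?K < \<bar>x\<bar>} x \<partial>lborel) = (\<integral>\<^sup>+x. 0 \<partial>(lborel :: real measure))"
        by (intro nn_integral_cong) (auto simp: indicator_def supp)
      thus "emeasure (MP v t) {x. ?K < \<bar>x\<bar>} = 0"
        using K by (subst MP_em) (auto simp: indicator_def)
    qed (simp add: sets_MP)
    thus ?thesis unfolding K_def by (rule AE_I') auto
  qed
  show A: ?A
    by (rule compact_distrI[OF ps sets_MP bounded])
  interpret real_distribution "MP v t" using compact_distrE[OF A] by metis
  \<comment> \<open>Away from 0 the law is absolutely continuous, so functions vanishing at 0 are
    integrated against the density alone, whatever the mass of the atom. This is why 1 is subtracted
    from the integrand of the transform below.\<close>
  have dens: "density (MP v t) (indicator (- {0})) = density lborel (\<lambda>x. ennreal (d x))"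
  proof (rule measure_eqI)
    fix A :: "real set" assume "A \<in> sets (density (MP v t) (indicator (- {0})))"
    hence A: "A \<in> sets borel" by simp
    have "emeasure (density (MP v t) (indicator (- {0}))) A = emeasure (MP v t) (- {0} \<inter> A)"
      using A by (subst emeasure_restricted) auto
    also have "\<dots> = (\<integral>\<^sup>+x. ennreal (d x) * indicator (- {0} \<inter> A) x \<partial>lborel)"
      using A by (subst MP_em) auto
    also have "\<dots> = (\<integral>\<^sup>+x. ennreal (d x) * indicator A x \<partial>lborel)"
      by (intro nn_integral_cong_AE, use AE_lborel_singleton[of 0] in eventually_elim) (auto simp: indicator_def)
    also have "\<dots> = emeasure (density lborel (\<lambda>x. ennreal (d x))) A"
      using A by (subst emeasure_density) auto
    finally show "emeasure (density (MP v t) (indicator (- {0}))) A = emeasure (density lborel (\<lambda>x. ennreal (d x))) A" .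
  qed simp
  have int_MP: "(\<integral>x. g x \<partial>MP v t) = (\<integral>x. d x *\<^sub>R g x \<partial>lborel)"
    if [measurable]: "g \<in> borel_measurable borel" and "g 0 = 0" for g :: "real \<Rightarrow> complex"
  proof -
    have "(\<integral>x. g x \<partial>MP v t) = (\<integral>x. indicator (- {0}) x *\<^sub>R g x \<partial>MP v t)"
      using that by (intro Bochner_Integration.integral_cong) (auto simp: indicator_def)
    also have "\<dots> = (\<integral>x. g x \<partial>density (MP v t) (\<lambda>x. ennreal (indicator (- {0}) x)))"
      by (subst integral_density) auto
    also have "(\<lambda>x. ennreal (indicator (- {0}) x)) = (indicator (- {0}) :: real \<Rightarrow> ennreal)"
      by (auto simp: indicator_def)
    also have "(\<integral>x. g x \<partial>density (MP v t) (indicator (- {0}))) = (\<integral>x. d x *\<^sub>R g x \<partial>lborel)"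
      unfolding dens using d_nonneg by (subst integral_density) auto
    finally show ?thesis .
  qed
  let ?v = "complex_of_real v" and ?t = "complex_of_real t"
  have M: "M_transform (MP v t) z = 1 + (\<integral>x. d x *\<^sub>R (1 / (1 - complex_of_real x * z) - 1) \<partial>lborel)"
    if z: "K * norm z \<le> 1 / 2" for z
  proof -
    have "(\<integral>x. 1 / (1 - complex_of_real x * z) - 1 \<partial>MP v t) = M_transform (MP v t) z - 1"
      unfolding M_transform_def using M_transform_integrable[OF A bounded z] prob_space
      by (subst Bochner_Integration.integral_diff) auto
    thus ?thesis by (subst (asm) int_MP) (auto simp: algebra_simps)
  qed
  show ?B
  proof (rule fps_R_eqI_fun[OF A])
    show "(\<lambda>w. of_real (t * v) * w / (1 - ?v * w)) has_fps_expansion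
        fps_const (of_real (t * v)) * fps_X / (1 - fps_const ?v * fps_X)"
      by (intro fps_expansion_intros) auto
    have K: "K > 0" using s t v by (simp add: K_def add_pos_pos)
    hence "\<forall>\<^sub>F z in nhds 0. z \<in> ball (0::complex) (1 / (2 * K))"
      by (intro eventually_nhds_in_open) auto
    thus "\<forall>\<^sub>F z in nhds 0. 1 + of_real (t * v) * (z * M_transform (MP v t) z) /
        (1 - ?v * (z * M_transform (MP v t) z)) = M_transform (MP v t) z"
    proof eventually_elim
      case (elim z)
      hence z: "K * norm z < 1 / 2" using K by (simp add: field_simps)
      define \<zeta> where "\<zeta> = ?v * z"
      have \<zeta>: "(1 + t + 2 * s) * norm \<zeta> < 1 / 2"
        using z by (simp add: \<zeta>_def K_def norm_mult algebra_simps)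
      show ?case
      proof (cases "z = 0")
        case True
        thus ?thesis using M[of 0] by simp
      next
        case False
        hence \<zeta>0: "\<zeta> \<noteq> 0" using v by (simp add: \<zeta>_def)
        \<comment> \<open>Chosen so that \<open>s (1 + r^2) - r y\<close> is a multiple of
          \<open>1 - \<zeta> (1 + t + y)\<close>; the radius allowed for \<open>z\<close> ensures
          \<open>norm \<alpha> > 2\<close>.\<close>
        define \<alpha> where "\<alpha> = (1 / \<zeta> - 1 - ?t) / of_real s"
        have "(1 + t + 2 * s) < norm (1 / \<zeta>)"
        proof -
          have "(1 + t + 2 * s) * norm \<zeta> < 1" using \<zeta> by linarith
          thus ?thesis using \<zeta>0 by (simp add: norm_divide field_simps)
        qed
        moreover have "norm (1 / \<zeta>) - norm (1 + ?t) \<le> norm (1 / \<zeta> - (1 + ?t))"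
          by (rule norm_triangle_ineq2)
        moreover have "norm (1 + ?t) \<le> 1 + t"
          using norm_triangle_ineq[of 1 ?t] t by simp
        ultimately have "2 * s < norm (1 / \<zeta> - 1 - ?t)" by (simp add: algebra_simps)
        hence "norm \<alpha> > 2" using s(1) by (simp add: \<alpha>_def norm_divide field_simps)
        then obtain r where r: "r \<noteq> 0" "norm r < 1" "1 + r\<^sup>2 = \<alpha> * r"
          by (rule joukowski_inverse)
        have sr: "of_real s * (1 + r\<^sup>2) = r / \<zeta> * (1 - \<zeta> * (1 + ?t))"
          unfolding r(3) \<alpha>_def using s(1) \<zeta>0 by (simp add: field_simps)
        have den: "of_real s * (1 + r\<^sup>2) - r * of_real y = r / \<zeta> * (1 - \<zeta> * of_real (1 + t + y))" for y
          unfolding sr using \<zeta>0 by (simp add: field_simps)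
        have integrand: "d (v * (1 + t) + v * y) *\<^sub>R (1 / (1 - complex_of_real (v * (1 + t) + v * y) * z) - 1) =
          of_real (1 / (2 * pi * \<bar>v\<bar>)) * r * (indicator {- 2 * s..2 * s} y *\<^sub>R
            (complex_of_real (sqrt (4 * s\<^sup>2 - y\<^sup>2)) / (of_real s * (1 + r\<^sup>2) - r * of_real y)))" for y
        proof (cases "y \<in> {- 2 * s..2 * s}")
          case True
          define X where "X = 1 + t + y"
          have y2: "y\<^sup>2 \<le> 4 * t"
            unfolding four_t by (rule power2_le_iff_abs_le[THEN iffD2]) (use True s(1) in auto)
          have zX: "complex_of_real (v * (1 + t) + v * y) * z = \<zeta> * of_real X"
            by (simp add: \<zeta>_def X_def algebra_simps)
          have "\<bar>X\<bar> \<le> 1 + t + 2 * s" using True t by (auto simp: X_def)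
          hence "norm (\<zeta> * of_real X) \<le> norm \<zeta> * (1 + t + 2 * s)"
            unfolding norm_mult by (intro mult_left_mono) auto
          hence ne: "1 - \<zeta> * of_real X \<noteq> 0"
            using \<zeta> norm_one_minus_ge_half[of "\<zeta> * of_real X"] by (auto simp: mult.commute)
          \<comment> \<open>A division by \<open>X = 0\<close> is harmless: with
            \<open>y^2 \<le> 4 t\<close> it forces \<open>y^2 = 4 t\<close>, so the root is
            0.\<close>
          have "sqrt (4 * t - y\<^sup>2) = 0" if "X = 0"
          proof -
            have y: "y = - (1 + t)" using that by (simp add: X_def)
            have "4 * t - y\<^sup>2 = - ((1 - t)\<^sup>2)" unfolding y by (simp add: power2_eq_square algebra_simps)
            moreover have "0 \<le> (1 - t)\<^sup>2" by simp
            ultimately have "4 * t - y\<^sup>2 = 0" using y2 by linarith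
            thus ?thesis by simp
          qed
          hence E: "complex_of_real (sqrt (4 * t - y\<^sup>2) / X) * (1 / (1 - \<zeta> * of_real X) - 1) =
             r * (complex_of_real (sqrt (4 * t - y\<^sup>2)) / (r / \<zeta> * (1 - \<zeta> * of_real X)))"
            using ne r(1) \<zeta>0 by (cases "X = 0") (simp_all add: field_simps)
          have "d (v * (1 + t) + v * y) *\<^sub>R (1 / (1 - complex_of_real (v * (1 + t) + v * y) * z) - 1) =
            of_real (1 / (2 * pi * \<bar>v\<bar>)) * (complex_of_real (sqrt (4 * t - y\<^sup>2) / X) * (1 / (1 - \<zeta> * of_real X) - 1))"
            unfolding zX d_affine X_def[symmetric] using True by (simp add: scaleR_conv_of_real)
          thus ?thesis
            unfolding E den X_def[symmetric] s(2) using True by (simp only: mult.assoc) simp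
        qed (simp add: d_affine)
        have "(\<integral>x. d x *\<^sub>R (1 / (1 - complex_of_real x * z) - 1) \<partial>lborel) =
            \<bar>v\<bar> *\<^sub>R (of_real (1 / (2 * pi * \<bar>v\<bar>)) * r * (2 * pi * s))"
          by (subst lborel_integral_real_affine[OF v, of _ "v * (1 + t)"], unfold integrand integral_mult_right_zero
            semicircle_integral(2)[OF s(1) r(2), unfolded set_lebesgue_integral_def]) (rule refl)
        also have "\<dots> = of_real s * r"
          using v by (simp add: scaleR_conv_of_real)
        finally have M_eq: "M_transform (MP v t) z = 1 + of_real s * r"
          using M z by simp
        let ?M = "1 + complex_of_real s * r"
        \<comment> \<open>The defining equation of \<open>r\<close>, rearranged. Multiplied by
          \<open>s\<close> it becomes \<open>(M - 1) (1 - \<zeta> M) = t \<zeta> M\<close>, the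
          R-equation cleared of its denominator.\<close>
        have "r = \<zeta> * (of_real s * (1 + r\<^sup>2) + r * (1 + ?t))"
          unfolding sr using \<zeta>0 by (simp add: field_simps)
        also have "?t = of_real s * of_real s" by (simp add: t_eq)
        finally have "of_real s * r = of_real s * (\<zeta> * (of_real s * (1 + r\<^sup>2) + r * (1 + of_real s * of_real s)))"
          by simp
        hence eq: "of_real s * r * (1 - \<zeta> * ?M) = of_real s * of_real s * \<zeta> * ?M"
          by (simp add: algebra_simps power2_eq_square)
        have "1 - \<zeta> * ?M \<noteq> 0"
        proof
          assume 0: "1 - \<zeta> * ?M = 0"
          hence "\<zeta> * ?M = 1" "of_real s * of_real s * (\<zeta> * ?M) = 0" using eq by auto
          thus False using s(1) by auto
        qed
        hence "1 + of_real s * of_real s * \<zeta> * ?M / (1 - \<zeta> * ?M) = ?M"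
          unfolding eq[symmetric] by simp
        thus ?thesis unfolding M_eq \<zeta>_def by (simp add: t_eq mult_ac)
      qed
    qed
  qed
qed

section \<open>Free decompositions\<close>

text \<open>The coefficients of the R-series. Index 0 is set apart, because \<open>v ^ 0 = 1\<close>
  would put the sum of the weights into the constant term.\<close>

definition cumulant :: "real \<Rightarrow> real \<Rightarrow> (real \<times> real) list \<Rightarrow> nat \<Rightarrow> real" where
  "cumulant u c\<^sub>0 ps m = (if m = 0 then 0
     else (if m = 1 then u else 0) + (if m = 2 then c\<^sub>0 else 0) + (\<Sum>(v, c)\<leftarrow>ps. c * v ^ m))"

definition decomposition_fps :: "real \<Rightarrow> real \<Rightarrow> (real \<times> real) list \<Rightarrow> complex fps" where
  "decomposition_fps u c\<^sub>0 ps = Abs_fps (\<lambda>m. complex_of_real (cumulant u c\<^sub>0 ps m))"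

lemma fps_divide_one_minus_const_X:
  fixes c :: "'a :: field"
  shows "F / (1 - fps_const c * fps_X) = F * Abs_fps (\<lambda>n. c ^ n)"
proof -
  have "(1 - fps_const c * fps_X) * Abs_fps (\<lambda>n. c ^ n) = 1"
  proof (rule fps_ext)
    fix n
    show "fps_nth ((1 - fps_const c * fps_X) * Abs_fps (\<lambda>n. c ^ n)) n = fps_nth 1 n"
      by (cases n) (simp_all add: left_diff_distrib mult.assoc)
  qed
  hence "inverse (1 - fps_const c * fps_X) = Abs_fps (\<lambda>n. c ^ n)"
    by (rule fps_inverse_unique)
  thus ?thesis by (subst fps_divide_unit) auto
qed

lemma fps_nth_X_divide:
  fixes c :: "'a :: field"
  shows "fps_nth (fps_X ^ k / (1 - fps_const c * fps_X)) m = (if m < k then 0 else c ^ (m - k))"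
  unfolding fps_divide_one_minus_const_X by (simp add: fps_X_power_mult_nth)

lemma fps_nth_Levy:
  "fps_nth (Levy_fps a qs) m =
     complex_of_real (if m = 0 then 0 else if m = 1 then a else (\<Sum>(v, q)\<leftarrow>qs. q * v ^ (m - 2)))"
proof -
  have "fps_nth (\<Sum>(v, q)\<leftarrow>qs. fps_const (complex_of_real q) * (fps_X\<^sup>2 / (1 - fps_const (of_real v) * fps_X))) m =
      complex_of_real (if m < 2 then 0 else (\<Sum>(v, q)\<leftarrow>qs. q * v ^ (m - 2)))"
    by (induction qs) (auto simp: fps_nth_X_divide)
  thus ?thesis unfolding Levy_fps_def by auto
qed

lemma decomposition_fps_eq_Levy:
  "decomposition_fps u c\<^sub>0 ps =
     Levy_fps (u + (\<Sum>(v, c)\<leftarrow>ps. c * v)) ((0, c\<^sub>0) # map (\<lambda>(v, c). (v, c * v\<^sup>2)) ps)"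
proof (rule fps_ext)
  fix m
  have "(\<Sum>(v, c)\<leftarrow>ps. c * v ^ m) = (\<Sum>x\<leftarrow>ps. case case x of (v, c) \<Rightarrow> (v, c * v\<^sup>2) of (v, q) \<Rightarrow> q * v ^ (m - 2))"
    if "m \<ge> 2"
  proof -
    have "v ^ m = v\<^sup>2 * v ^ (m - 2)" for v :: real
      using that by (metis le_add_diff_inverse power_add)
    thus ?thesis by (simp add: case_prod_unfold mult.assoc)
  qed
  thus "fps_nth (decomposition_fps u c\<^sub>0 ps) m =
      fps_nth (Levy_fps (u + (\<Sum>(v, c)\<leftarrow>ps. c * v)) ((0, c\<^sub>0) # map (\<lambda>(v, c). (v, c * v\<^sup>2)) ps)) m"
    by (auto simp: decomposition_fps_def cumulant_def fps_nth_Levy o_def)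
qed

lemma exists_measure_with_decomposition:
  assumes "c\<^sub>0 \<ge> 0" "\<And>v c. (v, c) \<in> set ps \<Longrightarrow> c \<ge> 0"
  shows "\<exists>\<mu>. compact_distr \<mu> \<and> fps_R \<mu> = decomposition_fps u c\<^sub>0 ps"
proof -
  interpret continued_fraction "u + (\<Sum>(v, c)\<leftarrow>ps. c * v)" "(0, c\<^sub>0) # map (\<lambda>(v, c). (v, c * v\<^sup>2)) ps"
    by unfold_locales (use assms in auto)
  show ?thesis unfolding decomposition_fps_eq_Levy by (rule exists_measure_with_Levy_R)
qed

lemma decomposition_fps_snoc:
  "decomposition_fps u c\<^sub>0 (ps @ [(v, c)]) = decomposition_fps u c\<^sub>0 ps + decomposition_fps 0 0 [(v, c)]"
  by (rule fps_ext) (auto simp: decomposition_fps_def cumulant_def)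

lemma decomposition_fps_add_Nil:
  "decomposition_fps u c\<^sub>0 [] = decomposition_fps u 0 [] + decomposition_fps 0 c\<^sub>0 []"
  by (rule fps_ext) (auto simp: decomposition_fps_def cumulant_def)

lemma decomposition_fps_scale:
  "decomposition_fps (k * u) (k * c\<^sub>0) (map (\<lambda>(v, c). (v, k * c)) ps) =
     fps_const (complex_of_real k) * decomposition_fps u c\<^sub>0 ps"
proof -
  have "(\<Sum>x\<leftarrow>ps. case case x of (v, c) \<Rightarrow> (v, k * c) of (v, c) \<Rightarrow> c * v ^ m) = k * (\<Sum>(v, c)\<leftarrow>ps. c * v ^ m)" for m
    by (induction ps) (auto simp: algebra_simps)
  thus ?thesis
    by (intro fps_ext) (auto simp: decomposition_fps_def cumulant_def o_def algebra_simps)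
qed

lemma fps_R_return_decomposition: "fps_R (point_mass u) = decomposition_fps u 0 []"
  unfolding fps_R_return by (rule fps_ext) (auto simp: decomposition_fps_def cumulant_def)

lemma Wigner_decomposition:
  assumes "c\<^sub>0 \<ge> 0"
  shows "compact_distr (Wigner c\<^sub>0) \<and> fps_R (Wigner c\<^sub>0) = decomposition_fps 0 c\<^sub>0 []"
proof (cases "c\<^sub>0 = 0")
  case True
  thus ?thesis using compact_distr_return fps_R_return_decomposition by (simp add: Wigner_def)
next
  case False
  have "fps_const (complex_of_real c\<^sub>0) * fps_X\<^sup>2 = decomposition_fps 0 c\<^sub>0 []"
    by (rule fps_ext) (auto simp: decomposition_fps_def cumulant_def fps_X_power_nth)
  thus ?thesis using Wigner_transform[of c\<^sub>0] False assms by simp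
qed

lemma MP_decomposition:
  assumes "v \<noteq> 0" "c > 0"
  shows "compact_distr (MP v c) \<and> fps_R (MP v c) = decomposition_fps 0 0 [(v, c)]"
proof -
  have "fps_const (complex_of_real (c * v)) * fps_X / (1 - fps_const (complex_of_real v) * fps_X) =
      decomposition_fps 0 0 [(v, c)]"
    unfolding fps_divide_one_minus_const_X
    by (rule fps_ext, rename_tac m, case_tac m) (auto simp: decomposition_fps_def cumulant_def mult.assoc)
  thus ?thesis using MP_transform[OF assms] by simp
qed

text \<open>Reverse induction, as \<open>foldl\<close> attaches the last law on the right. At each
  stage a law with the wanted R-series is produced first; only then is it known to be the value of
  \<open>\<boxplus>\<close>.\<close>

lemma foldl_free_conv_MP:
  assumes "c\<^sub>0 \<ge> 0" "\<forall>(v, c)\<in>set ps. v \<noteq> 0 \<and> c > 0"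
  shows "compact_distr (foldl (\<lambda>\<nu> (v, c). \<nu> \<boxplus> MP v c) (point_mass u \<boxplus> Wigner c\<^sub>0) ps) \<and>
    fps_R (foldl (\<lambda>\<nu> (v, c). \<nu> \<boxplus> MP v c) (point_mass u \<boxplus> Wigner c\<^sub>0) ps) = decomposition_fps u c\<^sub>0 ps"
  using assms(2)
proof (induction ps rule: rev_induct)
  case Nil
  obtain \<mu> where "compact_distr \<mu>" "fps_R \<mu> = decomposition_fps u c\<^sub>0 []"
    using exists_measure_with_decomposition[of c\<^sub>0 "[]"] assms(1) by auto
  moreover from this have "is_free_conv (point_mass u) (Wigner c\<^sub>0) \<mu>"
    unfolding is_free_conv_iff decomposition_fps_add_Nil[of u c\<^sub>0]
    using Wigner_decomposition[OF assms(1)] compact_distr_return fps_R_return_decomposition by simp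
  hence "point_mass u \<boxplus> Wigner c\<^sub>0 = \<mu>" by (rule free_conv_eqI)
  ultimately show ?case by simp
next
  case (snoc x ps)
  obtain v c where x: "x = (v, c)" by (cases x)
  let ?\<nu> = "foldl (\<lambda>\<nu> (v, c). \<nu> \<boxplus> MP v c) (point_mass u \<boxplus> Wigner c\<^sub>0) ps"
  have "\<exists>\<mu>. compact_distr \<mu> \<and> fps_R \<mu> = decomposition_fps u c\<^sub>0 (ps @ [x])"
    by (rule exists_measure_with_decomposition) (use snoc.prems assms(1) in \<open>auto simp: less_imp_le\<close>)
  then obtain \<mu> where \<mu>: "compact_distr \<mu>" "fps_R \<mu> = decomposition_fps u c\<^sub>0 (ps @ [x])" by blast
  have "is_free_conv ?\<nu> (MP v c) \<mu>"
    unfolding is_free_conv_iff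
    using \<mu> snoc MP_decomposition[of v c] by (auto simp: x decomposition_fps_snoc)
  hence "?\<nu> \<boxplus> MP v c = \<mu>" by (rule free_conv_eqI)
  with \<mu> show ?case by (simp add: x)
qed

lemma free_decomposition_iff:
  "free_decomposition \<mu> u c\<^sub>0 ps \<longleftrightarrow>
     c\<^sub>0 \<ge> 0 \<and> (\<forall>(v, c)\<in>set ps. v \<noteq> 0 \<and> c > 0) \<and> distinct (map fst ps) \<and>
     compact_distr \<mu> \<and> fps_R \<mu> = decomposition_fps u c\<^sub>0 ps"
  unfolding free_decomposition_def
  using foldl_free_conv_MP[of c\<^sub>0 ps u] compact_distr_eqI_fps_R by metis

lemma has_fps_expansion_decomposition:
  "(\<lambda>w. complex_of_real u * w + complex_of_real c\<^sub>0 * w\<^sup>2 +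
      (\<Sum>(v, c)\<leftarrow>ps. complex_of_real c * complex_of_real v * w / (1 - complex_of_real v * w)))
    has_fps_expansion decomposition_fps u c\<^sub>0 ps"
proof (induction ps rule: rev_induct)
  case Nil
  have "fps_const (complex_of_real u) * fps_X + fps_const (complex_of_real c\<^sub>0) * fps_X\<^sup>2 = decomposition_fps u c\<^sub>0 []"
    by (rule fps_ext) (auto simp: decomposition_fps_def cumulant_def fps_X_power_nth)
  moreover have "(\<lambda>w. complex_of_real u * w + complex_of_real c\<^sub>0 * w\<^sup>2) has_fps_expansion
      fps_const (complex_of_real u) * fps_X + fps_const (complex_of_real c\<^sub>0) * fps_X\<^sup>2"
    by (intro fps_expansion_intros)
  ultimately show ?case by simp
next
  case (snoc x ps)
  obtain v c where x: "x = (v, c)" by (cases x)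
  have "fps_const (complex_of_real c) * fps_const (complex_of_real v) * fps_X / (1 - fps_const (complex_of_real v) * fps_X) =
      decomposition_fps 0 0 [(v, c)]"
    unfolding fps_divide_one_minus_const_X
    by (rule fps_ext, rename_tac m, case_tac m) (auto simp: decomposition_fps_def cumulant_def mult.assoc)
  moreover have "(\<lambda>w. complex_of_real c * complex_of_real v * w / (1 - complex_of_real v * w)) has_fps_expansion
     fps_const (complex_of_real c) * fps_const (complex_of_real v) * fps_X / (1 - fps_const (complex_of_real v) * fps_X)"
    by (intro fps_expansion_intros) auto
  ultimately have "(\<lambda>w. complex_of_real c * complex_of_real v * w / (1 - complex_of_real v * w)) has_fps_expansion
      decomposition_fps 0 0 [(v, c)]" by simp
  from has_fps_expansion_add[OF snoc.IH this] show ?case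
    by (simp add: x decomposition_fps_snoc add.assoc)
qed

section \<open>Uniqueness of the decomposition\<close>

lemma sum_list_mult_poly_cong:
  fixes ps ps' :: "(real \<times> real) list"
  assumes "\<And>m. m \<ge> k \<Longrightarrow> (\<Sum>(v, c)\<leftarrow>ps. c * v ^ m) = (\<Sum>(v, c)\<leftarrow>ps'. c * v ^ m)"
  shows "(\<Sum>(v, c)\<leftarrow>ps. c * v ^ k * poly p v) = (\<Sum>(v, c)\<leftarrow>ps'. c * v ^ k * poly p v)"
proof -
  have *: "(\<Sum>(v, c)\<leftarrow>qs. c * v ^ k * poly p v) = (\<Sum>i\<le>degree p. coeff p i * (\<Sum>(v, c)\<leftarrow>qs. c * v ^ (k + i)))"
    for qs :: "(real \<times> real) list"
  proof (induction qs)
    case (Cons x qs)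
    obtain v c where x: "x = (v, c)" by (cases x)
    have "c * v ^ k * poly p v = (\<Sum>i\<le>degree p. coeff p i * (c * v ^ (k + i)))"
      by (simp add: poly_altdef sum_distrib_left power_add mult_ac)
    thus ?case using Cons by (simp add: x distrib_left sum.distrib)
  qed auto
  show ?thesis unfolding * using assms by simp
qed

lemma sum_list_filter_distinct:
  fixes ps :: "('a \<times> real) list"
  assumes "distinct (map fst ps)"
  shows "(\<Sum>(v, c)\<leftarrow>ps. if v = x then c else 0) = (if x \<in> fst ` set ps then the (map_of ps x) else 0)"
  using assms
proof (induction ps)
  case (Cons y ps)
  thus ?case by (cases y) (auto simp: image_iff)
qed auto

text \<open>Equality of the power sums extends to \<open>v ^ k\<close> times any polynomial. The one
  vanishing at all other nodes isolates the weight at \<open>x\<close>, since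
  \<open>x ^ k \<noteq> 0\<close>. Starting at exponent \<open>k\<close> leaves out the low
  cumulants, which contain other parameters.\<close>

lemma decomposition_subset:
  fixes ps ps' :: "(real \<times> real) list"
  assumes ps: "\<forall>(v, c)\<in>set ps. v \<noteq> 0 \<and> c > 0" "distinct (map fst ps)"
    and ps': "distinct (map fst ps')"
    and eq: "\<And>m. m \<ge> k \<Longrightarrow> (\<Sum>(v, c)\<leftarrow>ps. c * v ^ m) = (\<Sum>(v, c)\<leftarrow>ps'. c * v ^ m)"
  shows "set ps \<subseteq> set ps'"
proof
  fix y assume y: "y \<in> set ps"
  obtain x d where xd: "y = (x, d)" by (cases y)
  have x0: "x \<noteq> 0" and d: "d > 0" using ps(1) y xd by auto
  define V where "V = fst ` set ps \<union> fst ` set ps'"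
  have V: "finite V" "x \<in> V" using y xd by (auto simp: V_def intro: rev_image_eqI)
  let ?p = "root_poly (V - {x})"
  have p: "poly ?p v = (if v = x then poly ?p x else 0)" if "v \<in> V" for v
    using that V poly_root_poly_eq_0_iff[of "V - {x}" v] by auto
  have px: "poly ?p x \<noteq> 0" using V poly_root_poly_eq_0_iff[of "V - {x}" x] by auto
  have *: "(\<Sum>(v, c)\<leftarrow>qs. c * v ^ k * poly ?p v) = (\<Sum>(v, c)\<leftarrow>qs. if v = x then c else 0) * (x ^ k * poly ?p x)"
    if "fst ` set qs \<subseteq> V" for qs
    using that
  proof (induction qs)
    case (Cons z qs)
    obtain v c where z: "z = (v, c)" by (cases z)
    have "c * v ^ k * poly ?p v = (if v = x then c else 0) * (x ^ k * poly ?p x)"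
      using p[of v] Cons.prems z by auto
    thus ?case using Cons by (simp add: z distrib_right)
  qed auto
  have "(\<Sum>(v, c)\<leftarrow>ps. if v = x then c else 0) = (\<Sum>(v, c)\<leftarrow>ps'. if v = x then c else 0)"
    using sum_list_mult_poly_cong[of k ps ps' ?p, OF eq] *[of ps] *[of ps'] px x0 by (simp add: V_def)
  moreover have "(\<Sum>(v, c)\<leftarrow>ps. if v = x then c else 0) = d"
    unfolding sum_list_filter_distinct[OF ps(2)] using y xd ps(2) by (auto intro: rev_image_eqI)
  ultimately have "x \<in> fst ` set ps'" "the (map_of ps' x) = d"
    unfolding sum_list_filter_distinct[OF ps'] using d by (auto split: if_splits)
  thus "y \<in> set ps'"
    unfolding xd by (metis map_of_eq_None_iff map_of_SomeD option.exhaust_sel)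
qed

text \<open>From index 3 on the cumulants involve only the Marchenko-Pastur pairs, which are thereby
  determined; indices 1 and 2 then give \<open>u\<close> and \<open>c\<^sub>0\<close>.\<close>

lemma decomposition_unique:
  assumes eq: "decomposition_fps u c\<^sub>0 ps = decomposition_fps u' c\<^sub>0' ps'"
    and ps: "\<forall>(v, c)\<in>set ps. v \<noteq> 0 \<and> c > 0" "distinct (map fst ps)"
    and ps': "\<forall>(v, c)\<in>set ps'. v \<noteq> 0 \<and> c > 0" "distinct (map fst ps')"
  shows "u = u' \<and> c\<^sub>0 = c\<^sub>0' \<and> mset ps = mset ps'"
proof -
  have cum: "cumulant u c\<^sub>0 ps m = cumulant u' c\<^sub>0' ps' m" for m
    using arg_cong[OF eq, of "\<lambda>F. fps_nth F m"] by (simp add: decomposition_fps_def)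
  have "(\<Sum>(v, c)\<leftarrow>ps. c * v ^ m) = (\<Sum>(v, c)\<leftarrow>ps'. c * v ^ m)" if "m \<ge> 3" for m
    using cum[of m] that by (simp add: cumulant_def)
  hence "set ps = set ps'"
    using decomposition_subset[OF ps ps'(2), of 3] decomposition_subset[OF ps' ps(2), of 3] by auto
  hence mset: "mset ps = mset ps'"
    using ps(2) ps'(2) by (simp add: set_eq_iff_mset_eq_distinct[symmetric] distinct_map)
  have sums: "(\<Sum>(v, c)\<leftarrow>ps. c * v ^ m) = (\<Sum>(v, c)\<leftarrow>ps'. c * v ^ m)" for m
    using arg_cong[OF mset, of "\<lambda>M. \<Sum>(v, c)\<in>#M. c * v ^ m"]
    by (simp only: mset_map[symmetric] sum_mset_sum_list)
  have "u = u'" "c\<^sub>0 = c\<^sub>0'"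
    using cum[of 1] cum[of 2] sums[of 1] sums[of 2] by (simp_all add: cumulant_def)
  with mset show ?thesis by simp
qed

section \<open>Decomposable laws are rational and freely infinitely divisible\<close>

lemma eventually_poly_nonzero:
  fixes q :: "complex poly"
  assumes "q \<noteq> 0"
  shows "\<forall>\<^sub>F w in at 0. poly q w \<noteq> 0"
proof -
  have "open (- ({w. poly q w = 0} - {0}))"
    using poly_roots_finite[OF assms] by (intro open_Compl finite_imp_closed) auto
  hence "\<forall>\<^sub>F w in at 0. w \<in> - ({w. poly q w = 0} - {0}) - {0}"
    by (intro eventually_at_in_open) auto
  thus ?thesis by eventually_elim auto
qed

lemma rational_near_0_add:
  assumes "rational_near_0 f" "rational_near_0 g"
  shows "rational_near_0 (\<lambda>w. f w + g w)"
proof -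
  obtain p q where f: "q \<noteq> 0" "\<forall>\<^sub>F w in at 0. f w = poly p w / poly q w"
    using assms(1) by (auto simp: rational_near_0_def)
  obtain p' q' where g: "q' \<noteq> 0" "\<forall>\<^sub>F w in at 0. g w = poly p' w / poly q' w"
    using assms(2) by (auto simp: rational_near_0_def)
  have "\<forall>\<^sub>F w in at 0. f w + g w = poly (p * q' + p' * q) w / poly (q * q') w"
    using f(2) g(2) eventually_poly_nonzero[OF f(1)] eventually_poly_nonzero[OF g(1)]
    by eventually_elim (simp add: add_frac_eq)
  thus ?thesis unfolding rational_near_0_def using f(1) g(1) by (intro exI[of _ "p * q' + p' * q"] exI[of _ "q * q'"]) auto
qed

lemma rational_near_0_decomposition:
  "rational_near_0 (\<lambda>w. complex_of_real u * w + complex_of_real c\<^sub>0 * w\<^sup>2 +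
      (\<Sum>(v, c)\<leftarrow>ps. complex_of_real c * complex_of_real v * w / (1 - complex_of_real v * w)))"
proof (rule rational_near_0_add)
  show "rational_near_0 (\<lambda>w. complex_of_real u * w + complex_of_real c\<^sub>0 * w\<^sup>2)"
    unfolding rational_near_0_def
    by (intro exI[of _ "[:0, complex_of_real u, complex_of_real c\<^sub>0:]"] exI[of _ 1])
       (auto simp: power2_eq_square algebra_simps)
  show "rational_near_0 (\<lambda>w. \<Sum>(v, c)\<leftarrow>ps. complex_of_real c * complex_of_real v * w / (1 - complex_of_real v * w))"
  proof (induction ps)
    case Nil
    show ?case unfolding rational_near_0_def by (intro exI[of _ 0] exI[of _ 1]) auto
  next
    case (Cons x ps)
    obtain v c where x: "x = (v, c)" by (cases x)
    have "rational_near_0 (\<lambda>w. complex_of_real c * complex_of_real v * w / (1 - complex_of_real v * w))"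
      unfolding rational_near_0_def
      by (intro exI[of _ "[:0, complex_of_real (c * v):]"] exI[of _ "[:1, - complex_of_real v:]"])
         (auto simp: mult.commute)
    from rational_near_0_add[OF this Cons] show ?case by (simp add: x)
  qed
qed

text \<open>Multiplying the R-series by \<open>k / n\<close> scales \<open>u\<close>,
  \<open>c\<^sub>0\<close> and the weights and keeps them nonnegative where required, so an
  \<open>n\<close>-th root and all its powers up to \<mu> exist.\<close>

lemma free_decomposition_imp_M_ratio_fid:
  assumes \<mu>: "compact_distr \<mu>" and R: "fps_R \<mu> = decomposition_fps u c\<^sub>0 ps"
    and c: "c\<^sub>0 \<ge> 0" "\<forall>(v, c)\<in>set ps. v \<noteq> 0 \<and> c > 0"
  shows "\<mu> \<in> M_ratio_fid"
proof -
  have exists: "\<exists>\<nu>. compact_distr \<nu> \<and> fps_R \<nu> = fps_const (complex_of_real k) * fps_R \<mu>" if "k \<ge> 0" for k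
    unfolding R decomposition_fps_scale[symmetric]
    by (rule exists_measure_with_decomposition) (use that c in \<open>force simp: less_imp_le\<close>)+
  have "freely_inf_divisible \<mu>"
    unfolding freely_inf_divisible_def
  proof (intro allI impI)
    fix n :: nat assume n: "n \<ge> 1"
    obtain \<nu> where \<nu>: "compact_distr \<nu>" "fps_R \<nu> = fps_const (complex_of_real (1 / n)) * fps_R \<mu>"
      using exists[of "1 / n"] by auto
    \<comment> \<open>Claimed for every \<open>k\<close>, because each convolution must be seen to
      exist before the next one can be evaluated; \<open>k = n\<close> gives \<mu>.\<close>
    have "compact_distr (free_conv_power \<nu> k) \<and>
      fps_R (free_conv_power \<nu> k) = fps_const (complex_of_real (k / n)) * fps_R \<mu>" for k
    proof (induction k)
      case 0
      have "fps_R (point_mass 0) = 0" by (simp add: fps_R_return)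
      thus ?case using compact_distr_return by simp
    next
      case (Suc k)
      obtain \<rho> where \<rho>: "compact_distr \<rho>" "fps_R \<rho> = fps_const (complex_of_real (Suc k / n)) * fps_R \<mu>"
        using exists[of "Suc k / n"] by auto
      have "complex_of_real (Suc k / n) = complex_of_real (k / n) + complex_of_real (1 / n)"
        by (simp add: add_divide_distrib)
      hence "is_free_conv (free_conv_power \<nu> k) \<nu> \<rho>"
        unfolding is_free_conv_iff \<rho>(2) using \<rho>(1) Suc \<nu>
        by (simp only: fps_const_add[symmetric] distrib_right)
      hence "free_conv_power \<nu> (Suc k) = \<rho>" using free_conv_eqI by simp
      with \<rho> show ?case by simp
    qed
    from this[of n] have "free_conv_power \<nu> n = \<mu>"
      using n \<mu> by (intro compact_distr_eqI_fps_R) auto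
    thus "\<exists>\<nu>. compact_distr \<nu> \<and> \<mu> = free_conv_power \<nu> n" using \<nu>(1) by blast
  qed
  moreover have "rational_near_0 (R_transform \<mu>)"
  proof -
    have "\<forall>\<^sub>F w in nhds 0. R_transform \<mu> w = complex_of_real u * w + complex_of_real c\<^sub>0 * w\<^sup>2 +
      (\<Sum>(v, c)\<leftarrow>ps. complex_of_real c * complex_of_real v * w / (1 - complex_of_real v * w))"
      using eq_near_0_iff_fps_eq[OF R_transform_has_fps_expansion[OF \<mu>] has_fps_expansion_decomposition] R by blast
    hence ev: "\<forall>\<^sub>F w in at 0. R_transform \<mu> w = complex_of_real u * w + complex_of_real c\<^sub>0 * w\<^sup>2 +
      (\<Sum>(v, c)\<leftarrow>ps. complex_of_real c * complex_of_real v * w / (1 - complex_of_real v * w))"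
      by (auto simp: eventually_at_filter elim: eventually_mono)
    obtain p q where pq: "q \<noteq> 0" "\<forall>\<^sub>F w in at 0. complex_of_real u * w + complex_of_real c\<^sub>0 * w\<^sup>2 +
      (\<Sum>(v, c)\<leftarrow>ps. complex_of_real c * complex_of_real v * w / (1 - complex_of_real v * w)) = poly p w / poly q w"
      using rational_near_0_decomposition[of u c\<^sub>0 ps] unfolding rational_near_0_def by blast
    have "\<forall>\<^sub>F w in at 0. R_transform \<mu> w = poly p w / poly q w"
      using ev pq(2) by eventually_elim simp
    thus ?thesis unfolding rational_near_0_def using pq(1) by blast
  qed
  ultimately show ?thesis using \<mu> by (simp add: M_ratio_fid_def)
qed

section \<open>Cumulants of freely infinitely divisible laws\<close>

text \<open>Only the last power is assumed to be a law; by \<open>is_free_conv_free_conv\<close>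
  this passes down to the earlier ones.\<close>

lemma fps_R_free_conv_power:
  assumes "compact_distr (free_conv_power \<nu> n)"
  shows "fps_R (free_conv_power \<nu> n) = of_nat n * fps_R \<nu>"
  using assms
proof (induction n)
  case 0
  show ?case by (simp add: fps_R_return)
next
  case (Suc n)
  hence "is_free_conv (free_conv_power \<nu> n) \<nu> (free_conv_power \<nu> (Suc n))"
    using is_free_conv_free_conv by simp
  thus ?case using Suc.IH by (simp add: is_free_conv_iff algebra_simps)
qed

text \<open>Restricted to indices up to \<open>j\<close>, because where it is applied only the lower
  coefficients are already known to converge.\<close>

lemma tendsto_fps_nth_power:
  fixes M :: "nat \<Rightarrow> complex fps"
  assumes "\<And>k. k \<le> j \<Longrightarrow> (\<lambda>n. fps_nth (M n) k) \<longlonglongrightarrow> fps_nth L k"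
  shows "k \<le> j \<Longrightarrow> (\<lambda>n. fps_nth (M n ^ i) k) \<longlonglongrightarrow> fps_nth (L ^ i) k"
proof (induction i arbitrary: k)
  case (Suc i)
  have "(\<lambda>n. \<Sum>l=0..k. fps_nth (M n) l * fps_nth (M n ^ i) (k - l)) \<longlonglongrightarrow>
      (\<Sum>l=0..k. fps_nth L l * fps_nth (L ^ i) (k - l))"
    using Suc assms by (intro tendsto_intros) auto
  thus ?case by (simp add: fps_mult_nth)
qed auto

text \<open>If \<open>\<mu>\<close> is the \<open>N\<close>-fold free convolution of \<open>\<mu>\<^sub>N\<close>, the moment series \<open>M\<close> of \<open>\<mu>\<^sub>N\<close> satisfies
  \<open>N * (M - 1) = R oo (X * M)\<close>, so \<open>M\<close> tends to 1 and \<open>N * (M - 1)\<close> to \<open>R oo X = R\<close> coefficientwise.\<close>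

lemma scaled_moments_tendsto_cumulants:
  fixes R :: "complex fps" and M :: "nat \<Rightarrow> complex fps"
  assumes R0: "fps_nth R 0 = 0"
    and M: "\<And>n. 1 + (fps_const (1 / of_nat (Suc n)) * R oo (fps_X * M n)) = M n"
    and m: "m \<ge> 1"
  shows "(\<lambda>n. of_nat (Suc n) * fps_nth (M n) m) \<longlonglongrightarrow> fps_nth R m"
proof -
  have eq: "of_nat (Suc n) * fps_nth (M n) m = (\<Sum>i\<le>m. fps_nth R i * fps_nth (M n ^ i) (m - i))"
    if "m \<ge> 1" for n m
  proof -
    have "fps_nth (M n) m = fps_nth (1 + (fps_const (1 / of_nat (Suc n)) * R oo (fps_X * M n))) m"
      by (simp only: M)
    also have "\<dots> = (\<Sum>i\<le>m. 1 / of_nat (Suc n) * (fps_nth R i * fps_nth (M n ^ i) (m - i)))"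
      using that by (simp add: fps_nth_compose_X_mult mult.assoc del: of_nat_Suc)
    also have "\<dots> = 1 / of_nat (Suc n) * (\<Sum>i\<le>m. fps_nth R i * fps_nth (M n ^ i) (m - i))"
      by (simp only: sum_distrib_left)
    finally show ?thesis by (simp del: of_nat_Suc)
  qed
  \<comment> \<open>Convergence below \<open>m\<close> is a hypothesis here, so that the same
    statement serves in the induction showing that \<open>M n\<close> tends to 1 and in the final
    limit.\<close>
  have rhs: "(\<lambda>n. \<Sum>i\<le>m. fps_nth R i * fps_nth (M n ^ i) (m - i)) \<longlonglongrightarrow> fps_nth R m"
    if m: "m \<ge> 1" and lower: "\<And>k. k < m \<Longrightarrow> (\<lambda>n. fps_nth (M n) k) \<longlonglongrightarrow> fps_nth 1 k" for m
  proof -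
    have "(\<lambda>n. fps_nth R i * fps_nth (M n ^ i) (m - i)) \<longlonglongrightarrow> fps_nth R i * fps_nth (1 ^ i) (m - i)"
      if "i \<le> m" for i
    proof (cases "i = 0")
      case False
      thus ?thesis using that m
        by (intro tendsto_mult tendsto_const tendsto_fps_nth_power[where j = "m - 1"] lower) auto
    qed (simp add: R0)
    hence "(\<lambda>n. \<Sum>i\<le>m. fps_nth R i * fps_nth (M n ^ i) (m - i)) \<longlonglongrightarrow>
        (\<Sum>i\<le>m. fps_nth R i * fps_nth (1 ^ i) (m - i))"
      by (intro tendsto_sum) auto
    \<comment> \<open>Powers of 1 have only a constant coefficient, so just \<open>i = m\<close>
      remains.\<close>
    also have "(\<Sum>i\<le>m. fps_nth R i * fps_nth (1 ^ i) (m - i)) = (\<Sum>i\<le>m. if i = m then fps_nth R i else 0)"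
      by (intro sum.cong refl) auto
    finally show ?thesis by simp
  qed
  have "(\<lambda>n. fps_nth (M n) k) \<longlonglongrightarrow> fps_nth 1 k" for k
  proof (induction k rule: less_induct)
    case (less k)
    show ?case
    proof (cases "k = 0")
      case True
      have "fps_nth (M n) 0 = 1" for n
        using arg_cong[OF M[of n], of "\<lambda>F. fps_nth F 0"] R0 by simp
      thus ?thesis using True by simp
    next
      case False
      hence "(\<lambda>n. 1 / of_nat (Suc n) * (\<Sum>i\<le>k. fps_nth R i * fps_nth (M n ^ i) (k - i))) \<longlonglongrightarrow> 0 * fps_nth R k"
        using less by (intro tendsto_mult rhs LIMSEQ_Suc[OF lim_1_over_n]) auto
      moreover have "1 / of_nat (Suc n) * (\<Sum>i\<le>k. fps_nth R i * fps_nth (M n ^ i) (k - i)) = fps_nth (M n) k" for n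
        using eq[of k n, symmetric] False by (simp del: of_nat_Suc)
      ultimately show ?thesis using False by simp
    qed
  qed
  thus ?thesis unfolding eq[OF m] using m by (intro rhs)
qed

section \<open>Rational R-series and their cumulants\<close>

lemma fps_of_poly_has_fps_expansion: "poly p has_fps_expansion fps_of_poly (p :: complex poly)"
  unfolding has_fps_expansion_def by simp

text \<open>Clearing denominators gives \<open>q f = p\<close> near 0 except at 0; both sides are
  continuous, so the identity holds at 0 too and passes to the series.\<close>

lemma rational_near_0_fps:
  assumes f: "f has_fps_expansion F" and "rational_near_0 f"
  obtains p q where "q \<noteq> 0" "fps_of_poly q * F = fps_of_poly p"
proof -
  obtain p q where pq: "q \<noteq> 0" "\<forall>\<^sub>F w in at 0. f w = poly p w / poly q w"
    using assms(2) by (auto simp: rational_near_0_def)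
  have ev: "\<forall>\<^sub>F w in at 0. poly q w * f w = poly p w"
    using pq(2) eventually_poly_nonzero[OF pq(1)] by eventually_elim simp
  have qf: "(\<lambda>w. poly q w * f w) has_fps_expansion fps_of_poly q * F"
    by (intro fps_expansion_intros f fps_of_poly_has_fps_expansion)
  have "((\<lambda>w. poly q w * f w) \<longlongrightarrow> poly q 0 * f 0) (at 0)"
    using has_fps_expansion_imp_continuous[OF qf, of UNIV] by (simp add: isCont_def)
  moreover have "(poly p \<longlongrightarrow> poly p 0) (at 0)"
    using poly_isCont by (simp add: isCont_def)
  ultimately have "poly q 0 * f 0 = poly p 0"
    using tendsto_cong[OF ev] by (metis (mono_tags) tendsto_unique trivial_limit_at)
  with ev have "\<forall>\<^sub>F w in nhds 0. poly q w * f w = poly p w"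
    by (simp add: eventually_nhds_conv_at)
  hence "fps_of_poly q * F = fps_of_poly p"
    using eq_near_0_iff_fps_eq[OF qf fps_of_poly_has_fps_expansion] by blast
  with pq(1) show ?thesis by (rule that)
qed

text \<open>Beyond \<open>degree p\<close> the coefficients of the product vanish, a recurrence with
  the coefficients of \<open>q\<close> in reverse order. Taking real or imaginary parts, whichever
  keeps the leading coefficient of \<open>q\<close> nonzero, makes it real. The conclusion says that
  the functional with moments \<open>\<kappa> (m + 2)\<close> kills all multiples of
  \<open>Q\<close>.\<close>

lemma linear_recurrence_of_rational:
  fixes q p :: "complex poly" and \<kappa> :: "nat \<Rightarrow> real"
  assumes q: "q \<noteq> 0" and eq: "fps_of_poly q * Abs_fps (\<lambda>m. complex_of_real (\<kappa> m)) = fps_of_poly p"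
  obtains Q :: "real poly" where "Q \<noteq> 0" "\<And>m. (\<Sum>i\<le>degree Q. coeff Q i * \<kappa> (i + m + 2)) = 0"
proof -
  \<comment> \<open>Large enough that \<open>N - j\<close> is a true difference for
    \<open>j \<le> degree q\<close> and that \<open>N + m + 2\<close> exceeds
    \<open>degree p\<close>.\<close>
  define N where "N = degree p + degree q"
  have rec: "(\<Sum>j\<le>degree q. coeff q j * of_real (\<kappa> (N + m + 2 - j))) = 0" for m
  proof -
    have "0 = coeff p (N + m + 2)" by (simp add: N_def coeff_eq_0)
    also have "\<dots> = fps_nth (fps_of_poly q * Abs_fps (\<lambda>m. complex_of_real (\<kappa> m))) (N + m + 2)"
      unfolding eq by simp
    also have "\<dots> = (\<Sum>j=0..N + m + 2. coeff q j * of_real (\<kappa> (N + m + 2 - j)))"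
      by (simp add: fps_mult_nth)
    also have "\<dots> = (\<Sum>j\<le>degree q. coeff q j * of_real (\<kappa> (N + m + 2 - j)))"
      by (intro sum.mono_neutral_right) (auto simp: N_def coeff_eq_0)
    finally show ?thesis by simp
  qed
  obtain g :: "complex \<Rightarrow> real" where g: "g 0 = 0" "g (lead_coeff q) \<noteq> 0"
    "\<And>m. (\<Sum>j\<le>degree q. g (coeff q j) * \<kappa> (N + m + 2 - j)) = 0"
  proof (cases "Re (lead_coeff q) = 0")
    case True
    have "(\<Sum>j\<le>degree q. Im (coeff q j) * \<kappa> (N + m + 2 - j)) = 0" for m
      using arg_cong[OF rec[of m], of Im] by simp
    moreover have "Im (lead_coeff q) \<noteq> 0" using True q by (metis complex_eqI leading_coeff_0_iff zero_complex.sel)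
    ultimately show ?thesis using that[of Im] by simp
  next
    case False
    have "(\<Sum>j\<le>degree q. Re (coeff q j) * \<kappa> (N + m + 2 - j)) = 0" for m
      using arg_cong[OF rec[of m], of Re] by simp
    thus ?thesis using that[of Re] False by simp
  qed
  define Q where "Q = (\<Sum>j\<le>degree q. monom (g (coeff q j)) (N - j))"
  have coeff_Q: "coeff Q i = (\<Sum>j\<le>degree q. if N - j = i then g (coeff q j) else 0)" for i
    by (simp add: Q_def coeff_sum)
  \<comment> \<open>The exponent \<open>N - degree q\<close> arises from \<open>j = degree q\<close>
    alone, so this coefficient is not cancelled.\<close>
  have "coeff Q (N - degree q) = (\<Sum>j\<le>degree q. if j = degree q then g (coeff q j) else 0)"
    unfolding coeff_Q by (intro sum.cong refl) (auto simp: N_def)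
  hence "coeff Q (N - degree q) \<noteq> 0" using g(2) by simp
  hence "Q \<noteq> 0" by auto
  moreover have "(\<Sum>i\<le>degree Q. coeff Q i * \<kappa> (i + m + 2)) = 0" for m
  proof -
    have "degree Q \<le> N"
      unfolding Q_def by (intro degree_sum_le) (auto intro: order.trans[OF degree_monom_le])
    hence "(\<Sum>i\<le>degree Q. coeff Q i * \<kappa> (i + m + 2)) = (\<Sum>i\<le>N. coeff Q i * \<kappa> (i + m + 2))"
      by (intro sum.mono_neutral_left) (auto simp: coeff_eq_0)
    also have "\<dots> = (\<Sum>i\<le>N. \<Sum>j\<le>degree q. if N - j = i then g (coeff q j) * \<kappa> (i + m + 2) else 0)"
      unfolding coeff_Q sum_distrib_right by (intro sum.cong refl) auto
    also have "\<dots> = (\<Sum>j\<le>degree q. \<Sum>i\<le>N. if N - j = i then g (coeff q j) * \<kappa> (i + m + 2) else 0)"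
      by (rule sum.swap)
    also have "\<dots> = (\<Sum>j\<le>degree q. g (coeff q j) * \<kappa> (N + m + 2 - j))"
    proof (rule sum.cong[OF refl])
      fix j assume "j \<in> {..degree q}"
      hence N_j: "N - j + m + 2 = N + m + 2 - j" by (simp add: N_def)
      have "(\<Sum>i\<le>N. if N - j = i then g (coeff q j) * \<kappa> (i + m + 2) else 0) = g (coeff q j) * \<kappa> (N - j + m + 2)"
        by simp
      thus "(\<Sum>i\<le>N. if N - j = i then g (coeff q j) * \<kappa> (i + m + 2) else 0) = g (coeff q j) * \<kappa> (N + m + 2 - j)"
        by (simp only: N_j)
    qed
    finally show ?thesis using g(3) by simp
  qed
  ultimately show ?thesis by (rule that)
qed

text \<open>The cumulants \<open>\<kappa> (m + 2)\<close> are the moments of the weak limit of the measures \<open>N x\<^sup>2 d\<mu>\<^sub>N\<close>, hence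
  positive definite. If they also satisfy a linear recurrence, they come from finitely many atoms.\<close>

lemma M_ratio_fid_cumulants:
  assumes "\<mu> \<in> M_ratio_fid"
  obtains V w \<kappa>\<^sub>1 where "finite V" "\<And>v. v \<in> V \<Longrightarrow> w v \<ge> 0"
    "fps_R \<mu> = Abs_fps (\<lambda>m. complex_of_real (if m = 0 then 0 else if m = 1 then \<kappa>\<^sub>1 else (\<Sum>v\<in>V. w v * v ^ (m - 2))))"
proof -
  have \<mu>: "compact_distr \<mu>" and fid: "freely_inf_divisible \<mu>" and rat: "rational_near_0 (R_transform \<mu>)"
    using assms by (auto simp: M_ratio_fid_def)
  have "\<forall>n. \<exists>\<nu>. compact_distr \<nu> \<and> \<mu> = free_conv_power \<nu> (Suc n)"
    using fid unfolding freely_inf_divisible_def by (metis le_add1 plus_1_eq_Suc)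
  hence "\<exists>\<nu>. \<forall>n. compact_distr (\<nu> n) \<and> \<mu> = free_conv_power (\<nu> n) (Suc n)" by (rule choice)
  then obtain \<nu> where \<nu>: "\<And>n. compact_distr (\<nu> n)" "\<And>n. \<mu> = free_conv_power (\<nu> n) (Suc n)"
    by blast
  have R_\<nu>: "fps_R (\<nu> n) = fps_const (1 / of_nat (Suc n)) * fps_R \<mu>" for n
  proof -
    have "fps_R \<mu> = of_nat (Suc n) * fps_R (\<nu> n)"
      using fps_R_free_conv_power[of "\<nu> n" "Suc n", folded \<nu>(2)[of n]] \<mu> by blast
    hence "fps_const (1 / of_nat (Suc n)) * fps_R \<mu> =
        (fps_const (1 / of_nat (Suc n)) * fps_const (of_nat (Suc n))) * fps_R (\<nu> n)"
      by (simp only: mult.assoc fps_of_nat)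
    also have "fps_const (1 / of_nat (Suc n)) * fps_const (of_nat (Suc n)) = (1 :: complex fps)"
      by (simp del: of_nat_Suc)
    finally show ?thesis by simp
  qed
  define \<kappa> where "\<kappa> m = Re (fps_nth (fps_R \<mu>) m)" for m
  have lim: "(\<lambda>n. complex_of_real (real (Suc n) * (\<integral>x. x ^ m \<partial>\<nu> n))) \<longlonglongrightarrow> fps_nth (fps_R \<mu>) m"
    if "m \<ge> 1" for m
  proof -
    have "(\<lambda>n. of_nat (Suc n) * fps_nth (fps_M (\<nu> n)) m) \<longlonglongrightarrow> fps_nth (fps_R \<mu>) m"
      by (rule scaled_moments_tendsto_cumulants[OF fps_R_0[OF \<mu>] _ that])
         (rule fps_R_eq[OF \<nu>(1), unfolded R_\<nu>])
    thus ?thesis by (simp add: fps_M_nth del: of_nat_Suc)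
  qed
  have lim_\<kappa>: "(\<lambda>n. real (Suc n) * (\<integral>x. x ^ m \<partial>\<nu> n)) \<longlonglongrightarrow> \<kappa> m" if "m \<ge> 1" for m
    using tendsto_Re[OF lim[OF that]] unfolding \<kappa>_def Re_complex_of_real .
  have R_\<kappa>: "fps_R \<mu> = Abs_fps (\<lambda>m. complex_of_real (\<kappa> m))"
  proof (rule fps_ext)
    fix m
    have "Im (fps_nth (fps_R \<mu>) m) = 0"
    proof (cases "m = 0")
      case False
      thus ?thesis using tendsto_Im[OF lim[of m]] by (simp add: LIMSEQ_const_iff)
    qed (simp add: fps_R_0[OF \<mu>])
    thus "fps_nth (fps_R \<mu>) m = fps_nth (Abs_fps (\<lambda>m. complex_of_real (\<kappa> m))) m"
      by (simp add: \<kappa>_def complex_eq_iff)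
  qed
  \<comment> \<open>The functional with moments shifted by 2: the limit of \<open>N\<close> times
    the integral of \<open>x^2 p x\<close> under the \<open>N\<close>-th root of \<mu>.\<close>
  define L where "L p = (\<Sum>i\<le>degree p. coeff p i * \<kappa> (i + 2))" for p :: "real poly"
  have int_poly: "integrable (\<nu> n) (\<lambda>x. x\<^sup>2 * poly p x)" and
    int_eq: "(\<integral>x. x\<^sup>2 * poly p x \<partial>\<nu> n) = (\<Sum>i\<le>degree p. coeff p i * (\<integral>x. x ^ (i + 2) \<partial>\<nu> n))" for n p
  proof -
    have eq: "x\<^sup>2 * poly p x = (\<Sum>i\<le>degree p. coeff p i * x ^ (i + 2))" for x
      by (simp add: poly_altdef sum_distrib_left power2_eq_square mult_ac)
    have int: "integrable (\<nu> n) (\<lambda>x. coeff p i * x ^ (i + 2))" for i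
      by (intro integrable_mult_right compact_distr_integrable_power \<nu>(1))
    show "integrable (\<nu> n) (\<lambda>x. x\<^sup>2 * poly p x)"
      unfolding eq using int by (rule Bochner_Integration.integrable_sum)
    show "(\<integral>x. x\<^sup>2 * poly p x \<partial>\<nu> n) = (\<Sum>i\<le>degree p. coeff p i * (\<integral>x. x ^ (i + 2) \<partial>\<nu> n))"
      unfolding eq Bochner_Integration.integral_sum[OF int] integral_mult_right_zero ..
  qed
  have L_lim: "(\<lambda>n. real (Suc n) * (\<integral>x. x\<^sup>2 * poly p x \<partial>\<nu> n)) \<longlonglongrightarrow> L p" for p
  proof -
    have "(\<lambda>n. \<Sum>i\<le>degree p. coeff p i * (real (Suc n) * (\<integral>x. x ^ (i + 2) \<partial>\<nu> n))) \<longlonglongrightarrow> L p"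
      unfolding L_def by (intro tendsto_sum tendsto_mult tendsto_const lim_\<kappa>) auto
    thus ?thesis unfolding int_eq sum_distrib_left by (simp only: mult.left_commute)
  qed
  \<comment> \<open>Linearity is read off from the limit, since the range of summation in
    \<open>L\<close> changes with the degree.\<close>
  have L_add: "L (p + q) = L p + L q" for p q
  proof (rule LIMSEQ_unique[OF L_lim])
    have "(\<integral>x. x\<^sup>2 * poly (p + q) x \<partial>\<nu> n) = (\<integral>x. x\<^sup>2 * poly p x \<partial>\<nu> n) + (\<integral>x. x\<^sup>2 * poly q x \<partial>\<nu> n)" for n
      using int_poly[of n p] int_poly[of n q] by (simp add: distrib_left)
    thus "(\<lambda>n. real (Suc n) * (\<integral>x. x\<^sup>2 * poly (p + q) x \<partial>\<nu> n)) \<longlonglongrightarrow> L p + L q"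
      using tendsto_add[OF L_lim[of p] L_lim[of q]] by (simp only: distrib_left)
  qed
  have L_smult: "L (smult c p) = c * L p" for c p
  proof (rule LIMSEQ_unique[OF L_lim])
    have "(\<integral>x. x\<^sup>2 * poly (smult c p) x \<partial>\<nu> n) = c * (\<integral>x. x\<^sup>2 * poly p x \<partial>\<nu> n)" for n
      unfolding poly_smult mult.left_commute[of _ c] by simp
    thus "(\<lambda>n. real (Suc n) * (\<integral>x. x\<^sup>2 * poly (smult c p) x \<partial>\<nu> n)) \<longlonglongrightarrow> c * L p"
      using tendsto_mult[OF tendsto_const[of c] L_lim[of p]] by (simp only: mult.left_commute)
  qed
  have L_pos: "L (p * p) \<ge> 0" for p
  proof (rule LIMSEQ_le_const[OF L_lim])
    show "\<exists>N. \<forall>n\<ge>N. 0 \<le> real (Suc n) * (\<integral>x. x\<^sup>2 * poly (p * p) x \<partial>\<nu> n)"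
      by (auto intro!: mult_nonneg_nonneg Bochner_Integration.integral_nonneg simp del: of_nat_Suc)
  qed
  obtain p q where "q \<noteq> 0" "fps_of_poly q * fps_R \<mu> = fps_of_poly p"
    using rational_near_0_fps[OF R_transform_has_fps_expansion[OF \<mu>] rat] by blast
  then obtain Q :: "real poly" where Q: "Q \<noteq> 0" "\<And>m. (\<Sum>i\<le>degree Q. coeff Q i * \<kappa> (i + m + 2)) = 0"
    unfolding R_\<kappa> using linear_recurrence_of_rational by blast
  have L_monom: "L (monom 1 m) = \<kappa> (m + 2)" for m
    by (simp add: L_def degree_monom_eq if_distrib[of "\<lambda>c. c * _"] cong: if_cong)
  have L_sum: "L (\<Sum>i\<in>A. smult (g i) (h i)) = (\<Sum>i\<in>A. g i * L (h i))" if "finite A" for A :: "nat set" and g h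
    using that
  proof induction
    case empty
    show ?case using L_smult[of 0 0] by simp
  qed (simp_all add: L_add L_smult)
  have poly_sum_monom: "p = (\<Sum>i\<le>degree p. smult (coeff p i) (monom 1 i))" for p :: "real poly"
    by (subst poly_as_sum_of_monoms[of p, symmetric]) (simp add: smult_monom)
  have Q_monom: "L (Q * monom 1 m) = 0" for m
  proof -
    have "Q * monom 1 m = (\<Sum>i\<le>degree Q. smult (coeff Q i) (monom 1 (i + m)))"
      by (subst poly_sum_monom[of Q]) (simp add: sum_distrib_right mult_monom)
    hence "L (Q * monom 1 m) = (\<Sum>i\<le>degree Q. coeff Q i * L (monom 1 (i + m)))"
      by (simp only: L_sum finite_atMost)
    thus ?thesis using Q(2)[of m] by (simp only: L_monom)
  qed
  have Q_null: "L (Q * p) = 0" for p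
  proof -
    have "Q * p = (\<Sum>i\<le>degree p. smult (coeff p i) (Q * monom 1 i))"
      by (subst poly_sum_monom[of p]) (simp add: sum_distrib_left)
    thus ?thesis by (simp only: L_sum finite_atMost Q_monom) simp
  qed
  obtain V w where V: "finite V" "\<And>v. v \<in> V \<Longrightarrow> w v \<ge> 0" "\<And>p. L p = (\<Sum>v\<in>V. w v * poly p v)"
    by (rule positive_functional_atomic[of L Q]) (use L_add L_smult L_pos Q(1) Q_null in auto)
  have "\<kappa> m = (\<Sum>v\<in>V. w v * v ^ (m - 2))" if "m \<ge> 2" for m
  proof -
    have "m - 2 + 2 = m" using that by simp
    thus ?thesis using L_monom[of "m - 2"] V(3)[of "monom 1 (m - 2)"] by (simp only: poly_monom mult_1)
  qed
  moreover have "\<kappa> 0 = 0" using fps_R_0[OF \<mu>] by (simp add: \<kappa>_def)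
  ultimately have "\<kappa> m = (if m = 0 then 0 else if m = 1 then \<kappa> 1 else (\<Sum>v\<in>V. w v * v ^ (m - 2)))" for m
    by auto
  thus ?thesis using that[of V w "\<kappa> 1"] V(1,2) R_\<kappa> by auto
qed

text \<open>An atom of weight \<open>w v\<close> at \<open>v \<noteq> 0\<close> contributes the
  higher cumulants of a Marchenko-Pastur law with parameter \<open>w v / v^2\<close>; an atom at 0
  contributes only at \<open>m = 2\<close>. The first cumulant is corrected by
  \<open>u\<close>.\<close>

lemma M_ratio_fid_imp_free_decomposition:
  assumes "\<mu> \<in> M_ratio_fid"
  shows "\<exists>u c\<^sub>0 ps. free_decomposition \<mu> u c\<^sub>0 ps"
proof -
  obtain V w \<kappa>\<^sub>1 where V: "finite V" "\<And>v. v \<in> V \<Longrightarrow> w v \<ge> 0"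
    and R: "fps_R \<mu> = Abs_fps (\<lambda>m. complex_of_real (if m = 0 then 0 else if m = 1 then \<kappa>\<^sub>1 else (\<Sum>v\<in>V. w v * v ^ (m - 2))))"
    using M_ratio_fid_cumulants[OF assms] by blast
  \<comment> \<open>Atoms of weight 0 are dropped as well, since each \<open>c\<close> must be
    strictly positive.\<close>
  define V' where "V' = {v \<in> V. v \<noteq> 0 \<and> w v \<noteq> 0}"
  have V': "finite V'" using V(1) by (simp add: V'_def)
  define ps where "ps = map (\<lambda>v. (v, w v / v\<^sup>2)) (sorted_list_of_set V')"
  define c\<^sub>0 where "c\<^sub>0 = (if 0 \<in> V then w 0 else 0)"
  define u where "u = \<kappa>\<^sub>1 - (\<Sum>(v, c)\<leftarrow>ps. c * v)"
  have sum_ps: "(\<Sum>(v, c)\<leftarrow>ps. c * v ^ m) = (\<Sum>v\<in>V'. w v / v\<^sup>2 * v ^ m)" for m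
    using V' by (simp add: ps_def o_def sum_list_distinct_conv_sum_set)
  have "cumulant u c\<^sub>0 ps m = (if m = 0 then 0 else if m = 1 then \<kappa>\<^sub>1 else (\<Sum>v\<in>V. w v * v ^ (m - 2)))" for m
  proof (cases "m < 2")
    case True
    thus ?thesis by (auto simp: cumulant_def u_def less_2_cases_iff)
  next
    case False
    have "(\<Sum>v\<in>V'. w v / v\<^sup>2 * v ^ m) = (\<Sum>v\<in>V'. w v * v ^ (m - 2))"
    proof (rule sum.cong[OF refl])
      fix v assume "v \<in> V'"
      moreover have "v ^ m = v\<^sup>2 * v ^ (m - 2)"
        using False by (metis le_add_diff_inverse linorder_not_less power_add)
      ultimately show "w v / v\<^sup>2 * v ^ m = w v * v ^ (m - 2)" by (simp add: V'_def)
    qed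
    also have "\<dots> = (\<Sum>v\<in>V - {0}. w v * v ^ (m - 2))"
      using V(1) by (intro sum.mono_neutral_left) (auto simp: V'_def)
    finally have "(\<Sum>v\<in>V'. w v / v\<^sup>2 * v ^ m) = (\<Sum>v\<in>V - {0}. w v * v ^ (m - 2))" .
    moreover have "(\<Sum>v\<in>V. w v * v ^ (m - 2)) =
        (if m = 2 then c\<^sub>0 else 0) + (\<Sum>v\<in>V - {0}. w v * v ^ (m - 2))"
      using V(1) False by (cases "0 \<in> V") (auto simp: sum.remove c\<^sub>0_def power_0_left)
    ultimately show ?thesis using False by (simp add: cumulant_def sum_ps)
  qed
  hence "fps_R \<mu> = decomposition_fps u c\<^sub>0 ps" by (simp add: R decomposition_fps_def)
  moreover have "c\<^sub>0 \<ge> 0" using V(2) by (simp add: c\<^sub>0_def)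
  moreover have "\<forall>(v, c)\<in>set ps. v \<noteq> 0 \<and> c > 0"
    using V' V(2) by (force simp: ps_def V'_def)
  moreover have "distinct (map fst ps)" using V' by (simp add: ps_def o_def)
  moreover have "compact_distr \<mu>" using assms by (simp add: M_ratio_fid_def)
  ultimately have "free_decomposition \<mu> u c\<^sub>0 ps" by (simp add: free_decomposition_iff)
  thus ?thesis by blast
qed

theorem theorem4p1:
  fixes \<mu> :: "real measure"
  assumes "compact_distr \<mu>"
  shows "(\<mu> \<in> M_ratio_fid \<longleftrightarrow> (\<exists>u c\<^sub>0 ps. free_decomposition \<mu> u c\<^sub>0 ps)) \<and>
    (\<forall>u c\<^sub>0 ps. free_decomposition \<mu> u c\<^sub>0 ps \<longrightarrow>
      (\<forall>\<^sub>F w in nhds 0. R_transform \<mu> w =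
         complex_of_real u * w + complex_of_real c\<^sub>0 * w\<^sup>2 +
         (\<Sum>(v, c)\<leftarrow>ps. complex_of_real c * complex_of_real v * w / (1 - complex_of_real v * w)))) \<and>
    (\<forall>u c\<^sub>0 ps u' c\<^sub>0' ps'.
      free_decomposition \<mu> u c\<^sub>0 ps \<longrightarrow> free_decomposition \<mu> u' c\<^sub>0' ps' \<longrightarrow>
      u = u' \<and> c\<^sub>0 = c\<^sub>0' \<and> mset ps = mset ps')"
proof (intro conjI iffI)
  show "\<exists>u c\<^sub>0 ps. free_decomposition \<mu> u c\<^sub>0 ps" if "\<mu> \<in> M_ratio_fid"
    using that by (rule M_ratio_fid_imp_free_decomposition)
  show "\<mu> \<in> M_ratio_fid" if "\<exists>u c\<^sub>0 ps. free_decomposition \<mu> u c\<^sub>0 ps"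
    using that free_decomposition_imp_M_ratio_fid by (auto simp: free_decomposition_iff)
  show "\<forall>u c\<^sub>0 ps. free_decomposition \<mu> u c\<^sub>0 ps \<longrightarrow>
      (\<forall>\<^sub>F w in nhds 0. R_transform \<mu> w =
         complex_of_real u * w + complex_of_real c\<^sub>0 * w\<^sup>2 +
         (\<Sum>(v, c)\<leftarrow>ps. complex_of_real c * complex_of_real v * w / (1 - complex_of_real v * w)))"
    using eq_near_0_iff_fps_eq[OF R_transform_has_fps_expansion[OF assms] has_fps_expansion_decomposition]
    by (auto simp: free_decomposition_iff)
  show "\<forall>u c\<^sub>0 ps u' c\<^sub>0' ps'.
      free_decomposition \<mu> u c\<^sub>0 ps \<longrightarrow> free_decomposition \<mu> u' c\<^sub>0' ps' \<longrightarrow>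
      u = u' \<and> c\<^sub>0 = c\<^sub>0' \<and> mset ps = mset ps'"
    unfolding free_decomposition_iff using decomposition_unique by metis
qed

end
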